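(* Let $\mathbb K$ be a field and let $A,A^*$ be a Leonard pair over $\mathbb K$. Then the map sending each parameter array $p$ of $A,A^*$ to the pair $p^T,p^D$ is a bijection from the set of parameter arrays for $A,A^*$ to the set of $TD$-$D$ canonical forms for $A,A^*$. The inverse bijection sends each $TD$-$D$ canonical form for $A,A^*$ to its designated parameter array.
   Context: $\mathrm{Mat}_{d+1}(\mathbb K)$ is the algebra of $(d+1)\times(d+1)$ matrices over $\mathbb K$, rows and columns indexed by $0,1,\dots,d$. A matrix is tridiagonal if every nonzero entry lies on the diagonal, subdiagonal or superdiagonal. Leonard pairs and systems. Let $\mathcal A$ be a $\mathbb K$-algebra isomorphic to $\mathrm{Mat}_{d+1}(\mathbb K)$, $d\ge0$. An element $A\in\mathcal A$ is multiplicity-free if it has $d+1$ distinct eigenvalues in $\mathbb K$; if these are $\theta_0,\dots,\theta_d$, the primitive idempotent of $A$ associated with $\theta_i$ is $E_i=\prod_{j\ne i}(A-\theta_jI)/(\theta_i-\theta_j)$. For multiplicity-free $A,A^*\in\mathcal A$ ($A^*$ is just a name, not an adjoint), an idempotent sequence for $A,A^*$ is an ordering $E_0,\dots,E_d$ of the primitive idempotents of $A$ such that $E_iA^*E_j=0$ if $|i-j|>1$ and $E_iA^*E_j\ne0$ if $|i-j|=1$ ($0\le i,j\le d$); a dual idempotent sequence for $A,A^*$ is an idempotent sequence for $A^*,A$. A Leonard pair in $\mathcal A$ (with ambient algebra $\mathcal A$, over $\mathbb K$, of diameter $d$) is an ordered pair $A,A^*$ of multiplicity-free elements of $\mathcal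 A$ for which an idempotent sequence and a dual idempotent sequence exist. A Leonard system in $\mathcal A$ is a sequence $\Phi=(A,A^*;E_i,E^*_i,i=0..d)$ where $A,A^*\in\mathcal A$ are multiplicity-free, $E_0,\dots,E_d$ is an idempotent sequence for $A,A^*$ and $E^*_0,\dots,E^*_d$ is a dual idempotent sequence for $A,A^*$; then $A,A^*$ is a Leonard pair, said to be associated with $\Phi$. The eigenvalue sequence (resp. dual eigenvalue sequence) of $\Phi$ is $\theta_0,\dots,\theta_d$ (resp. $\theta^*_0,\dots,\theta^*_d$), where $\theta_i$ (resp. $\theta^*_i$) is the eigenvalue of $A$ (resp. $A^*$) associated with $E_i$ (resp. $E^*_i$). An eigenvalue sequence of a Leonard pair is the eigenvalue sequence of an associated Leonard system; if $\theta_0,\dots,\theta_d$ is one, then the only other one is $\theta_d,\dots,\theta_0$. Leonard pairs $A,A^*$ and $B,B^*$ are isomorphic if there is a $\mathbb K$-algebra isomorphism between their ambient algebras sending $A$ to $B$ and $A^*$ to $B^*$. Split sequences. Let $V$ be an irreducible left $\mathcal A$-module (unique up to isomorphism, of dimension $d+1$) and set $U_i=(E^*_0V+\cdots+E^*_iV)\cap(E_iV+\cdots+E_dV)$. It is known that each $U_i$ has dimension 1, $V$ is the direct sum of $U_0,\dots,U_d$, $(A-\theta_iI)U_i=U_{i+1}$ ($0\le i\le d-1$), $(A-\theta_dI)U_d=0$, $(A^*-\theta^*_iI)U_i=U_{i-1}$ ($1\le i\le d$), $(A^*-\theta_0^*I)U_0=0$. For $1\le i\le d$, $\varphi_i$ is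 the (nonzero) eigenvalue of $(A-\theta_{i-1}I)(A^*-\theta^*_iI)$ on $U_i$. The sequence $\varphi_1,\dots,\varphi_d$ is the first split sequence of $\Phi$. The second split sequence $\phi_1,\dots,\phi_d$ of $\Phi$ is the first split sequence of $\Phi^\Downarrow=(A,A^*;E_{d-i},E^*_i,i=0..d)$. The parameter array of $\Phi$ is $(\theta_i,\theta^*_i,i=0..d;\varphi_j,\phi_j,j=1..d)$, formed from its eigenvalue, dual eigenvalue, first split and second split sequences. It is known that two Leonard systems over $\mathbb K$ are isomorphic if and only if they have the same parameter array. A parameter array of a Leonard pair is the parameter array of an associated Leonard system; if $p=(\theta_i,\theta^*_i,i=0..d;\varphi_j,\phi_j,j=1..d)$ is one, then all of them are $p$, $(\theta_i,\theta^*_{d-i},i=0..d;\phi_{d-j+1},\varphi_{d-j+1},j=1..d)$, $(\theta_{d-i},\theta^*_i,i=0..d;\phi_j,\varphi_j,j=1..d)$, $(\theta_{d-i},\theta^*_{d-i},i=0..d;\varphi_{d-j+1},\phi_{d-j+1},j=1..d)$. The matrices $p^T,p^D$. For $p=(\theta_i,\theta^*_i,i=0..d;\varphi_j,\phi_j,j=1..d)$, $p^T\in\mathrm{Mat}_{d+1}(\mathbb K)$ is the tridiagonal matrix with diagonal entries $p^T_{ii}=\theta_i+\frac{\varphi_i}{\theta^*_i-\theta^*_{i-1}}+\frac{\varphi_{i+1}}{\theta^*_i-\theta^*_{i+1}}$ ($0\le i\le d$), where $\varphi_0=\varphi_{d+1}=0$ and $\theta^*_{-1},\theta^*_{d+1}$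 are indeterminates (so terms with numerator $\varphi_0$ or $\varphi_{d+1}$ vanish), and, for $1\le i\le d$, $$p^T_{i-1,i}=\varphi_i\frac{\prod_{h=0}^{i-2}(\theta^*_{i-1}-\theta^*_h)}{\prod_{h=0}^{i-1}(\theta^*_i-\theta^*_h)},\qquad p^T_{i,i-1}=\phi_i\frac{\prod_{h=i+1}^{d}(\theta^*_i-\theta^*_h)}{\prod_{h=i}^{d}(\theta^*_{i-1}-\theta^*_h)}.$$ Also $p^D=\mathrm{diag}(\theta^*_0,\dots,\theta^*_d)$. $TD$-$D$ canonical form. A Leonard pair $A,A^*$ with eigenvalue sequence $\theta_0,\dots,\theta_d$ is in $TD$-$D$ canonical form if its ambient algebra is $\mathrm{Mat}_{d+1}(\mathbb K)$, $A$ is tridiagonal and $A^*$ is diagonal, and $A$ has constant row sum (all row sums equal) with this sum equal to $\theta_0$ or $\theta_d$. For such a pair there is a unique eigenvalue sequence $\theta_0,\dots,\theta_d$ with $A$ having constant row sum $\theta_0$, and $A^*_{00},\dots,A^*_{dd}$ is a dual eigenvalue sequence; the designated Leonard system of the pair is the associated Leonard system with this eigenvalue sequence and with dual eigenvalue sequence $A^*_{00},\dots,A^*_{dd}$, and the designated parameter array of the pair is the parameter array of its designated Leonard system. A $TD$-$D$ canonical form for a Leonard pair $A,A^*$ is a Leonard pair over $\mathbb K$ which is isomorphic to $A,A^*$ and which is in $TD$-$D$ canonical form. *)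

theory Defs
  imports
    "Jordan_Normal_Form.VS_Connect"
    "Jordan_Normal_Form.Char_Poly"
    "HOL-Algebra.QuotRing"
begin

(* The locale "algebra" of HOL-Algebra is restricted to commutative algebras. *)
definition assoc_algebra :: "('k::field, 'a, 'm) module_scheme \<Rightarrow> bool" where
  "assoc_algebra \<A> \<longleftrightarrow> ring \<A> \<and> Module.module class_ring \<A> \<and>
     (\<forall>c. \<forall>x\<in>carrier \<A>. \<forall>y\<in>carrier \<A>.
        (c \<odot>\<^bsub>\<A>\<^esub> x) \<otimes>\<^bsub>\<A>\<^esub> y = c \<odot>\<^bsub>\<A>\<^esub> (x \<otimes>\<^bsub>\<A>\<^esub> y) \<and>
        x \<otimes>\<^bsub>\<A>\<^esub> (c \<odot>\<^bsub>\<A>\<^esub> y) = c \<odot>\<^bsub>\<A>\<^esub> (x \<otimes>\<^bsub>\<A>\<^esub> y))"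

definition algebra_iso ::
    "('k::field, 'a, 'm) module_scheme \<Rightarrow> ('k, 'b, 'n) module_scheme \<Rightarrow> ('a \<Rightarrow> 'b) set" where
  "algebra_iso \<A> \<B> =
     {h \<in> ring_iso \<A> \<B>. \<forall>c. \<forall>x\<in>carrier \<A>. h (c \<odot>\<^bsub>\<A>\<^esub> x) = c \<odot>\<^bsub>\<B>\<^esub> h x}"

abbreviation mat_algebra :: "nat \<Rightarrow> ('k::field, 'k mat) module" where
  "mat_algebra d \<equiv> module_mat TYPE('k) (d + 1) (d + 1)"

definition matrix_algebra :: "nat \<Rightarrow> ('k::field, 'a, 'm) module_scheme \<Rightarrow> bool" where
  "matrix_algebra d \<A> \<longleftrightarrow>
     assoc_algebra \<A> \<and> algebra_iso \<A> (mat_algebra d :: ('k, 'k mat) module) \<noteq> {}"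

(* The eigenvalues of an element are those of any matrix representing it; this does not depend
   on the isomorphism, since an isomorphism preserves invertibility of a - t1. *)
definition alg_eigenvalue ::
    "nat \<Rightarrow> ('k::field, 'a, 'm) module_scheme \<Rightarrow> 'a \<Rightarrow> 'k \<Rightarrow> bool" where
  "alg_eigenvalue d \<A> a t \<longleftrightarrow> (\<exists>h\<in>algebra_iso \<A> (mat_algebra d). eigenvalue (h a) t)"

definition multiplicity_free :: "nat \<Rightarrow> ('k::field, 'a, 'm) module_scheme \<Rightarrow> 'a \<Rightarrow> bool" where
  "multiplicity_free d \<A> a \<longleftrightarrow>
     a \<in> carrier \<A> \<and> card {t. alg_eigenvalue d \<A> a t} = d + 1"

definition alg_shift :: "('k::field, 'a, 'm) module_scheme \<Rightarrow> 'a \<Rightarrow> 'k \<Rightarrow> 'a" where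
  "alg_shift \<A> a t = a \<ominus>\<^bsub>\<A>\<^esub> (t \<odot>\<^bsub>\<A>\<^esub> \<one>\<^bsub>\<A>\<^esub>)"

(* "finprod" needs a commutative monoid, hence a product along a list (the factors commute). *)
definition primitive_idempotent ::
    "nat \<Rightarrow> ('k::field, 'a, 'm) module_scheme \<Rightarrow> 'a \<Rightarrow> (nat \<Rightarrow> 'k) \<Rightarrow> nat \<Rightarrow> 'a" where
  "primitive_idempotent d \<A> a \<theta> i =
     foldr (\<lambda>j x. (inverse (\<theta> i - \<theta> j) \<odot>\<^bsub>\<A>\<^esub> alg_shift \<A> a (\<theta> j)) \<otimes>\<^bsub>\<A>\<^esub> x)
       (filter (\<lambda>j. j \<noteq> i) [0..<d + 1]) \<one>\<^bsub>\<A>\<^esub>"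

(* E_0, ..., E_d is an ordering of the primitive idempotents of a, and \<theta>_i is the eigenvalue
   associated with E_i.  Finite sequences are functions that are "undefined" outside their
   index range, so that equality of sequences is equality of functions. *)
definition idempotent_ordering ::
    "nat \<Rightarrow> ('k::field, 'a, 'm) module_scheme \<Rightarrow> 'a \<Rightarrow> (nat \<Rightarrow> 'k) \<Rightarrow> (nat \<Rightarrow> 'a) \<Rightarrow> bool" where
  "idempotent_ordering d \<A> a \<theta> E \<longleftrightarrow>
     \<theta> \<in> {0..d} \<rightarrow>\<^sub>E UNIV \<and> E \<in> {0..d} \<rightarrow>\<^sub>E carrier \<A> \<and>
     bij_betw \<theta> {0..d} {t. alg_eigenvalue d \<A> a t} \<and>
     (\<forall>i\<in>{0..d}. E i = primitive_idempotent d \<A> a \<theta> i)"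

definition idempotent_sequence ::
    "nat \<Rightarrow> ('k::field, 'a, 'm) module_scheme \<Rightarrow> 'a \<Rightarrow> 'a \<Rightarrow> (nat \<Rightarrow> 'a) \<Rightarrow> bool" where
  "idempotent_sequence d \<A> A As E \<longleftrightarrow>
     (\<exists>\<theta>. idempotent_ordering d \<A> A \<theta> E) \<and>
     (\<forall>i\<in>{0..d}. \<forall>j\<in>{0..d}.
        (\<bar>int i - int j\<bar> > 1 \<longrightarrow> E i \<otimes>\<^bsub>\<A>\<^esub> As \<otimes>\<^bsub>\<A>\<^esub> E j = \<zero>\<^bsub>\<A>\<^esub>) \<and>
        (\<bar>int i - int j\<bar> = 1 \<longrightarrow> E i \<otimes>\<^bsub>\<A>\<^esub> As \<otimes>\<^bsub>\<A>\<^esub> E j \<noteq> \<zero>\<^bsub>\<A>\<^esub>))"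

definition leonard_pair :: "nat \<Rightarrow> ('k::field, 'a, 'm) module_scheme \<Rightarrow> 'a \<Rightarrow> 'a \<Rightarrow> bool" where
  "leonard_pair d \<A> A As \<longleftrightarrow> matrix_algebra d \<A> \<and>
     multiplicity_free d \<A> A \<and> multiplicity_free d \<A> As \<and>
     (\<exists>E. idempotent_sequence d \<A> A As E) \<and> (\<exists>Es. idempotent_sequence d \<A> As A Es)"

definition leonard_system ::
    "nat \<Rightarrow> ('k::field, 'a, 'm) module_scheme \<Rightarrow> 'a \<Rightarrow> 'a \<Rightarrow> (nat \<Rightarrow> 'a) \<Rightarrow> (nat \<Rightarrow> 'a) \<Rightarrow> bool" where
  "leonard_system d \<A> A As E Es \<longleftrightarrow> matrix_algebra d \<A> \<and>
     multiplicity_free d \<A> A \<and> multiplicity_free d \<A> As \<and>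
     idempotent_sequence d \<A> A As E \<and> idempotent_sequence d \<A> As A Es"

definition leonard_pair_iso ::
    "('k::field, 'a, 'm) module_scheme \<Rightarrow> 'a \<Rightarrow> 'a \<Rightarrow>
     ('k, 'b, 'n) module_scheme \<Rightarrow> 'b \<Rightarrow> 'b \<Rightarrow> bool" where
  "leonard_pair_iso \<A> A As \<B> B Bs \<longleftrightarrow> (\<exists>h\<in>algebra_iso \<A> \<B>. h A = B \<and> h As = Bs)"

(* The record "module" of HOL-Algebra serves for left modules over the ring R; the scalar
   multiplication is the action of R (the locale "module" wants R commutative). *)
definition left_module :: "('a, 'r) ring_scheme \<Rightarrow> ('a, 'v) module \<Rightarrow> bool" where
  "left_module R V \<longleftrightarrow> ring R \<and> abelian_group V \<and>
     (\<forall>a\<in>carrier R. \<forall>v\<in>carrier V. a \<odot>\<^bsub>V\<^esub> v \<in> carrier V) \<and>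
     (\<forall>a\<in>carrier R. \<forall>b\<in>carrier R. \<forall>v\<in>carrier V.
        (a \<oplus>\<^bsub>R\<^esub> b) \<odot>\<^bsub>V\<^esub> v = a \<odot>\<^bsub>V\<^esub> v \<oplus>\<^bsub>V\<^esub> b \<odot>\<^bsub>V\<^esub> v \<and>
        (a \<otimes>\<^bsub>R\<^esub> b) \<odot>\<^bsub>V\<^esub> v = a \<odot>\<^bsub>V\<^esub> (b \<odot>\<^bsub>V\<^esub> v)) \<and>
     (\<forall>a\<in>carrier R. \<forall>v\<in>carrier V. \<forall>w\<in>carrier V.
        a \<odot>\<^bsub>V\<^esub> (v \<oplus>\<^bsub>V\<^esub> w) = a \<odot>\<^bsub>V\<^esub> v \<oplus>\<^bsub>V\<^esub> a \<odot>\<^bsub>V\<^esub> w) \<and>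
     (\<forall>v\<in>carrier V. \<one>\<^bsub>R\<^esub> \<odot>\<^bsub>V\<^esub> v = v)"

definition irreducible_left_module :: "('a, 'r) ring_scheme \<Rightarrow> ('a, 'v) module \<Rightarrow> bool" where
  "irreducible_left_module R V \<longleftrightarrow> left_module R V \<and> carrier V \<noteq> {\<zero>\<^bsub>V\<^esub>} \<and>
     (\<forall>W. Module.submodule W R V \<longrightarrow> W = {\<zero>\<^bsub>V\<^esub>} \<or> W = carrier V)"

definition component_sum :: "('a, 'v) module \<Rightarrow> (nat \<Rightarrow> 'a) \<Rightarrow> nat set \<Rightarrow> 'v set" where
  "component_sum V F J =
     {finsum V (\<lambda>j. F j \<odot>\<^bsub>V\<^esub> w j) J | w. w \<in> J \<rightarrow> carrier V}"

definition split_component ::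
    "nat \<Rightarrow> ('a, 'v) module \<Rightarrow> (nat \<Rightarrow> 'a) \<Rightarrow> (nat \<Rightarrow> 'a) \<Rightarrow> nat \<Rightarrow> 'v set" where
  "split_component d V E Es i = component_sum V Es {0..i} \<inter> component_sum V E {i..d}"

(* Every irreducible left module of \<A> has dimension d+1 over 'k, hence a copy of it lives
   on a subset of 'k vec; as it is unique up to isomorphism, the choice of V is immaterial.
   A scalar c acts on V as c1. *)
definition first_split_sequence ::
    "nat \<Rightarrow> ('k::field, 'a, 'm) module_scheme \<Rightarrow> 'a \<Rightarrow> 'a \<Rightarrow> (nat \<Rightarrow> 'a) \<Rightarrow> (nat \<Rightarrow> 'a) \<Rightarrow>
     (nat \<Rightarrow> 'k) \<Rightarrow> bool" where
  "first_split_sequence d \<A> A As E Es \<phi> \<longleftrightarrow> \<phi> \<in> {1..d} \<rightarrow>\<^sub>E UNIV \<and>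
     (\<exists>\<theta> \<theta>s. \<exists>V :: ('a, 'k vec) module.
        idempotent_ordering d \<A> A \<theta> E \<and> idempotent_ordering d \<A> As \<theta>s Es \<and>
        irreducible_left_module \<A> V \<and>
        (\<forall>i\<in>{1..d}. \<exists>u\<in>split_component d V E Es i. u \<noteq> \<zero>\<^bsub>V\<^esub> \<and>
           (alg_shift \<A> A (\<theta> (i - 1)) \<otimes>\<^bsub>\<A>\<^esub> alg_shift \<A> As (\<theta>s i)) \<odot>\<^bsub>V\<^esub> u =
           (\<phi> i \<odot>\<^bsub>\<A>\<^esub> \<one>\<^bsub>\<A>\<^esub>) \<odot>\<^bsub>V\<^esub> u))"

definition second_split_sequence ::
    "nat \<Rightarrow> ('k::field, 'a, 'm) module_scheme \<Rightarrow> 'a \<Rightarrow> 'a \<Rightarrow> (nat \<Rightarrow> 'a) \<Rightarrow> (nat \<Rightarrow> 'a) \<Rightarrow>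
     (nat \<Rightarrow> 'k) \<Rightarrow> bool" where
  "second_split_sequence d \<A> A As E Es \<psi> \<longleftrightarrow>
     first_split_sequence d \<A> A As (\<lambda>i\<in>{0..d}. E (d - i)) Es \<psi>"

(* (eigenvalue sequence, dual eigenvalue sequence, first split sequence, second split sequence),
   written (\<theta>, \<theta>s, \<phi>, \<psi>) below *)
type_synonym 'k parray = "(nat \<Rightarrow> 'k) \<times> (nat \<Rightarrow> 'k) \<times> (nat \<Rightarrow> 'k) \<times> (nat \<Rightarrow> 'k)"

fun system_parameter_array ::
    "nat \<Rightarrow> ('k::field, 'a, 'm) module_scheme \<Rightarrow> 'a \<Rightarrow> 'a \<Rightarrow> (nat \<Rightarrow> 'a) \<Rightarrow> (nat \<Rightarrow> 'a) \<Rightarrow>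
     'k parray \<Rightarrow> bool" where
  "system_parameter_array d \<A> A As E Es (\<theta>, \<theta>s, \<phi>, \<psi>) \<longleftrightarrow>
     idempotent_ordering d \<A> A \<theta> E \<and> idempotent_ordering d \<A> As \<theta>s Es \<and>
     first_split_sequence d \<A> A As E Es \<phi> \<and> second_split_sequence d \<A> A As E Es \<psi>"

definition parameter_arrays ::
    "nat \<Rightarrow> ('k::field, 'a, 'm) module_scheme \<Rightarrow> 'a \<Rightarrow> 'a \<Rightarrow> 'k parray set" where
  "parameter_arrays d \<A> A As =
     {p. \<exists>E Es. leonard_system d \<A> A As E Es \<and> system_parameter_array d \<A> A As E Es p}"

(* The case distinctions on i = 0 and i = d realise the convention that the terms with
   numerator \<phi>_0 or \<phi>_{d+1} vanish. *)
fun p_T :: "nat \<Rightarrow> 'k::field parray \<Rightarrow> 'k mat" where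
  "p_T d (\<theta>, \<theta>s, \<phi>, \<psi>) = mat (d + 1) (d + 1) (\<lambda>(i, j).
     if i = j then
       \<theta> i + (if i = 0 then 0 else \<phi> i / (\<theta>s i - \<theta>s (i - 1)))
           + (if i = d then 0 else \<phi> (i + 1) / (\<theta>s i - \<theta>s (i + 1)))
     else if j = i + 1 then
       \<phi> j * (\<Prod>h\<in>{..<j - 1}. \<theta>s (j - 1) - \<theta>s h) / (\<Prod>h\<in>{..<j}. \<theta>s j - \<theta>s h)
     else if i = j + 1 then
       \<psi> i * (\<Prod>h\<in>{i + 1..d}. \<theta>s i - \<theta>s h) / (\<Prod>h\<in>{i..d}. \<theta>s (i - 1) - \<theta>s h)
     else 0)"

fun p_D :: "nat \<Rightarrow> 'k::field parray \<Rightarrow> 'k mat" where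
  "p_D d (\<theta>, \<theta>s, \<phi>, \<psi>) = mat_diag (d + 1) \<theta>s"

definition tridiagonal_mat :: "'k::zero mat \<Rightarrow> bool" where
  "tridiagonal_mat B \<longleftrightarrow> (\<forall>i<dim_row B. \<forall>j<dim_col B.
     B $$ (i, j) \<noteq> 0 \<longrightarrow> i = j \<or> i = j + 1 \<or> j = i + 1)"

definition constant_row_sum :: "'k::field mat \<Rightarrow> 'k \<Rightarrow> bool" where
  "constant_row_sum B c \<longleftrightarrow> (\<forall>i<dim_row B. (\<Sum>j<dim_col B. B $$ (i, j)) = c)"

definition td_d_canonical :: "nat \<Rightarrow> 'k::field mat \<Rightarrow> 'k mat \<Rightarrow> bool" where
  "td_d_canonical d B Bs \<longleftrightarrow> leonard_pair d (mat_algebra d) B Bs \<and>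
     tridiagonal_mat B \<and> diagonal_mat Bs \<and>
     (\<exists>E Es \<theta>. leonard_system d (mat_algebra d) B Bs E Es \<and>
        idempotent_ordering d (mat_algebra d) B \<theta> E \<and>
        (constant_row_sum B (\<theta> 0) \<or> constant_row_sum B (\<theta> d)))"

definition td_d_canonical_forms ::
    "('k::field, 'a, 'm) module_scheme \<Rightarrow> 'a \<Rightarrow> 'a \<Rightarrow> ('k mat \<times> 'k mat) set" where
  "td_d_canonical_forms \<A> A As =
     {(B, Bs). \<exists>e. td_d_canonical e B Bs \<and> leonard_pair_iso \<A> A As (mat_algebra e) B Bs}"

definition designated_system ::
    "nat \<Rightarrow> 'k::field mat \<Rightarrow> 'k mat \<Rightarrow> (nat \<Rightarrow> 'k mat) \<Rightarrow> (nat \<Rightarrow> 'k mat) \<Rightarrow> bool" where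
  "designated_system d B Bs E Es \<longleftrightarrow> leonard_system d (mat_algebra d) B Bs E Es \<and>
     (\<exists>\<theta>. idempotent_ordering d (mat_algebra d) B \<theta> E \<and> constant_row_sum B (\<theta> 0)) \<and>
     (\<exists>\<theta>s. idempotent_ordering d (mat_algebra d) Bs \<theta>s Es \<and> (\<forall>i\<in>{0..d}. \<theta>s i = Bs $$ (i, i)))"

definition designated_parameter_array ::
    "nat \<Rightarrow> 'k::field mat \<Rightarrow> 'k mat \<Rightarrow> 'k parray \<Rightarrow> bool" where
  "designated_parameter_array d B Bs p \<longleftrightarrow>
     (\<exists>E Es. designated_system d B Bs E Es \<and>
        system_parameter_array d (mat_algebra d) B Bs E Es p)"

end

theory Submission
  imports Defs
begin

text \<open>
  Diagonalizing A* turns a Leonard system into matrices B (irreducible tridiagonal) and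
  D = diag(\<theta>*_0, ..., \<theta>*_d).  If q is an eigenvector of B for \<theta>_d, then all its entries are nonzero,
  and the split component U_i is spanned by the vector with entries
  q_k \<Prod>_{h>i} (\<theta>*_k - \<theta>*_h): it is the image of q under \<Prod>_{h>i} (D - \<theta>*_h), hence lies in
  E_i V + ... + E_d V, and it is supported on 0, ..., i.  Comparing the i-th entries in
  (B - \<theta>_{i-1}) u_{i-1} = \<phi>_i u_i and in (B - \<theta>_i) u_i = \<phi>_{i+1} u_{i+1} yields the first split
  sequence and the diagonal of B.  The second split sequence is the same statement for the
  reversed ordering, where q becomes an eigenvector for \<theta>_0; rescaling the basis makes it the
  all-ones vector, so that B has constant row sum \<theta>_0 and the subdiagonal of B comes out.
  For the superdiagonal, let w be the left \<theta>_0-eigenvector of B.  It satisfies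
  w_{i-1} B_{i-1,i} = w_i B_{i,i-1}, and w annihilates f(D) q for deg f < d; choosing for f the
  product over all h different from i-1 and i compares w_{i-1} q_{i-1} with w_i q_i.
\<close>

section \<open>Transfer along algebra isomorphisms\<close>

text \<open>The definitions speak of an abstract algebra, of some isomorphism onto matrices and of
  some irreducible module, whereas the argument is about matrix entries. The module is the main
  obstacle: \<open>first_split_sequence\<close> admits any irreducible \<open>V\<close>. Instead of
  constructing isomorphisms between modules, \<open>irreducible_annihilator\<close> finds for each
  nonzero \<open>u\<close> in \<open>V\<close> a nonzero column vector with the same annihilator.
  Membership in a split component and the eigenvalue equation are both annihilation statements, so
  this suffices. Dimension counts are avoided as well: a flag of coordinate subspaces and a flag of
  sums of eigenspaces meet trivially when their indices are one step short of overlapping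
  (\<open>flag_eq_zero\<close>), and this alone makes U_i a line and identifies the image of U_i
  under B - \<theta>_i. For the inverse map the difficulty is one of ordering. A canonical form
  lists the dual eigenvalues in the order of its diagonal, while a Leonard pair only promises some
  dual idempotent sequence; tridiagonality of the first matrix forces the two orders to agree up to
  reversal.\<close>

lemma assoc_algebraD:
  assumes "assoc_algebra \<A>"
  shows "ring \<A>" "Module.module class_ring \<A>"
    and "x \<in> carrier \<A> \<Longrightarrow> c \<odot>\<^bsub>\<A>\<^esub> x \<in> carrier \<A>"
    and "x \<in> carrier \<A> \<Longrightarrow> y \<in> carrier \<A> \<Longrightarrow>
      (c \<odot>\<^bsub>\<A>\<^esub> x) \<otimes>\<^bsub>\<A>\<^esub> y = c \<odot>\<^bsub>\<A>\<^esub> (x \<otimes>\<^bsub>\<A>\<^esub> y)"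
    and "x \<in> carrier \<A> \<Longrightarrow> y \<in> carrier \<A> \<Longrightarrow>
      x \<otimes>\<^bsub>\<A>\<^esub> (c \<odot>\<^bsub>\<A>\<^esub> y) = c \<odot>\<^bsub>\<A>\<^esub> (x \<otimes>\<^bsub>\<A>\<^esub> y)"
proof -
  show m: "Module.module class_ring \<A>" and "ring \<A>"
    using assms unfolding assoc_algebra_def by auto
  show "x \<in> carrier \<A> \<Longrightarrow> c \<odot>\<^bsub>\<A>\<^esub> x \<in> carrier \<A>"
    using Module.module.smult_closed[OF m, of c x] by simp
qed (use assms in \<open>auto simp: assoc_algebra_def\<close>)

lemma algebra_isoD:
  assumes "h \<in> algebra_iso \<A> \<B>"
  shows "bij_betw h (carrier \<A>) (carrier \<B>)"
    and "x \<in> carrier \<A> \<Longrightarrow> h x \<in> carrier \<B>"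
    and "x \<in> carrier \<A> \<Longrightarrow> y \<in> carrier \<A> \<Longrightarrow> h (x \<otimes>\<^bsub>\<A>\<^esub> y) = h x \<otimes>\<^bsub>\<B>\<^esub> h y"
    and "x \<in> carrier \<A> \<Longrightarrow> y \<in> carrier \<A> \<Longrightarrow> h (x \<oplus>\<^bsub>\<A>\<^esub> y) = h x \<oplus>\<^bsub>\<B>\<^esub> h y"
    and "h \<one>\<^bsub>\<A>\<^esub> = \<one>\<^bsub>\<B>\<^esub>"
    and "x \<in> carrier \<A> \<Longrightarrow> h (c \<odot>\<^bsub>\<A>\<^esub> x) = c \<odot>\<^bsub>\<B>\<^esub> h x"
  using assms unfolding algebra_iso_def ring_iso_def Ring.ring_hom_def by auto

lemma algebra_iso_comp:
  assumes "h \<in> algebra_iso \<A> \<B>" "g \<in> algebra_iso \<B> \<C>"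
  shows "g \<circ> h \<in> algebra_iso \<A> \<C>"
  using bij_betw_trans[OF algebra_isoD(1)[OF assms(1)] algebra_isoD(1)[OF assms(2)]]
    algebra_isoD[OF assms(1)] algebra_isoD[OF assms(2)]
  unfolding algebra_iso_def ring_iso_def Ring.ring_hom_def by auto

lemma assoc_mat_algebra: "assoc_algebra (mat_algebra d :: ('k::field, 'k mat) module)"
proof -
  let ?M = "mat_algebra d :: ('k, 'k mat) module"
  interpret abelian_group ?M by (rule abelian_group_mat)
  have "ring ?M"
    by (rule ringI, unfold_locales)
      (auto simp: module_mat_def add_mult_distrib_mat[of _ "d+1" "d+1"] mult_add_distrib_mat[of _ "d+1" "d+1"] assoc_mult_mat[of _ "d+1" "d+1"])
  moreover have "Module.module class_ring ?M"
    by (rule Module.moduleI, rule class_cring.is_cring, unfold_locales)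
      (auto simp: module_mat_def algebra_simps intro!: eq_matI)
  ultimately show ?thesis
    unfolding assoc_algebra_def by (auto simp: module_mat_def)
qed

lemma id_algebra_iso: "id \<in> algebra_iso \<A> \<A>"
  unfolding algebra_iso_def ring_iso_def Ring.ring_hom_def by (auto simp: bij_betw_def)

lemma matrix_mat_algebra: "matrix_algebra d (mat_algebra d :: ('k::field, 'k mat) module)"
  unfolding matrix_algebra_def using assoc_mat_algebra id_algebra_iso by blast

locale algebra_isomorphism =
  fixes \<A> :: "('k::field, 'a, 'm) module_scheme" and \<B> :: "('k, 'b, 'n) module_scheme"
    and h :: "'a \<Rightarrow> 'b"
  assumes assoc_A: "assoc_algebra \<A>" and assoc_B: "assoc_algebra \<B>"
    and h: "h \<in> algebra_iso \<A> \<B>"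
begin

sublocale A: ring \<A> by (rule assoc_algebraD(1)[OF assoc_A])
sublocale B: ring \<B> by (rule assoc_algebraD(1)[OF assoc_B])

lemmas h_simps = algebra_isoD(2-)[OF h]
lemmas A_smult = assoc_algebraD(3-)[OF assoc_A]
lemmas B_smult = assoc_algebraD(3-)[OF assoc_B]

lemma h_inj: "x \<in> carrier \<A> \<Longrightarrow> y \<in> carrier \<A> \<Longrightarrow> h x = h y \<longleftrightarrow> x = y"
  using algebra_isoD(1)[OF h] unfolding bij_betw_def inj_on_def by blast

lemma h_zero: "h \<zero>\<^bsub>\<A>\<^esub> = \<zero>\<^bsub>\<B>\<^esub>"
proof (rule ring_hom_zero[OF _ A.ring_axioms B.ring_axioms])
  show "h \<in> Ring.ring_hom \<A> \<B>" using h unfolding algebra_iso_def ring_iso_def by auto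
qed

lemma h_eq_zero: "x \<in> carrier \<A> \<Longrightarrow> h x = \<zero>\<^bsub>\<B>\<^esub> \<longleftrightarrow> x = \<zero>\<^bsub>\<A>\<^esub>"
  using h_inj[of x "\<zero>\<^bsub>\<A>\<^esub>"] h_zero by auto

lemma h_a_inv: "x \<in> carrier \<A> \<Longrightarrow> h (\<ominus>\<^bsub>\<A>\<^esub> x) = \<ominus>\<^bsub>\<B>\<^esub> h x"
  by (metis A.a_inv_closed A.r_neg B.minus_equality B.a_comm h_simps(1) h_simps(3) h_zero)

lemma h_surj: "y \<in> carrier \<B> \<Longrightarrow> \<exists>x\<in>carrier \<A>. h x = y"
  using algebra_isoD(1)[OF h] unfolding bij_betw_def by (metis imageE)

definition "k = inv_into (carrier \<A>) h"

lemma k_h: "x \<in> carrier \<A> \<Longrightarrow> k (h x) = x"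
  unfolding k_def using algebra_isoD(1)[OF h] by (simp add: bij_betw_def)

lemma h_k: "y \<in> carrier \<B> \<Longrightarrow> h (k y) = y" "y \<in> carrier \<B> \<Longrightarrow> k y \<in> carrier \<A>"
  using h_surj[of y] k_h by auto

lemma k_iso: "k \<in> algebra_iso \<B> \<A>"
proof -
  have bij: "bij_betw k (carrier \<B>) (carrier \<A>)"
    unfolding k_def by (rule bij_betw_inv_into[OF algebra_isoD(1)[OF h]])
  have 1: "k (x \<otimes>\<^bsub>\<B>\<^esub> y) = k x \<otimes>\<^bsub>\<A>\<^esub> k y" if "x \<in> carrier \<B>" "y \<in> carrier \<B>" for x y
    using k_h[of "k x \<otimes>\<^bsub>\<A>\<^esub> k y"] h_k that by (simp add: h_simps)
  have 2: "k (x \<oplus>\<^bsub>\<B>\<^esub> y) = k x \<oplus>\<^bsub>\<A>\<^esub> k y" if "x \<in> carrier \<B>" "y \<in> carrier \<B>" for x y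
    using k_h[of "k x \<oplus>\<^bsub>\<A>\<^esub> k y"] h_k that by (simp add: h_simps)
  have 3: "k (c \<odot>\<^bsub>\<B>\<^esub> x) = c \<odot>\<^bsub>\<A>\<^esub> k x" if "x \<in> carrier \<B>" for c x
    using k_h[of "c \<odot>\<^bsub>\<A>\<^esub> k x"] h_k that by (simp add: h_simps A_smult)
  have 4: "k \<one>\<^bsub>\<B>\<^esub> = \<one>\<^bsub>\<A>\<^esub>" using k_h[of "\<one>\<^bsub>\<A>\<^esub>"] by (simp add: h_simps)
  show ?thesis using bij 1 2 3 4 h_k
    unfolding algebra_iso_def ring_iso_def Ring.ring_hom_def by auto
qed

lemma inverse_isomorphism: "algebra_isomorphism \<B> \<A> k"
  by unfold_locales (rule assoc_B assoc_A k_iso)+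

lemma h_shift: "x \<in> carrier \<A> \<Longrightarrow> h (alg_shift \<A> x t) = alg_shift \<B> (h x) t"
  unfolding alg_shift_def by (simp add: a_minus_def h_simps h_a_inv A_smult)

lemma alg_shift_closed: "x \<in> carrier \<A> \<Longrightarrow> alg_shift \<A> x t \<in> carrier \<A>"
  unfolding alg_shift_def by (simp add: A_smult)

lemma matrix_algebra_image:
  assumes "matrix_algebra d \<A>" shows "matrix_algebra d \<B>"
  using assms algebra_iso_comp[OF k_iso] assoc_B unfolding matrix_algebra_def by blast

end

text \<open>The right-hand side mentions neither \<open>h\<close> nor \<open>d\<close>, so
  eigenvalues become intrinsic to the algebra. An eigenvector \<open>v\<close> yields the matrix all
  of whose columns are \<open>v\<close>; conversely any nonzero column of \<open>h x\<close> is an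
  eigenvector.\<close>

lemma eigenvalue_image_iff:
  fixes \<A> :: "('k::field, 'a, 'm) module_scheme"
  assumes "assoc_algebra \<A>" and h: "h \<in> algebra_iso \<A> (mat_algebra d)" and a: "a \<in> carrier \<A>"
  shows "eigenvalue (h a) t \<longleftrightarrow>
    (\<exists>x\<in>carrier \<A>. x \<noteq> \<zero>\<^bsub>\<A>\<^esub> \<and> a \<otimes>\<^bsub>\<A>\<^esub> x = t \<odot>\<^bsub>\<A>\<^esub> x)" (is "_ = ?R")
proof -
  let ?M = "mat_algebra d :: ('k, 'k mat) module"
  interpret algebra_isomorphism \<A> ?M h
    using assms assoc_mat_algebra by unfold_locales auto
  have ha: "h a \<in> carrier_mat (d+1) (d+1)" using h_simps(1)[OF a] by (simp add: module_mat_def)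
  show ?thesis
  proof
    assume "eigenvalue (h a) t"
    then obtain v where v: "v \<in> carrier_vec (d+1)" "v \<noteq> 0\<^sub>v (d+1)" "h a *\<^sub>v v = t \<cdot>\<^sub>v v"
      using ha unfolding eigenvalue_def eigenvector_def by auto
    define X where "X = mat (d+1) (d+1) (\<lambda>(i,j). v $ i)"
    have X: "X \<in> carrier ?M" by (auto simp: X_def module_mat_def)
    have cX: "col X j = v" if "j < d+1" for j
      using that v(1) by (auto simp: X_def)
    have "X \<noteq> 0\<^sub>m (d+1) (d+1)"
    proof
      assume "X = 0\<^sub>m (d+1) (d+1)"
      then have "v = col (0\<^sub>m (d+1) (d+1)) 0" using cX[of 0] by simp
      then show False using v(2) by simp
    qed
    moreover have "h a * X = t \<cdot>\<^sub>m X"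
    proof (rule mat_col_eqI)
      fix j assume "j < dim_col (t \<cdot>\<^sub>m X)"
      then have j: "j < d+1" by (simp add: X_def)
      have "col (h a * X) j = h a *\<^sub>v col X j"
        using j by (intro col_mult2[OF ha]) (auto simp: X_def)
      also have "\<dots> = t \<cdot>\<^sub>v col X j" using cX[OF j] v(3) by simp
      finally show "col (h a * X) j = col (t \<cdot>\<^sub>m X) j"
        using j by (simp add: X_def)
    qed (use ha in \<open>auto simp: X_def\<close>)
    ultimately have "h (k X) \<noteq> \<zero>\<^bsub>?M\<^esub>" "h (a \<otimes>\<^bsub>\<A>\<^esub> k X) = h (t \<odot>\<^bsub>\<A>\<^esub> k X)"
      using h_k[OF X] a by (simp_all add: h_simps) (simp_all add: module_mat_def)
    then show ?R
      using h_k(2)[OF X] a h_eq_zero[of "k X"] by (auto simp: h_inj A_smult)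
  next
    assume ?R
    then obtain x where x: "x \<in> carrier \<A>" "x \<noteq> \<zero>\<^bsub>\<A>\<^esub>" "a \<otimes>\<^bsub>\<A>\<^esub> x = t \<odot>\<^bsub>\<A>\<^esub> x" by auto
    let ?X = "h x"
    have X: "?X \<in> carrier_mat (d+1) (d+1)" using h_simps(1)[OF x(1)] by (simp add: module_mat_def)
    have eq: "h a * ?X = t \<cdot>\<^sub>m ?X"
      using arg_cong[OF x(3), of h] x(1) a by (simp add: h_simps) (simp add: module_mat_def)
    have "?X \<noteq> 0\<^sub>m (d+1) (d+1)"
      using h_eq_zero[OF x(1)] x(2) by (simp add: module_mat_def)
    then obtain i j where ij: "i < d+1" "j < d+1" "?X $$ (i,j) \<noteq> 0"
      using X by (metis (no_types, lifting) carrier_matD eq_matI index_zero_mat)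
    have "col ?X j $ i \<noteq> 0" using ij X by simp
    then have ne: "col ?X j \<noteq> 0\<^sub>v (d+1)" using ij by auto
    have "h a *\<^sub>v col ?X j = col (h a * ?X) j"
      using col_mult2[OF ha X ij(2)] by simp
    also have "\<dots> = t \<cdot>\<^sub>v col ?X j" using ij X by (simp add: eq)
    finally show "eigenvalue (h a) t"
      using ne ha X ij(2) unfolding eigenvalue_def eigenvector_def by (auto intro!: exI[of _ "col ?X j"])
  qed
qed

lemma alg_eigenvalue_iff:
  assumes "matrix_algebra d \<A>" "a \<in> carrier \<A>"
  shows "alg_eigenvalue d \<A> a t \<longleftrightarrow>
    (\<exists>x\<in>carrier \<A>. x \<noteq> \<zero>\<^bsub>\<A>\<^esub> \<and> a \<otimes>\<^bsub>\<A>\<^esub> x = t \<odot>\<^bsub>\<A>\<^esub> x)"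
  using assms eigenvalue_image_iff[OF _ _ assms(2)]
  unfolding alg_eigenvalue_def matrix_algebra_def by blast

lemma primitive_idempotent_closed:
  assumes "assoc_algebra \<A>" "a \<in> carrier \<A>"
  shows "primitive_idempotent d \<A> a \<theta> i \<in> carrier \<A>"
proof -
  interpret ring \<A> by (rule assoc_algebraD(1)[OF assms(1)])
  have "foldr (\<lambda>j x. (inverse (\<theta> i - \<theta> j) \<odot>\<^bsub>\<A>\<^esub> alg_shift \<A> a (\<theta> j)) \<otimes>\<^bsub>\<A>\<^esub> x) js \<one>\<^bsub>\<A>\<^esub>
      \<in> carrier \<A>" for js
    using assms by (induction js) (auto simp: alg_shift_def assoc_algebraD(3))
  then show ?thesis unfolding primitive_idempotent_def .
qed

context algebra_isomorphism
begin

lemma alg_eigenvalue_image: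
  assumes "matrix_algebra d \<A>" "a \<in> carrier \<A>"
  shows "alg_eigenvalue d \<B> (h a) t \<longleftrightarrow> alg_eigenvalue d \<A> a t"
proof -
  have "(\<exists>x\<in>carrier \<A>. x \<noteq> \<zero>\<^bsub>\<A>\<^esub> \<and> a \<otimes>\<^bsub>\<A>\<^esub> x = t \<odot>\<^bsub>\<A>\<^esub> x) \<longleftrightarrow>
    (\<exists>x\<in>carrier \<A>. h x \<noteq> \<zero>\<^bsub>\<B>\<^esub> \<and> h a \<otimes>\<^bsub>\<B>\<^esub> h x = t \<odot>\<^bsub>\<B>\<^esub> h x)"
    using assms(2) h_inj h_eq_zero
    by (intro bex_cong refl) (simp add: h_simps(2)[symmetric] h_simps(5)[symmetric] A_smult)
  also have "\<dots> \<longleftrightarrow> (\<exists>x\<in>carrier \<B>. x \<noteq> \<zero>\<^bsub>\<B>\<^esub> \<and> h a \<otimes>\<^bsub>\<B>\<^esub> x = t \<odot>\<^bsub>\<B>\<^esub> x)"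
    using h_surj h_simps(1) by metis
  finally show ?thesis
    using assms alg_eigenvalue_iff[OF assms] alg_eigenvalue_iff[OF matrix_algebra_image h_simps(1)]
    by simp
qed

lemma multiplicity_free_image:
  assumes "matrix_algebra d \<A>" "multiplicity_free d \<A> a"
  shows "multiplicity_free d \<B> (h a)"
  using assms alg_eigenvalue_image[of d a] unfolding multiplicity_free_def
  by (simp add: h_simps cong: Collect_cong)

lemma primitive_idempotent_image:
  assumes "a \<in> carrier \<A>"
  shows "h (primitive_idempotent d \<A> a \<theta> i) = primitive_idempotent d \<B> (h a) \<theta> i"
proof -
  let ?P = "\<lambda>js. foldr (\<lambda>j x. (inverse (\<theta> i - \<theta> j) \<odot>\<^bsub>\<A>\<^esub> alg_shift \<A> a (\<theta> j)) \<otimes>\<^bsub>\<A>\<^esub> x) js \<one>\<^bsub>\<A>\<^esub>"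
  have "?P js \<in> carrier \<A> \<and> h (?P js) =
      foldr (\<lambda>j x. (inverse (\<theta> i - \<theta> j) \<odot>\<^bsub>\<B>\<^esub> alg_shift \<B> (h a) (\<theta> j)) \<otimes>\<^bsub>\<B>\<^esub> x) js \<one>\<^bsub>\<B>\<^esub>" for js
    using assms by (induction js) (auto simp: h_simps h_shift alg_shift_closed A_smult(1))
  then show ?thesis unfolding primitive_idempotent_def by blast
qed

text \<open>Sequences are extensional, hence the image sequence is cut off again outside
  \<open>{0..d}\<close>; the image systems below carry the same restriction.\<close>

lemma idempotent_ordering_image:
  assumes m: "matrix_algebra d \<A>" and a: "a \<in> carrier \<A>"
    and "idempotent_ordering d \<A> a \<theta> E"
  shows "idempotent_ordering d \<B> (h a) \<theta> (\<lambda>i\<in>{0..d}. h (E i))"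
proof -
  have "{t. alg_eigenvalue d \<B> (h a) t} = {t. alg_eigenvalue d \<A> a t}"
    using alg_eigenvalue_image[OF m a] by auto
  moreover have "(\<lambda>i\<in>{0..d}. h (E i)) \<in> {0..d} \<rightarrow>\<^sub>E carrier \<B>"
    using assms(3) unfolding idempotent_ordering_def PiE_def
    by (auto simp: h_simps(1) primitive_idempotent_closed[OF assoc_A a])
  ultimately show ?thesis
    using assms(3) primitive_idempotent_image[OF a] unfolding idempotent_ordering_def by simp
qed

lemma idempotent_sequence_image:
  assumes m: "matrix_algebra d \<A>" and a: "a \<in> carrier \<A>" and b: "b \<in> carrier \<A>"
    and i: "idempotent_sequence d \<A> a b E"
  shows "idempotent_sequence d \<B> (h a) (h b) (\<lambda>i\<in>{0..d}. h (E i))"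
proof -
  have E: "E i \<in> carrier \<A>" if "i \<in> {0..d}" for i
    using i that unfolding idempotent_sequence_def idempotent_ordering_def by (meson PiE_mem)
  have "h (E i) \<otimes>\<^bsub>\<B>\<^esub> h b \<otimes>\<^bsub>\<B>\<^esub> h (E j) = h (E i \<otimes>\<^bsub>\<A>\<^esub> b \<otimes>\<^bsub>\<A>\<^esub> E j)"
    if "i \<in> {0..d}" "j \<in> {0..d}" for i j
    using E[OF that(1)] E[OF that(2)] b by (simp add: h_simps)
  moreover have "E i \<otimes>\<^bsub>\<A>\<^esub> b \<otimes>\<^bsub>\<A>\<^esub> E j \<in> carrier \<A>" if "i \<in> {0..d}" "j \<in> {0..d}" for i j
    using E that b by simp
  ultimately show ?thesis
    using i idempotent_ordering_image[OF m a]
    unfolding idempotent_sequence_def by (simp add: h_eq_zero) blast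
qed

lemma leonard_system_image:
  assumes "leonard_system d \<A> a b E Es"
  shows "leonard_system d \<B> (h a) (h b) (\<lambda>i\<in>{0..d}. h (E i)) (\<lambda>i\<in>{0..d}. h (Es i))"
proof -
  have "a \<in> carrier \<A>" "b \<in> carrier \<A>"
    using assms unfolding leonard_system_def multiplicity_free_def by auto
  then show ?thesis
    using assms idempotent_sequence_image multiplicity_free_image matrix_algebra_image
    unfolding leonard_system_def by auto
qed

end

section \<open>Primitive idempotents and diagonalization\<close>

text \<open>Without this the simplifier turns the dimension \<open>d + 1\<close> into \<open>Suc d\<close>, and rules about
  \<open>mat_algebra d\<close> no longer match.\<close>
declare One_nat_def [simp del]

lemma alg_eigenvalue_mat:
  assumes "M \<in> carrier_mat (d + 1) (d + 1)"
  shows "alg_eigenvalue d (mat_algebra d) M t \<longleftrightarrow> eigenvalue M (t :: 'k::field)"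
  using alg_eigenvalue_iff[OF matrix_mat_algebra, of M d t] assms
    eigenvalue_image_iff[OF assoc_mat_algebra id_algebra_iso, of M d t]
  by (simp add: module_mat_simps)

lemma alg_shift_mat:
  assumes "M \<in> carrier_mat (d + 1) (d + 1)"
  shows "alg_shift (mat_algebra d) M t = M - t \<cdot>\<^sub>m 1\<^sub>m (d + 1)"
proof -
  interpret abelian_group "mat_algebra d :: ('a, 'a mat) module" by (rule abelian_group_mat)
  have "a_inv (mat_algebra d) X = - X" if "X \<in> carrier_mat (d + 1) (d + 1)" for X :: "'a mat"
    using that by (intro minus_equality) (auto simp: module_mat_simps)
  then show ?thesis
    using assms unfolding alg_shift_def a_minus_def
    by (simp add: module_mat_simps minus_add_uminus_mat[symmetric])
qed

lemma smult_mat_mult_vec: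
  fixes A :: "'k::field mat"
  assumes "A \<in> carrier_mat nr nc" "v \<in> carrier_vec nc"
  shows "(c \<cdot>\<^sub>m A) *\<^sub>v v = c \<cdot>\<^sub>v (A *\<^sub>v v)"
  using assms by (intro eq_vecI) auto

lemma mult_mat_unit_vec:
  fixes A :: "'k::field mat"
  assumes "A \<in> carrier_mat nr nc" "i < nc"
  shows "A *\<^sub>v unit_vec nc i = col A i"
  using assms by (intro eq_vecI) auto

lemma alg_shift_mat_mult_vec:
  assumes "M \<in> carrier_mat (d + 1) (d + 1)" "v \<in> carrier_vec (d + 1)"
  shows "alg_shift (mat_algebra d) M t *\<^sub>v v = M *\<^sub>v v - t \<cdot>\<^sub>v v"
  using assms
  by (simp add: alg_shift_mat minus_mult_distrib_mat_vec[of _ "d + 1" "d + 1"] smult_mat_mult_vec[of _ "d+1" "d+1"])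

text \<open>Each factor of the product acts on an eigenvector as a scalar. Evaluating idempotents on
  eigenvectors in this way avoids all manipulation of the matrix product itself.\<close>

lemma primitive_idempotent_eigenvector:
  assumes M: "M \<in> carrier_mat (d + 1) (d + 1)" and v: "v \<in> carrier_vec (d + 1)"
    and ev: "M *\<^sub>v v = t \<cdot>\<^sub>v v"
  shows "primitive_idempotent d (mat_algebra d) M \<theta> i *\<^sub>v v =
    (\<Prod>j\<in>{0..d} - {i}. (t - \<theta> j) / (\<theta> i - \<theta> j)) \<cdot>\<^sub>v v"
proof -
  let ?M = "mat_algebra d :: ('a, 'a mat) module"
  interpret ring ?M by (rule assoc_algebraD(1)[OF assoc_mat_algebra])
  let ?P = "\<lambda>js. foldr (\<lambda>j x. (inverse (\<theta> i - \<theta> j) \<odot>\<^bsub>?M\<^esub> alg_shift ?M M (\<theta> j)) \<otimes>\<^bsub>?M\<^esub> x) js \<one>\<^bsub>?M\<^esub>"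
  have S: "alg_shift ?M M s \<in> carrier_mat (d + 1) (d + 1)" for s
    unfolding alg_shift_mat[OF M] using M by auto
  have "?P js \<in> carrier_mat (d + 1) (d + 1) \<and>
    ?P js *\<^sub>v v = (\<Prod>j\<leftarrow>js. (t - \<theta> j) / (\<theta> i - \<theta> j)) \<cdot>\<^sub>v v" for js
  proof (induction js)
    case Nil
    then show ?case using v by (simp add: module_mat_simps)
  next
    case (Cons j js)
    let ?c = "inverse (\<theta> i - \<theta> j)" and ?S = "alg_shift ?M M (\<theta> j)"
      and ?p = "\<Prod>j\<leftarrow>js. (t - \<theta> j) / (\<theta> i - \<theta> j)"
    have P: "?P js \<in> carrier_mat (d + 1) (d + 1)" by (rule conjunct1[OF Cons])
    have cS: "?c \<cdot>\<^sub>m ?S \<in> carrier_mat (d + 1) (d + 1)" using S by auto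
    have eq: "?P (j # js) = (?c \<cdot>\<^sub>m ?S) * ?P js" by (simp add: module_mat_simps)
    have "?P (j # js) *\<^sub>v v = (?c \<cdot>\<^sub>m ?S) *\<^sub>v (?P js *\<^sub>v v)"
      unfolding eq by (rule assoc_mult_mat_vec[OF cS P v])
    also have "\<dots> = (?c \<cdot>\<^sub>m ?S) *\<^sub>v (?p \<cdot>\<^sub>v v)" by (simp only: conjunct2[OF Cons])
    also have "\<dots> = ?p \<cdot>\<^sub>v (?c \<cdot>\<^sub>v (?S *\<^sub>v v))"
      using S[of "\<theta> j"] v
      by (simp only: mult_mat_vec[of _ "d+1" "d+1"] smult_mat_mult_vec[of _ "d+1" "d+1"] smult_carrier_mat)
    also have "\<dots> = ?p \<cdot>\<^sub>v (?c \<cdot>\<^sub>v ((t - \<theta> j) \<cdot>\<^sub>v v))"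
      unfolding alg_shift_mat_mult_vec[OF M v] ev using v by (auto simp: left_diff_distrib)
    also have "\<dots> = (\<Prod>j\<leftarrow>j#js. (t - \<theta> j) / (\<theta> i - \<theta> j)) \<cdot>\<^sub>v v"
      by (simp add: smult_smult_assoc divide_inverse ac_simps)
    finally have 1: "?P (j # js) *\<^sub>v v = (\<Prod>j\<leftarrow>j#js. (t - \<theta> j) / (\<theta> i - \<theta> j)) \<cdot>\<^sub>v v" .
    have "?P (j # js) \<in> carrier_mat (d + 1) (d + 1)"
      using mult_carrier_mat[OF cS P] by (simp add: module_mat_simps)
    with 1 show ?case by (rule conjI[rotated])
  qed
  from this[of "filter (\<lambda>j. j \<noteq> i) [0..<d + 1]"] have
    "primitive_idempotent d ?M M \<theta> i *\<^sub>v v =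
      (\<Prod>j\<leftarrow>filter (\<lambda>j. j \<noteq> i) [0..<d + 1]. (t - \<theta> j) / (\<theta> i - \<theta> j)) \<cdot>\<^sub>v v"
    unfolding primitive_idempotent_def by blast
  also have "(\<Prod>j\<leftarrow>filter (\<lambda>j. j \<noteq> i) [0..<d + 1]. (t - \<theta> j) / (\<theta> i - \<theta> j)) =
      (\<Prod>j\<in>{0..d} - {i}. (t - \<theta> j) / (\<theta> i - \<theta> j))"
    by (subst prod.distinct_set_conv_list[symmetric]) (auto intro!: prod.cong)
  finally show ?thesis .
qed

text \<open>The scalar of the preceding lemma is the Lagrange basis polynomial at the node
  \<open>\<eta> i\<close>, evaluated at a node.\<close>

lemma lagrange_coefficient:
  fixes \<eta> :: "nat \<Rightarrow> 'k::field"
  assumes "inj_on \<eta> {0..d}" "i \<le> d" "t \<in> \<eta> ` {0..d}"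
  shows "(\<Prod>j\<in>{0..d} - {i}. (t - \<eta> j) / (\<eta> i - \<eta> j)) = (if t = \<eta> i then 1 else 0)"
proof (cases "t = \<eta> i")
  case True
  have "\<eta> i - \<eta> j \<noteq> 0" if "j \<in> {0..d} - {i}" for j
    using that assms(2) inj_onD[OF assms(1), of i j] by auto
  then have "(\<Prod>j\<in>{0..d} - {i}. (t - \<eta> j) / (\<eta> i - \<eta> j)) = (\<Prod>j\<in>{0..d} - {i}. 1)"
    unfolding True by (intro prod.cong) auto
  then show ?thesis using True by simp
next
  case False
  obtain j where j: "j \<in> {0..d}" "t = \<eta> j" using assms(3) by blast
  then have "j \<in> {0..d} - {i}" using False by auto
  then have "(\<Prod>j\<in>{0..d} - {i}. (t - \<eta> j) / (\<eta> i - \<eta> j)) = 0"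
    using j(2) by (intro prod_zero) (auto intro!: bexI[of _ j])
  then show ?thesis using False by simp
qed

section \<open>Diagonal idempotents and change of basis\<close>

abbreviation diag_unit :: "nat \<Rightarrow> nat \<Rightarrow> 'k::field mat" where
  "diag_unit d i \<equiv> mat_diag (d + 1) (\<lambda>k. if k = i then 1 else 0)"

lemma diag_unit_mult_vec:
  assumes "x \<in> carrier_vec (d + 1)"
  shows "diag_unit d i *\<^sub>v x = vec (d + 1) (\<lambda>k. if k = i then x $ i else 0)"
proof (rule eq_vecI)
  fix k assume "k < dim_vec (vec (d + 1) (\<lambda>k. if k = i then x $ i else 0))"
  then have k: "k < d + 1" by simp
  then have "(diag_unit d i *\<^sub>v x) $ k = (\<Sum>j = 0..<d + 1. (if k = j then if j = i then 1 else 0 else 0) * x $ j)"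
    using assms by (simp add: mat_diag_def scalar_prod_def)
  also have "\<dots> = (\<Sum>j\<in>{k}. (if k = j then if j = i then 1 else 0 else 0) * x $ j)"
    using k by (intro sum.mono_neutral_right) auto
  finally show "(diag_unit d i *\<^sub>v x) $ k = vec (d + 1) (\<lambda>k. if k = i then x $ i else 0) $ k"
    using k by simp
qed (use assms in \<open>auto simp: mat_diag_def\<close>)

lemma mat_diag_mult_vec:
  assumes "x \<in> carrier_vec n"
  shows "mat_diag n f *\<^sub>v x = vec n (\<lambda>k. f k * x $ k)"
proof (rule eq_vecI)
  fix k assume "k < dim_vec (vec n (\<lambda>k. f k * x $ k))"
  then have k: "k < n" by simp
  then have "(mat_diag n f *\<^sub>v x) $ k = (\<Sum>j = 0..<n. (if k = j then f j else 0) * x $ j)"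
    using assms by (simp add: mat_diag_def scalar_prod_def)
  also have "\<dots> = (\<Sum>j\<in>{k}. (if k = j then f j else 0) * x $ j)"
    using k by (intro sum.mono_neutral_right) auto
  finally show "(mat_diag n f *\<^sub>v x) $ k = vec n (\<lambda>k. f k * x $ k) $ k"
    using k by simp
qed (use assms in \<open>auto simp: mat_diag_def\<close>)

lemma conjugation_algebra_iso:
  fixes Q Qi :: "'k::field mat"
  assumes Q: "Q \<in> carrier_mat (d + 1) (d + 1)" and Qi: "Qi \<in> carrier_mat (d + 1) (d + 1)"
    and inv: "Q * Qi = 1\<^sub>m (d + 1)" "Qi * Q = 1\<^sub>m (d + 1)"
  shows "(\<lambda>X. Qi * X * Q) \<in> algebra_iso (mat_algebra d) (mat_algebra d)"
proof -
  let ?N = "carrier_mat (d + 1) (d + 1) :: 'k mat set"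
  have 1: "Q * (Qi * X * Q) * Qi = X" and 2: "Qi * (Q * X * Qi) * Q = X" if X: "X \<in> ?N" for X
  proof -
    have "Q * (Qi * X * Q) * Qi = (Q * Qi) * X * (Q * Qi)"
      using Q Qi X by (simp add: assoc_mult_mat[of _ "d + 1" "d + 1" _ "d + 1" _ "d + 1"])
    then show "Q * (Qi * X * Q) * Qi = X" using inv X by simp
    have "Qi * (Q * X * Qi) * Q = (Qi * Q) * X * (Qi * Q)"
      using Q Qi X by (simp add: assoc_mult_mat[of _ "d + 1" "d + 1" _ "d + 1" _ "d + 1"])
    then show "Qi * (Q * X * Qi) * Q = X" using inv X by simp
  qed
  have bij: "bij_betw (\<lambda>X. Qi * X * Q) ?N ?N"
    by (rule bij_betw_byWitness[where f' = "\<lambda>X. Q * X * Qi"]) (use 1 2 Q Qi in auto)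
  have mult: "Qi * (X * Y) * Q = (Qi * X * Q) * (Qi * Y * Q)" if X: "X \<in> ?N" and Y: "Y \<in> ?N" for X Y
  proof -
    have "(Qi * X * Q) * (Qi * Y * Q) = Qi * X * ((Q * Qi) * (Y * Q))"
      using Q Qi X Y by (simp add: assoc_mult_mat[of _ "d + 1" "d + 1" _ "d + 1" _ "d + 1"])
    also have "\<dots> = Qi * (X * Y) * Q"
      using Q Qi X Y inv by (simp add: assoc_mult_mat[of _ "d + 1" "d + 1" _ "d + 1" _ "d + 1"])
    finally show ?thesis by simp
  qed
  have add: "Qi * (X + Y) * Q = Qi * X * Q + Qi * Y * Q" if "X \<in> ?N" "Y \<in> ?N" for X Y
    using Q Qi that
    by (simp add: mult_add_distrib_mat[of _ "d+1" "d+1"] add_mult_distrib_mat[of _ "d+1" "d+1"])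
  have smult: "Qi * (c \<cdot>\<^sub>m X) * Q = c \<cdot>\<^sub>m (Qi * X * Q)" if "X \<in> ?N" for c X
    using Q Qi that by (simp add: mult_smult_distrib[of _ "d+1" "d+1"] mult_smult_assoc_mat[of _ "d+1" "d+1"])
  show ?thesis
    unfolding algebra_iso_def ring_iso_def Ring.ring_hom_def
    using bij mult add smult inv Q Qi by (auto simp: module_mat_simps)
qed

text \<open>The columns of \<open>Q\<close> are eigenvectors in the order prescribed by
  \<open>\<theta>\<close>; the Lagrange idempotents fix or kill them, which makes each
  \<open>E i\<close> a diagonal matrix unit in the new basis.\<close>

lemma diagonalization:
  fixes M :: "'k::field mat"
  assumes M: "M \<in> carrier_mat (d + 1) (d + 1)"
    and ord: "idempotent_ordering d (mat_algebra d) M \<theta> E"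
  obtains Q Qi where "Q \<in> carrier_mat (d + 1) (d + 1)" "Qi \<in> carrier_mat (d + 1) (d + 1)"
    "Q * Qi = 1\<^sub>m (d + 1)" "Qi * Q = 1\<^sub>m (d + 1)"
    "M * Q = Q * mat_diag (d + 1) \<theta>" "\<And>i. i \<le> d \<Longrightarrow> E i * Q = Q * diag_unit d i"
proof -
  let ?n = "d + 1"
  have inj: "inj_on \<theta> {0..d}" and img: "\<theta> ` {0..d} = {t. eigenvalue M t}"
    and E: "\<And>i. i \<le> d \<Longrightarrow> E i = primitive_idempotent d (mat_algebra d) M \<theta> i"
    using ord alg_eigenvalue_mat[OF M] unfolding idempotent_ordering_def bij_betw_def by auto
  have Ec: "E i \<in> carrier_mat ?n ?n" if "i \<le> d" for i
    using E[OF that] primitive_idempotent_closed[OF assoc_mat_algebra, of M d d \<theta> i] M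
    by (simp add: module_mat_simps)
  have "\<forall>j\<in>{0..d}. \<exists>v. eigenvector M v (\<theta> j)"
    using img unfolding eigenvalue_def by blast
  then obtain v where "\<forall>j\<in>{0..d}. eigenvector M (v j) (\<theta> j)" by metis
  then have v: "v j \<in> carrier_vec ?n" "v j \<noteq> 0\<^sub>v ?n" "M *\<^sub>v v j = \<theta> j \<cdot>\<^sub>v v j" if "j \<le> d" for j
    using that M unfolding eigenvector_def by auto
  define Q where "Q = mat ?n ?n (\<lambda>(i, j). v j $ i)"
  have Q: "Q \<in> carrier_mat ?n ?n" by (simp add: Q_def)
  have col: "col Q j = v j" if "j \<le> d" for j
    using that v(1)[OF that] by (auto simp: Q_def)
  have MQ: "M * Q = Q * mat_diag ?n \<theta>"
  proof (rule mat_col_eqI)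
    fix j assume "j < dim_col (Q * mat_diag ?n \<theta>)"
    then have j: "j \<le> d" by (simp add: mat_diag_def)
    then have "col (M * Q) j = \<theta> j \<cdot>\<^sub>v v j"
      using M Q v(3)[OF j] by (subst col_mult2[of _ ?n ?n _ ?n]) (auto simp: col)
    also have "\<dots> = col (Q * mat_diag ?n \<theta>) j"
      using j v(1)[OF j] Q by (subst mat_diag_mult_right[OF Q]) (auto simp: Q_def)
    finally show "col (M * Q) j = col (Q * mat_diag ?n \<theta>) j" .
  qed (use M Q in \<open>auto simp: mat_diag_def\<close>)
  have EQ: "E i * Q = Q * diag_unit d i" if i: "i \<le> d" for i
  proof (rule mat_col_eqI)
    fix j assume "j < dim_col (Q * diag_unit d i)"
    then have j: "j \<le> d" by (simp add: mat_diag_def)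
    have "col (E i * Q) j = E i *\<^sub>v v j"
      using Ec[OF i] Q j by (subst col_mult2[of _ ?n ?n _ ?n]) (auto simp: col)
    also have "\<dots> = (if \<theta> j = \<theta> i then 1 else 0) \<cdot>\<^sub>v v j"
      unfolding E[OF i] primitive_idempotent_eigenvector[OF M v(1)[OF j] v(3)[OF j]]
      using inj i j by (subst lagrange_coefficient) auto
    also have "\<dots> = col (Q * diag_unit d i) j"
      using i j v(1)[OF j] Q inj by (subst mat_diag_mult_right[OF Q]) (auto simp: Q_def inj_on_def)
    finally show "col (E i * Q) j = col (Q * diag_unit d i) j" .
  qed (use Ec[OF i] Q in \<open>auto simp: mat_diag_def\<close>)
  \<comment> \<open>Independence of the eigenvectors: applying \<open>E i\<close> to a vanishing
    combination with coefficients \<open>x\<close> leaves only the summand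
    \<open>x $ i \<cdot>\<^sub>v v i\<close>.\<close>
  have "det Q \<noteq> 0"
  proof
    assume "det Q = 0"
    then obtain x where x: "x \<in> carrier_vec ?n" "x \<noteq> 0\<^sub>v ?n" "Q *\<^sub>v x = 0\<^sub>v ?n"
      using det_0_iff_vec_prod_zero_field[OF Q] by auto
    have "x $ i = 0" if i: "i < ?n" for i
    proof -
      have id: "i \<le> d" using i by simp
      have "0\<^sub>v ?n = E i *\<^sub>v (Q *\<^sub>v x)" unfolding x(3) using Ec[OF id] by auto
      also have "\<dots> = (E i * Q) *\<^sub>v x"
        using Ec[OF id] Q x(1) by simp
      also have "\<dots> = Q *\<^sub>v (diag_unit d i *\<^sub>v x)"
        unfolding EQ[OF id] using Q x(1) by (intro assoc_mult_mat_vec) auto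
      also have "diag_unit d i *\<^sub>v x = x $ i \<cdot>\<^sub>v unit_vec ?n i"
        unfolding diag_unit_mult_vec[OF x(1)] using i by auto
      also have "Q *\<^sub>v \<dots> = x $ i \<cdot>\<^sub>v v i"
        using Q i id col[OF id] by (simp add: mult_mat_vec[of _ ?n ?n] mult_mat_unit_vec[of _ ?n ?n])
      finally have eq: "x $ i \<cdot>\<^sub>v v i = 0\<^sub>v ?n" by simp
      obtain k where k: "k < ?n" "v i $ k \<noteq> 0"
        using v(1,2)[OF id] by (metis carrier_vecD eq_vecI index_zero_vec)
      from arg_cong[OF eq, of "\<lambda>w. w $ k"] show ?thesis
        using k v(1)[OF id] by simp
    qed
    then have "x = 0\<^sub>v ?n" using x(1) by auto
    with x(2) show False by simp
  qed
  then have "Q \<in> Units (ring_mat TYPE('k) ?n ())"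
    using det_non_zero_imp_unit[OF Q] by auto
  then obtain Qi where "Qi \<in> carrier_mat ?n ?n" "Q * Qi = 1\<^sub>m ?n" "Qi * Q = 1\<^sub>m ?n"
    unfolding Units_def by (auto simp: ring_mat_simps)
  then show thesis using that Q MQ EQ by blast
qed

lemma mat_diag_eqI:
  assumes "\<And>k. k < n \<Longrightarrow> f k = g k"
  shows "mat_diag n f = mat_diag n g"
  using assms by (auto simp: mat_diag_def)

lemma idempotent_ordering_closed:
  "idempotent_ordering d \<A> a \<theta> E \<Longrightarrow> i \<le> d \<Longrightarrow> E i \<in> carrier \<A>"
  using PiE_mem[of E "{0..d}" "\<lambda>_. carrier \<A>" i] by (simp add: idempotent_ordering_def)

lemma idempotent_ordering_inj: "idempotent_ordering d \<A> a \<theta> E \<Longrightarrow> inj_on \<theta> {0..d}"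
  by (simp add: idempotent_ordering_def bij_betw_def)

text \<open>An arbitrary isomorphism onto matrices is followed by the change to an eigenbasis of the
  image of \<open>a\<close>. Identities between primitive idempotents then become identities between
  0-1 diagonal matrices.\<close>

lemma diagonalizing_iso:
  fixes \<A> :: "('k::field, 'a, 'm) module_scheme"
  assumes m: "matrix_algebra d \<A>" and a: "a \<in> carrier \<A>" and ord: "idempotent_ordering d \<A> a \<theta> E"
  obtains h where "algebra_isomorphism \<A> (mat_algebra d) h" "h a = mat_diag (d + 1) \<theta>"
    "\<And>i. i \<le> d \<Longrightarrow> h (E i) = diag_unit d i"
proof -
  obtain h where "h \<in> algebra_iso \<A> (mat_algebra d)" and assoc: "assoc_algebra \<A>"
    using m unfolding matrix_algebra_def by auto
  then interpret h: algebra_isomorphism \<A> "mat_algebra d" h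
    using assoc_mat_algebra by unfold_locales
  have ha: "h a \<in> carrier_mat (d + 1) (d + 1)"
    using h.h_simps(1)[OF a] by (simp add: module_mat_simps)
  obtain Q Qi where Q: "Q \<in> carrier_mat (d + 1) (d + 1)" "Qi \<in> carrier_mat (d + 1) (d + 1)"
    "Q * Qi = 1\<^sub>m (d + 1)" "Qi * Q = 1\<^sub>m (d + 1)"
    "h a * Q = Q * mat_diag (d + 1) \<theta>"
    "\<And>i. i \<le> d \<Longrightarrow> (\<lambda>i\<in>{0..d}. h (E i)) i * Q = Q * diag_unit d i"
    using diagonalization[OF ha h.idempotent_ordering_image[OF m a ord]] by metis
  let ?g = "\<lambda>X. Qi * X * Q"
  have 1: "Qi * X * Q = Y" if "X * Q = Q * Y" "X \<in> carrier_mat (d + 1) (d + 1)"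
    "Y \<in> carrier_mat (d + 1) (d + 1)" for X Y
  proof -
    have "Qi * X * Q = Qi * (X * Q)" using Q(1,2) that by simp
    also have "\<dots> = Qi * Q * Y" unfolding that(1) using Q(1,2) that by simp
    finally show ?thesis using Q(4) that by simp
  qed
  have "?g \<circ> h \<in> algebra_iso \<A> (mat_algebra d)"
    by (rule algebra_iso_comp[OF h.h conjugation_algebra_iso[OF Q(1-4)]])
  then have "algebra_isomorphism \<A> (mat_algebra d) (?g \<circ> h)"
    using assoc assoc_mat_algebra by unfold_locales
  moreover have "(?g \<circ> h) a = mat_diag (d + 1) \<theta>"
    using 1[OF Q(5) ha] by simp
  moreover have "(?g \<circ> h) (E i) = diag_unit d i" if i: "i \<le> d" for i
  proof -
    have "E i \<in> carrier \<A>" using idempotent_ordering_closed[OF ord i] .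
    then show ?thesis using h.h_simps(1)[of "E i"] 1[OF Q(6)[OF i]] i by (simp add: module_mat_simps)
  qed
  ultimately show thesis using that by blast
qed

text \<open>The list \<open>\<theta>\<close> of diagonal entries and the enumeration
  \<open>\<eta>\<close> of the eigenvalues are kept apart, so that different orderings of the same
  spectrum can be compared.\<close>

lemma primitive_idempotent_mat_diag:
  assumes "inj_on \<eta> {0..d}" "i \<le> d" "\<And>k. k \<le> d \<Longrightarrow> \<theta> k \<in> \<eta> ` {0..d}"
  shows "primitive_idempotent d (mat_algebra d) (mat_diag (d + 1) \<theta>) \<eta> i =
    mat_diag (d + 1) (\<lambda>k. if \<theta> k = \<eta> i then 1 else (0::'k::field))" (is "?P = ?D")
proof (rule mat_col_eqI)
  let ?n = "d + 1"
  have P: "?P \<in> carrier_mat ?n ?n"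
    using primitive_idempotent_closed[OF assoc_mat_algebra, of "mat_diag ?n \<theta>" d d \<eta> i]
    by (simp add: module_mat_simps)
  then show "dim_row ?P = dim_row ?D" "dim_col ?P = dim_col ?D" by (auto simp: mat_diag_def)
  fix j assume "j < dim_col ?D"
  then have j: "j < ?n" by (simp add: mat_diag_def)
  have ev: "mat_diag ?n \<theta> *\<^sub>v unit_vec ?n j = \<theta> j \<cdot>\<^sub>v unit_vec ?n j"
    using j by (subst mat_diag_mult_vec) auto
  have "col ?P j = ?P *\<^sub>v unit_vec ?n j"
    using mult_mat_unit_vec[OF P j] by simp
  also have "\<dots> = (if \<theta> j = \<eta> i then 1 else 0) \<cdot>\<^sub>v unit_vec ?n j"
    using assms j by (subst primitive_idempotent_eigenvector[OF _ _ ev])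
      (auto simp: lagrange_coefficient)
  also have "\<dots> = col ?D j" using j by (auto simp: mat_diag_def)
  finally show "col ?P j = col ?D j" .
qed

lemma idempotent_ordering_mat_diag:
  assumes ord: "idempotent_ordering d (mat_algebra d) (mat_diag (d + 1) \<theta>) \<theta> E" and i: "i \<le> d"
  shows "E i = (diag_unit d i :: 'k::field mat)"
proof -
  note inj = idempotent_ordering_inj[OF ord]
  have "E i = primitive_idempotent d (mat_algebra d) (mat_diag (d + 1) \<theta>) \<theta> i"
    using ord i unfolding idempotent_ordering_def by auto
  also have "\<dots> = mat_diag (d + 1) (\<lambda>k. if \<theta> k = \<theta> i then 1 else 0)"
    using inj i by (intro primitive_idempotent_mat_diag) auto
  also have "\<dots> = diag_unit d i"
    using inj_on_eq_iff[OF inj, of _ i] i by (intro mat_diag_eqI) auto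
  finally show ?thesis .
qed

text \<open>The product runs over all the other eigenvalues, so only the eigenvalue matters and not
  its position. Rather than permuting the factors, both sides are compared as diagonal
  matrices.\<close>

lemma primitive_idempotent_reorder:
  assumes m: "matrix_algebra d \<A>" and a: "a \<in> carrier \<A>" and ord: "idempotent_ordering d \<A> a \<theta> E"
    and \<eta>: "bij_betw \<eta> {0..d} {t. alg_eigenvalue d \<A> a t}"
    and ij: "i \<le> d" "j \<le> d" "\<eta> i = \<theta> j"
  shows "primitive_idempotent d \<A> a \<eta> i = E j"
proof -
  obtain h where iso: "algebra_isomorphism \<A> (mat_algebra d) h"
    and ha: "h a = mat_diag (d + 1) \<theta>" and hE: "\<And>i. i \<le> d \<Longrightarrow> h (E i) = diag_unit d i"
    using diagonalizing_iso[OF m a ord] by blast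
  interpret algebra_isomorphism \<A> "mat_algebra d" h by (rule iso)
  have img: "\<eta> ` {0..d} = \<theta> ` {0..d}" and inj: "inj_on \<eta> {0..d}" "inj_on \<theta> {0..d}"
    using \<eta> ord unfolding idempotent_ordering_def bij_betw_def by auto
  have "h (primitive_idempotent d \<A> a \<eta> i) =
      mat_diag (d + 1) (\<lambda>k. if \<theta> k = \<eta> i then 1 else 0)"
    using inj ij img by (simp add: primitive_idempotent_image[OF a] ha primitive_idempotent_mat_diag)
  also have "\<dots> = h (E j)"
    unfolding hE[OF ij(2)] using inj_on_eq_iff[OF inj(2), of _ j] ij by (intro mat_diag_eqI) auto
  finally show ?thesis
    using h_inj primitive_idempotent_closed[OF assoc_A a] idempotent_ordering_closed[OF ord ij(2)] by blast
qed

lemma idempotent_ordering_reverse: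
  assumes "matrix_algebra d \<A>" "a \<in> carrier \<A>" and ord: "idempotent_ordering d \<A> a \<theta> E"
  shows "idempotent_ordering d \<A> a (\<lambda>i\<in>{0..d}. \<theta> (d - i)) (\<lambda>i\<in>{0..d}. E (d - i))"
proof -
  let ?\<eta> = "\<lambda>i\<in>{0..d}. \<theta> (d - i)"
  have "bij_betw (\<lambda>i. d - i) {0..d} {0..d}"
    by (rule bij_betw_byWitness[where f' = "\<lambda>i. d - i"]) auto
  then have "bij_betw (\<theta> \<circ> (\<lambda>i. d - i)) {0..d} {t. alg_eigenvalue d \<A> a t}"
    using ord bij_betw_trans unfolding idempotent_ordering_def by blast
  then have bij: "bij_betw ?\<eta> {0..d} {t. alg_eigenvalue d \<A> a t}"
    by (subst bij_betw_cong[of _ _ "\<theta> \<circ> (\<lambda>i. d - i)"]) auto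
  have "primitive_idempotent d \<A> a ?\<eta> i = E (d - i)" if "i \<le> d" for i
    using that by (intro primitive_idempotent_reorder[OF assms bij]) auto
  then show ?thesis
    unfolding idempotent_ordering_def using bij idempotent_ordering_closed[OF ord] by auto
qed

text \<open>This is the passage to the system whose first split sequence is the second split
  sequence. The conditions on \<open>E i\<close> and \<open>E j\<close> depend on the distance of
  the indices only, which the reversal preserves.\<close>

lemma leonard_system_reverse:
  assumes "leonard_system d \<A> A As E Es"
  shows "leonard_system d \<A> A As (\<lambda>i\<in>{0..d}. E (d - i)) Es"
proof -
  have m: "matrix_algebra d \<A>" and A: "A \<in> carrier \<A>" and seq: "idempotent_sequence d \<A> A As E"
    using assms unfolding leonard_system_def multiplicity_free_def by auto
  obtain \<theta> where ord: "idempotent_ordering d \<A> A \<theta> E"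
    using seq unfolding idempotent_sequence_def by auto
  have "idempotent_sequence d \<A> A As (\<lambda>i\<in>{0..d}. E (d - i))"
    unfolding idempotent_sequence_def
  proof (intro conjI ballI)
    show "\<exists>\<theta>. idempotent_ordering d \<A> A \<theta> (\<lambda>i\<in>{0..d}. E (d - i))"
      using idempotent_ordering_reverse[OF m A ord] by blast
    fix i j assume ij: "i \<in> {0..d}" "j \<in> {0..d}"
    then have "\<bar>int (d - i) - int (d - j)\<bar> = \<bar>int i - int j\<bar>" by (auto simp: of_nat_diff)
    moreover have "d - i \<in> {0..d}" "d - j \<in> {0..d}" by auto
    ultimately have "(1 < \<bar>int i - int j\<bar> \<longrightarrow> E (d - i) \<otimes>\<^bsub>\<A>\<^esub> As \<otimes>\<^bsub>\<A>\<^esub> E (d - j) = \<zero>\<^bsub>\<A>\<^esub>) \<and>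
      (\<bar>int i - int j\<bar> = 1 \<longrightarrow> E (d - i) \<otimes>\<^bsub>\<A>\<^esub> As \<otimes>\<^bsub>\<A>\<^esub> E (d - j) \<noteq> \<zero>\<^bsub>\<A>\<^esub>)"
      using seq unfolding idempotent_sequence_def by metis
    then show "1 < \<bar>int i - int j\<bar> \<longrightarrow> (\<lambda>i\<in>{0..d}. E (d - i)) i \<otimes>\<^bsub>\<A>\<^esub> As \<otimes>\<^bsub>\<A>\<^esub>
        (\<lambda>i\<in>{0..d}. E (d - i)) j = \<zero>\<^bsub>\<A>\<^esub>"
      and "\<bar>int i - int j\<bar> = 1 \<longrightarrow> (\<lambda>i\<in>{0..d}. E (d - i)) i \<otimes>\<^bsub>\<A>\<^esub> As \<otimes>\<^bsub>\<A>\<^esub>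
        (\<lambda>i\<in>{0..d}. E (d - i)) j \<noteq> \<zero>\<^bsub>\<A>\<^esub>"
      using ij by auto
  qed
  then show ?thesis using assms unfolding leonard_system_def by auto
qed

text \<open>A path with unit steps that never revisits a value cannot turn, so
  \<open>\<sigma>\<close> is affine with slope 1 or -1, and its range determines the starting value.
  It serves to compare two orderings of the dual idempotents.\<close>

lemma unit_step_bijection:
  assumes bij: "bij_betw \<sigma> {0..d} {0..d}"
    and step: "\<And>i. i < d \<Longrightarrow> \<bar>int (\<sigma> i) - int (\<sigma> (i + 1))\<bar> = 1"
  shows "(\<forall>i\<le>d. \<sigma> i = i) \<or> (\<forall>i\<le>d. \<sigma> i = d - i)"
proof (cases "d = 0")
  case True
  then show ?thesis using bij by (auto simp: bij_betw_def)
next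
  case False
  define s where "s = int (\<sigma> 1) - int (\<sigma> 0)"
  have s: "s = 1 \<or> s = -1" using step[of 0] False by (auto simp: s_def)
  have inj: "\<sigma> i = \<sigma> j \<longleftrightarrow> i = j" if "i \<le> d" "j \<le> d" for i j
    using bij that by (intro inj_on_eq_iff[of \<sigma> "{0..d}"]) (auto simp: bij_betw_def)
  have diff: "int (\<sigma> (i + 1)) - int (\<sigma> i) = s" if "i < d" for i
    using that
  proof (induction i)
    case 0
    then show ?case by (simp add: s_def)
  next
    case (Suc i)
    \<comment> \<open>A change of direction after \<open>i + 1\<close> would lead back to the value
      at \<open>i\<close>.\<close>
    then have "\<sigma> (i + 2) \<noteq> \<sigma> i" using inj[of "i + 2" i] by auto
    moreover have e: "i + 1 + 1 = i + 2" "Suc i = i + 1" by auto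
    moreover have "\<bar>int (\<sigma> (i + 1)) - int (\<sigma> (i + 2))\<bar> = 1"
      using step[of "i + 1"] Suc.prems unfolding e .
    ultimately have "int (\<sigma> (i + 2)) - int (\<sigma> (i + 1)) = s"
      using Suc.IH Suc.prems s by linarith
    then show ?case unfolding e .
  qed
  have lin: "int (\<sigma> i) = int (\<sigma> 0) + s * int i" if "i \<le> d" for i
    using that
  proof (induction i)
    case (Suc i)
    then have "int (\<sigma> i) = int (\<sigma> 0) + s * int i" "int (\<sigma> (i + 1)) - int (\<sigma> i) = s"
      using diff[of i] by auto
    then show ?case by (simp add: distrib_left Suc_eq_plus1)
  qed simp
  have range: "\<sigma> i \<le> d" if "i \<le> d" for i using bij that by (auto simp: bij_betw_def)
  from s show ?thesis
  proof
    assume s: "s = 1"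
    then have "\<sigma> 0 = 0" using lin[of d] range[of d] by simp
    then have "\<forall>i\<le>d. \<sigma> i = i" using lin s by simp
    then show ?thesis ..
  next
    assume s: "s = -1"
    then have "\<sigma> 0 = d" using lin[of d] range[of 0] by simp
    then have "\<sigma> i = d - i" if "i \<le> d" for i using lin[OF that] that unfolding s by simp
    then show ?thesis by simp
  qed
qed

section \<open>Irreducible modules and split sequences\<close>

lemma finsum_additive:
  assumes "abelian_group G" "abelian_group H" "finite J" "F \<in> J \<rightarrow> carrier G"
    and closed: "\<And>x. x \<in> carrier G \<Longrightarrow> f x \<in> carrier H"
    and add: "\<And>x y. x \<in> carrier G \<Longrightarrow> y \<in> carrier G \<Longrightarrow> f (x \<oplus>\<^bsub>G\<^esub> y) = f x \<oplus>\<^bsub>H\<^esub> f y"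
  shows "f (finsum G F J) = finsum H (\<lambda>j. f (F j)) J"
proof -
  interpret G: abelian_group G by fact
  interpret H: abelian_group H by fact
  have "f \<zero>\<^bsub>G\<^esub> \<oplus>\<^bsub>H\<^esub> f \<zero>\<^bsub>G\<^esub> = f \<zero>\<^bsub>G\<^esub>"
    using add[of "\<zero>\<^bsub>G\<^esub>" "\<zero>\<^bsub>G\<^esub>"] by simp
  then have zero: "f \<zero>\<^bsub>G\<^esub> = \<zero>\<^bsub>H\<^esub>"
    using closed[of "\<zero>\<^bsub>G\<^esub>"] by (metis G.zero_closed H.add.r_cancel_one')
  show ?thesis using assms(3,4)
  proof (induction J rule: finite_induct)
    case empty
    then show ?case using zero by simp
  next
    case (insert j J)
    then have "(\<lambda>j. f (F j)) \<in> J \<rightarrow> carrier H" "f (F j) \<in> carrier H" using closed by auto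
    then show ?case using insert add by (simp add: Pi_def)
  qed
qed

lemma matrix_algebraD: "matrix_algebra d \<A> \<Longrightarrow> ring \<A>" "matrix_algebra d \<A> \<Longrightarrow> assoc_algebra \<A>"
  unfolding matrix_algebra_def assoc_algebra_def by auto

lemma idempotents_orthogonal:
  assumes m: "matrix_algebra d \<A>" and a: "a \<in> carrier \<A>" and ord: "idempotent_ordering d \<A> a \<theta> E"
    and ij: "i \<le> d" "j \<le> d"
  shows "E i \<otimes>\<^bsub>\<A>\<^esub> E j = (if i = j then E i else \<zero>\<^bsub>\<A>\<^esub>)"
proof -
  obtain h where iso: "algebra_isomorphism \<A> (mat_algebra d) h"
    and hE: "\<And>i. i \<le> d \<Longrightarrow> h (E i) = diag_unit d i"
    using diagonalizing_iso[OF m a ord] by blast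
  interpret algebra_isomorphism \<A> "mat_algebra d" h by (rule iso)
  have E: "E i \<in> carrier \<A>" "E j \<in> carrier \<A>" using idempotent_ordering_closed[OF ord] ij by auto
  have "h (E i \<otimes>\<^bsub>\<A>\<^esub> E j) = diag_unit d i * diag_unit d j"
    using E ij by (simp add: h_simps(2) hE module_mat_simps)
  also have "\<dots> = (if i = j then diag_unit d i else 0\<^sub>m (d + 1) (d + 1))"
    unfolding mat_diag_diag by (auto simp: mat_diag_def intro!: eq_matI)
  also have "\<dots> = h (if i = j then E i else \<zero>\<^bsub>\<A>\<^esub>)"
    using hE[OF ij(1)] hE[OF ij(2)] h_zero by (simp add: module_mat_simps)
  finally show ?thesis using E by (subst (asm) h_inj) auto
qed

lemma idempotents_sum:
  fixes \<A> :: "('k::field, 'a, 'm) module_scheme"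
  assumes m: "matrix_algebra d \<A>" and a: "a \<in> carrier \<A>" and ord: "idempotent_ordering d \<A> a \<theta> E"
  shows "finsum \<A> E {0..d} = \<one>\<^bsub>\<A>\<^esub>"
proof -
  let ?M = "mat_algebra d :: ('k, 'k mat) module"
  obtain h where iso: "algebra_isomorphism \<A> ?M h"
    and hE: "\<And>i. i \<le> d \<Longrightarrow> h (E i) = diag_unit d i"
    using diagonalizing_iso[OF m a ord] by blast
  interpret algebra_isomorphism \<A> ?M h by (rule iso)
  have E: "E \<in> {0..d} \<rightarrow> carrier \<A>" using idempotent_ordering_closed[OF ord] by auto
  \<comment> \<open>Partial sums are made explicit so that an induction applies; the identity matrix
    is the case \<open>n = d + 1\<close>.\<close>
  have partial: "finsum ?M (\<lambda>i. diag_unit d i) {..<n} = mat_diag (d + 1) (\<lambda>k. if k < n then 1 else 0)" for n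
  proof (induction n)
    case 0
    show ?case by (auto simp: module_mat_simps mat_diag_def intro!: eq_matI)
  next
    case (Suc n)
    have "finsum ?M (\<lambda>i. diag_unit d i) {..<Suc n} = diag_unit d n + finsum ?M (\<lambda>i. diag_unit d i) {..<n}"
      unfolding lessThan_Suc by (subst B.finsum_insert) (auto simp: module_mat_simps)
    also have "\<dots> = mat_diag (d + 1) (\<lambda>k. if k < Suc n then 1 else 0)"
      unfolding Suc by (auto simp: mat_diag_def intro!: eq_matI)
    finally show ?case .
  qed
  have "h (finsum \<A> E {0..d}) = finsum ?M (\<lambda>i. h (E i)) {0..d}"
    using E by (intro finsum_additive A.abelian_group_axioms B.abelian_group_axioms) (auto simp: h_simps)
  also have "\<dots> = finsum ?M (\<lambda>i. diag_unit d i) {..<d + 1}"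
    using hE by (intro B.finsum_cong') (auto simp: module_mat_simps)
  also have "\<dots> = 1\<^sub>m (d + 1)"
    unfolding partial by (auto simp: mat_diag_def intro!: eq_matI)
  also have "\<dots> = h \<one>\<^bsub>\<A>\<^esub>" by (simp add: h_simps module_mat_simps)
  finally show ?thesis using E by (subst (asm) h_inj) auto
qed

locale left_ring_module =
  fixes R :: "('a, 'r) ring_scheme" and V :: "('a, 'v) module"
  assumes left_module: "left_module R V"
begin

sublocale R: ring R using left_module unfolding left_module_def by blast
sublocale V: abelian_group V using left_module unfolding left_module_def by blast

lemma smult_closed [simp]: "a \<in> carrier R \<Longrightarrow> v \<in> carrier V \<Longrightarrow> a \<odot>\<^bsub>V\<^esub> v \<in> carrier V"
  and smult_l_distr: "a \<in> carrier R \<Longrightarrow> b \<in> carrier R \<Longrightarrow> v \<in> carrier V \<Longrightarrow>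
    (a \<oplus>\<^bsub>R\<^esub> b) \<odot>\<^bsub>V\<^esub> v = a \<odot>\<^bsub>V\<^esub> v \<oplus>\<^bsub>V\<^esub> b \<odot>\<^bsub>V\<^esub> v"
  and smult_r_distr: "a \<in> carrier R \<Longrightarrow> v \<in> carrier V \<Longrightarrow> w \<in> carrier V \<Longrightarrow>
    a \<odot>\<^bsub>V\<^esub> (v \<oplus>\<^bsub>V\<^esub> w) = a \<odot>\<^bsub>V\<^esub> v \<oplus>\<^bsub>V\<^esub> a \<odot>\<^bsub>V\<^esub> w"
  and smult_assoc: "a \<in> carrier R \<Longrightarrow> b \<in> carrier R \<Longrightarrow> v \<in> carrier V \<Longrightarrow>
    (a \<otimes>\<^bsub>R\<^esub> b) \<odot>\<^bsub>V\<^esub> v = a \<odot>\<^bsub>V\<^esub> (b \<odot>\<^bsub>V\<^esub> v)"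
  and smult_one [simp]: "v \<in> carrier V \<Longrightarrow> \<one>\<^bsub>R\<^esub> \<odot>\<^bsub>V\<^esub> v = v"
  using left_module unfolding left_module_def by auto

lemma smult_zero_left [simp]:
  assumes "v \<in> carrier V" shows "\<zero>\<^bsub>R\<^esub> \<odot>\<^bsub>V\<^esub> v = \<zero>\<^bsub>V\<^esub>"
  using smult_l_distr[of "\<zero>\<^bsub>R\<^esub>" "\<zero>\<^bsub>R\<^esub>" v] assms
  by (metis R.zero_closed R.l_zero V.add.r_cancel_one' smult_closed)

lemma smult_zero_right [simp]:
  assumes "a \<in> carrier R" shows "a \<odot>\<^bsub>V\<^esub> \<zero>\<^bsub>V\<^esub> = \<zero>\<^bsub>V\<^esub>"
  using smult_r_distr[of a "\<zero>\<^bsub>V\<^esub>" "\<zero>\<^bsub>V\<^esub>"] assms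
  by (metis V.zero_closed V.l_zero V.add.r_cancel_one' smult_closed)

text \<open>It turns the eigenvalue equation in the definition of a split sequence into the
  vanishing of one ring element on \<open>v\<close>, the only kind of statement that
  \<open>irreducible_annihilator\<close> transports.\<close>

lemma smult_minus_eq_zero:
  assumes "a \<in> carrier R" "b \<in> carrier R" "v \<in> carrier V"
  shows "(a \<ominus>\<^bsub>R\<^esub> b) \<odot>\<^bsub>V\<^esub> v = \<zero>\<^bsub>V\<^esub> \<longleftrightarrow> a \<odot>\<^bsub>V\<^esub> v = b \<odot>\<^bsub>V\<^esub> v"
proof -
  have "(a \<ominus>\<^bsub>R\<^esub> b) \<oplus>\<^bsub>R\<^esub> b = a" using assms by (simp add: R.minus_eq R.a_assoc R.l_neg)
  then have "a \<odot>\<^bsub>V\<^esub> v = (a \<ominus>\<^bsub>R\<^esub> b) \<odot>\<^bsub>V\<^esub> v \<oplus>\<^bsub>V\<^esub> b \<odot>\<^bsub>V\<^esub> v"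
    using smult_l_distr[of "a \<ominus>\<^bsub>R\<^esub> b" b v] assms by simp
  then show ?thesis using assms by (simp add: V.add.r_cancel_one)
qed

text \<open>Orthogonality kills E_j V for every projection outside \<open>J\<close>, and u is the
  sum of all E_j u because the idempotents sum to one. Sums of components thus become common
  kernels, that is, annihilation conditions.\<close>

lemma component_sum_eq:
  assumes E: "\<And>i. i \<le> d \<Longrightarrow> E i \<in> carrier R"
    and orth: "\<And>i j. i \<le> d \<Longrightarrow> j \<le> d \<Longrightarrow> i \<noteq> j \<Longrightarrow> E i \<otimes>\<^bsub>R\<^esub> E j = \<zero>\<^bsub>R\<^esub>"
    and sum: "finsum R E {0..d} = \<one>\<^bsub>R\<^esub>" and J: "J \<subseteq> {0..d}"
  shows "component_sum V E J = {u \<in> carrier V. \<forall>l\<in>{0..d} - J. E l \<odot>\<^bsub>V\<^esub> u = \<zero>\<^bsub>V\<^esub>}" (is "?L = ?R")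
proof
  have fin: "finite J" using J finite_subset by blast
  show "?L \<subseteq> ?R"
  proof
    fix u assume "u \<in> ?L"
    then obtain w where w: "w \<in> J \<rightarrow> carrier V" and u: "u = finsum V (\<lambda>j. E j \<odot>\<^bsub>V\<^esub> w j) J"
      unfolding component_sum_def by auto
    have c: "(\<lambda>j. E j \<odot>\<^bsub>V\<^esub> w j) \<in> J \<rightarrow> carrier V" 
      using w E J by (intro Pi_I smult_closed) auto
    then have "u \<in> carrier V" unfolding u by simp
    moreover have "E l \<odot>\<^bsub>V\<^esub> u = \<zero>\<^bsub>V\<^esub>" if l: "l \<in> {0..d} - J" for l
    proof -
      have "E l \<odot>\<^bsub>V\<^esub> u = finsum V (\<lambda>j. E l \<odot>\<^bsub>V\<^esub> (E j \<odot>\<^bsub>V\<^esub> w j)) J"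
        unfolding u using E l
        by (intro finsum_additive V.abelian_group_axioms fin c) (auto simp: smult_r_distr)
      also have "\<dots> = finsum V (\<lambda>j. \<zero>\<^bsub>V\<^esub>) J"
      proof (intro V.finsum_cong' refl)
        fix j assume j: "j \<in> J"
        then have "E l \<odot>\<^bsub>V\<^esub> (E j \<odot>\<^bsub>V\<^esub> w j) = (E l \<otimes>\<^bsub>R\<^esub> E j) \<odot>\<^bsub>V\<^esub> w j"
          using E l J w by (intro smult_assoc[symmetric]) auto
        also have "E l \<otimes>\<^bsub>R\<^esub> E j = \<zero>\<^bsub>R\<^esub>" using l j J by (intro orth) auto
        finally show "E l \<odot>\<^bsub>V\<^esub> (E j \<odot>\<^bsub>V\<^esub> w j) = \<zero>\<^bsub>V\<^esub>"
          using smult_zero_left[of "w j"] w j by (simp add: Pi_iff)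
      qed auto
      finally show ?thesis by simp
    qed
    ultimately show "u \<in> ?R" by auto
  qed
  show "?R \<subseteq> ?L"
  proof
    fix u assume u: "u \<in> ?R"
    then have uc: "u \<in> carrier V" by auto
    have c: "(\<lambda>j. E j \<odot>\<^bsub>V\<^esub> u) \<in> {0..d} \<rightarrow> carrier V" using E uc by auto
    have "u = finsum R E {0..d} \<odot>\<^bsub>V\<^esub> u" unfolding sum using uc by simp
    also have "\<dots> = finsum V (\<lambda>j. E j \<odot>\<^bsub>V\<^esub> u) {0..d}"
      using E uc by (intro finsum_additive[where f = "\<lambda>x. x \<odot>\<^bsub>V\<^esub> u"] R.abelian_group_axioms V.abelian_group_axioms)
        (auto simp: smult_l_distr)
    also have "\<dots> = finsum V (\<lambda>j. E j \<odot>\<^bsub>V\<^esub> u) J"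
      using u J c by (intro V.add.finprod_mono_neutral_cong_right[folded finsum_def]) auto
    finally show "u \<in> ?L" unfolding component_sum_def using uc by auto
  qed
qed

end

section \<open>Irreducible modules compared through annihilators\<close>

definition matrix_unit :: "nat \<Rightarrow> nat \<Rightarrow> nat \<Rightarrow> 'k::field mat" where
  "matrix_unit n i j = mat n n (\<lambda>(p, q). if p = i \<and> q = j then 1 else 0)"

lemma matrix_unit_closed [simp]: "matrix_unit n i j \<in> carrier_mat n n"
  by (simp add: matrix_unit_def)

lemma matrix_unit_mult_left:
  assumes "Y \<in> carrier_mat n n" "j < n"
  shows "matrix_unit n i j * Y = mat n n (\<lambda>(p, q). if p = i then Y $$ (j, q) else (0 :: 'k::field))"
proof (rule eq_matI)
  fix p q assume "p < dim_row (mat n n (\<lambda>(p, q). if p = i then Y $$ (j, q) else (0 :: 'k)))"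
    "q < dim_col (mat n n (\<lambda>(p, q). if p = i then Y $$ (j, q) else (0 :: 'k)))"
  then have pq: "p < n" "q < n" by auto
  then have "(matrix_unit n i j * Y) $$ (p, q) = (\<Sum>r = 0..<n. (if p = i \<and> r = j then 1 else 0) * Y $$ (r, q))"
    using assms by (simp add: matrix_unit_def scalar_prod_def)
  also have "\<dots> = (\<Sum>r\<in>{j}. (if p = i \<and> r = j then 1 else 0) * Y $$ (r, q))"
    using assms by (intro sum.mono_neutral_right) auto
  finally show "(matrix_unit n i j * Y) $$ (p, q) = mat n n (\<lambda>(p, q). if p = i then Y $$ (j, q) else 0) $$ (p, q)"
    using pq by simp
qed (use assms in \<open>auto simp: matrix_unit_def\<close>)

lemma matrix_unit_mult_right:
  assumes "Y \<in> carrier_mat n n" "i < n"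
  shows "Y * matrix_unit n i j = mat n n (\<lambda>(p, q). if q = j then Y $$ (p, i) else (0 :: 'k::field))"
proof (rule eq_matI)
  fix p q assume "p < dim_row (mat n n (\<lambda>(p, q). if q = j then Y $$ (p, i) else (0 :: 'k)))"
    "q < dim_col (mat n n (\<lambda>(p, q). if q = j then Y $$ (p, i) else (0 :: 'k)))"
  then have pq: "p < n" "q < n" by auto
  then have "(Y * matrix_unit n i j) $$ (p, q) = (\<Sum>r = 0..<n. Y $$ (p, r) * (if r = i \<and> q = j then 1 else 0))"
    using assms by (simp add: matrix_unit_def scalar_prod_def)
  also have "\<dots> = (\<Sum>r\<in>{i}. Y $$ (p, r) * (if r = i \<and> q = j then 1 else 0))"
    using assms by (intro sum.mono_neutral_right) auto
  finally show "(Y * matrix_unit n i j) $$ (p, q) = mat n n (\<lambda>(p, q). if q = j then Y $$ (p, i) else 0) $$ (p, q)"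
    using pq by simp
qed (use assms in \<open>auto simp: matrix_unit_def\<close>)

text \<open>Let e_ij be the preimages of the matrix units. Some z = e_0i u is nonzero and fixed by
  e_00, and it generates \<open>V\<close>, so u = b z. Then \<open>x\<close> is column 0 of
  \<open>h b\<close>: the element a b e_00 acts on z as a acts on u, and its matrix has
  \<open>h a *\<^sub>v x\<close> as its only possibly nonzero column.\<close>

lemma irreducible_annihilator:
  fixes \<A> :: "('k::field, 'a, 'm) module_scheme" and V :: "('a, 'v) module"
  assumes iso: "algebra_isomorphism \<A> (mat_algebra d) h" and irr: "irreducible_left_module \<A> V"
    and u: "u \<in> carrier V" "u \<noteq> \<zero>\<^bsub>V\<^esub>"
  obtains x where "x \<in> carrier_vec (d + 1)" "x \<noteq> 0\<^sub>v (d + 1)"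
    "\<And>a. a \<in> carrier \<A> \<Longrightarrow> a \<odot>\<^bsub>V\<^esub> u = \<zero>\<^bsub>V\<^esub> \<longleftrightarrow> h a *\<^sub>v x = 0\<^sub>v (d + 1)"
proof -
  let ?n = "d + 1"
  interpret algebra_isomorphism \<A> "mat_algebra d" h by (rule iso)
  interpret left_ring_module \<A> V using irr unfolding irreducible_left_module_def by unfold_locales auto
  define e where "e i j = k (matrix_unit ?n i j)" for i j
  have e: "e i j \<in> carrier \<A>" "h (e i j) = matrix_unit ?n i j" for i j
    using h_k[of "matrix_unit ?n i j"] by (auto simp: e_def module_mat_simps)
  have hc: "h a \<in> carrier_mat ?n ?n" if "a \<in> carrier \<A>" for a
    using h_simps(1)[OF that] by (simp add: module_mat_simps)
  have hm: "h (a \<otimes>\<^bsub>\<A>\<^esub> b) = h a * h b" if "a \<in> carrier \<A>" "b \<in> carrier \<A>" for a b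
    using h_simps(2)[OF that] by (simp add: module_mat_simps)
  have ee: "e i j \<otimes>\<^bsub>\<A>\<^esub> e j l = e i l" if "j < ?n" for i j l
  proof -
    have "h (e i j \<otimes>\<^bsub>\<A>\<^esub> e j l) = h (e i l)"
      using that e by (simp add: hm matrix_unit_mult_left) (auto simp: matrix_unit_def)
    then show ?thesis using e by (subst (asm) h_inj) auto
  qed
  \<comment> \<open>If all e_0i u vanished, then so would e_ii u = e_i0 e_0i u, and their sum is
    u.\<close>
  have "\<exists>i<?n. e 0 i \<odot>\<^bsub>V\<^esub> u \<noteq> \<zero>\<^bsub>V\<^esub>"
  proof (rule ccontr)
    assume "\<not> ?thesis"
    then have z: "e 0 i \<odot>\<^bsub>V\<^esub> u = \<zero>\<^bsub>V\<^esub>" if "i < ?n" for i using that by blast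
    have zz: "e i i \<odot>\<^bsub>V\<^esub> u = \<zero>\<^bsub>V\<^esub>" if "i < ?n" for i
      using smult_assoc[of "e i 0" "e 0 i" u] ee[of 0 i i] z[OF that] e u by simp
    have "k (mat_diag ?n (\<lambda>j. if j < n then 1 else 0)) \<odot>\<^bsub>V\<^esub> u = \<zero>\<^bsub>V\<^esub>" if "n \<le> ?n" for n
      using that
    proof (induction n)
      case 0
      have "mat_diag ?n (\<lambda>j. if j < (0::nat) then 1 else 0) = h \<zero>\<^bsub>\<A>\<^esub>"
        by (auto simp: h_zero module_mat_simps mat_diag_def intro!: eq_matI)
      then show ?case using u by (simp add: k_h)
    next
      case (Suc n)
      let ?D = "mat_diag ?n (\<lambda>j. if j < n then 1 else 0)"
      have D: "?D \<in> carrier (mat_algebra d)" by (simp add: module_mat_simps)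
      have "mat_diag ?n (\<lambda>j. if j < Suc n then 1 else 0) = ?D + matrix_unit ?n n n"
        using Suc by (auto simp: mat_diag_def matrix_unit_def intro!: eq_matI)
      also have "\<dots> = h (k ?D \<oplus>\<^bsub>\<A>\<^esub> e n n)"
        using e h_k[OF D] by (simp add: h_simps(3)) (simp add: module_mat_simps)
      finally have "k (mat_diag ?n (\<lambda>j. if j < Suc n then 1 else 0)) = k ?D \<oplus>\<^bsub>\<A>\<^esub> e n n"
        using e h_k[OF D] by (simp add: k_h)
      then show ?case using Suc zz[of n] e u h_k[OF D] by (simp add: smult_l_distr)
    qed
    from this[of ?n] have "k (mat_diag ?n (\<lambda>j. if j < ?n then 1 else 0)) \<odot>\<^bsub>V\<^esub> u = \<zero>\<^bsub>V\<^esub>" by blast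
    moreover have "mat_diag ?n (\<lambda>j. if j < ?n then 1 else 0) = h \<one>\<^bsub>\<A>\<^esub>"
      by (auto simp: h_simps module_mat_simps mat_diag_def intro!: eq_matI)
    ultimately show False using u by (simp add: k_h)
  qed
  then obtain i where i: "i < ?n" "e 0 i \<odot>\<^bsub>V\<^esub> u \<noteq> \<zero>\<^bsub>V\<^esub>" by blast
  define z where "z = e 0 i \<odot>\<^bsub>V\<^esub> u"
  have z: "z \<in> carrier V" "z \<noteq> \<zero>\<^bsub>V\<^esub>" using i e u by (auto simp: z_def)
  have ez: "e 0 0 \<odot>\<^bsub>V\<^esub> z = z"
    unfolding z_def using smult_assoc[of "e 0 0" "e 0 i" u] ee[of 0 0 i] e u by simp
  \<comment> \<open>The cyclic submodule generated by z; by irreducibility it is everything, which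
    provides \<open>b\<close>.\<close>
  define W where "W = {a \<odot>\<^bsub>V\<^esub> z | a. a \<in> carrier \<A>}"
  have "Module.submodule W \<A> V"
  proof (intro Module.submodule.intro V.add.subgroupI)
    show "W \<subseteq> carrier V" "W \<noteq> {}" using z by (auto simp: W_def)
    show "\<ominus>\<^bsub>V\<^esub> w \<in> W" if w: "w \<in> W" for w
    proof -
      obtain a where a: "a \<in> carrier \<A>" "w = a \<odot>\<^bsub>V\<^esub> z" using w by (auto simp: W_def)
      have "(\<ominus>\<^bsub>\<A>\<^esub> a) \<odot>\<^bsub>V\<^esub> z \<oplus>\<^bsub>V\<^esub> w = \<zero>\<^bsub>V\<^esub>"
        using smult_l_distr[of "\<ominus>\<^bsub>\<A>\<^esub> a" a z] a z by (simp add: A.l_neg)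
      then have "\<ominus>\<^bsub>V\<^esub> w = (\<ominus>\<^bsub>\<A>\<^esub> a) \<odot>\<^bsub>V\<^esub> z"
        using V.minus_equality[of _ w] a z by simp
      then show ?thesis using a by (auto simp: W_def)
    qed
    show "w \<oplus>\<^bsub>V\<^esub> w' \<in> W" if w: "w \<in> W" "w' \<in> W" for w w'
    proof -
      obtain a a' where "a \<in> carrier \<A>" "w = a \<odot>\<^bsub>V\<^esub> z" "a' \<in> carrier \<A>" "w' = a' \<odot>\<^bsub>V\<^esub> z"
        using w by (auto simp: W_def)
      then show ?thesis using smult_l_distr[of a a' z] z by (auto simp: W_def intro!: exI[of _ "a \<oplus>\<^bsub>\<A>\<^esub> a'"])
    qed
    show "Module.submodule_axioms W \<A> V"
    proof
      fix b w assume b: "b \<in> carrier \<A>" and "w \<in> W"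
      then obtain a where "a \<in> carrier \<A>" "w = a \<odot>\<^bsub>V\<^esub> z" by (auto simp: W_def)
      then show "b \<odot>\<^bsub>V\<^esub> w \<in> W"
        using smult_assoc[of b a z] b z by (auto simp: W_def intro!: exI[of _ "b \<otimes>\<^bsub>\<A>\<^esub> a"])
    qed
  qed
  moreover have "z \<in> W" using ez e unfolding W_def by (metis (mono_tags, lifting) mem_Collect_eq)
  ultimately have "W = carrier V" using irr z unfolding irreducible_left_module_def by blast
  then obtain b where b: "b \<in> carrier \<A>" "u = b \<odot>\<^bsub>V\<^esub> z" using u by (auto simp: W_def)
  define x where "x = col (h b) 0"
  have x: "x \<in> carrier_vec ?n" using hc[OF b(1)] by (auto simp: x_def intro: carrier_vecI)
  have iff: "a \<odot>\<^bsub>V\<^esub> u = \<zero>\<^bsub>V\<^esub> \<longleftrightarrow> h a *\<^sub>v x = 0\<^sub>v ?n" if a: "a \<in> carrier \<A>" for a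
  proof -
    \<comment> \<open>The factor e_00 is invisible on z but erases all columns of
      \<open>h a * h b\<close> except column 0, so that \<open>c\<close> vanishes exactly when
      \<open>h a *\<^sub>v x\<close> does.\<close>
    define c where "c = a \<otimes>\<^bsub>\<A>\<^esub> b \<otimes>\<^bsub>\<A>\<^esub> e 0 0"
    have c: "c \<in> carrier \<A>" using a b e by (simp add: c_def)
    have cz: "c \<odot>\<^bsub>V\<^esub> z = a \<odot>\<^bsub>V\<^esub> u"
      unfolding c_def b(2) using a b e z ez by (simp add: smult_assoc)
    have ab: "h a * h b \<in> carrier_mat ?n ?n" using mult_carrier_mat[OF hc[OF a] hc[OF b(1)]] .
    have ax: "h a *\<^sub>v x = col (h a * h b) 0"
      unfolding x_def using hc a b by (subst col_mult2[of _ ?n ?n _ ?n]) auto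
    have ax_index: "(h a *\<^sub>v x) $ p = (h a * h b) $$ (p, 0)" if "p < ?n" for p
      unfolding ax using that carrier_matD[OF ab] by (intro index_col) auto
    have hcm: "h c = mat ?n ?n (\<lambda>(p, q). if q = 0 then (h a *\<^sub>v x) $ p else 0)"
      unfolding c_def using a b e ab
      by (simp add: hm matrix_unit_mult_right) (auto simp: ax_index intro!: eq_matI)
    show ?thesis
    proof
      assume "h a *\<^sub>v x = 0\<^sub>v ?n"
      then have "h c = h \<zero>\<^bsub>\<A>\<^esub>"
        unfolding hcm h_zero by (auto simp: module_mat_simps intro!: eq_matI)
      then have "c = \<zero>\<^bsub>\<A>\<^esub>" using c by (subst (asm) h_inj) auto
      then show "a \<odot>\<^bsub>V\<^esub> u = \<zero>\<^bsub>V\<^esub>" using cz z by simp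
    next
      assume au: "a \<odot>\<^bsub>V\<^esub> u = \<zero>\<^bsub>V\<^esub>"
      show "h a *\<^sub>v x = 0\<^sub>v ?n"
      proof (rule ccontr)
        assume "h a *\<^sub>v x \<noteq> 0\<^sub>v ?n"
        moreover have "h a *\<^sub>v x \<in> carrier_vec ?n" using hc[OF a] x by simp
        ultimately obtain r where r: "r < ?n" "(h a *\<^sub>v x) $ r \<noteq> 0"
          by (metis carrier_vecD eq_vecI index_zero_vec)
        \<comment> \<open>A nonzero entry in row r of \<open>c\<close> can be moved to position (0,
          0) and normalized: e_0r c divided by that entry is e_00. Hence c z = 0 would force z =
          e_00 z = 0.\<close>
        let ?s = "inverse ((h a *\<^sub>v x) $ r)"
        have "h ((?s \<odot>\<^bsub>\<A>\<^esub> e 0 r) \<otimes>\<^bsub>\<A>\<^esub> c) = ?s \<cdot>\<^sub>m (matrix_unit ?n 0 r * h c)"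
          using e c hc[OF c] by (simp add: hm A_smult(1) h_simps(5) mult_smult_assoc_mat[of _ ?n ?n])
            (simp add: module_mat_simps mult_smult_assoc_mat[of _ ?n ?n _ ?n])
        also have "\<dots> = h (e 0 0)"
          unfolding e(2) using r hc[OF c]
          by (subst matrix_unit_mult_left) (auto simp: hcm matrix_unit_def intro!: eq_matI)
        finally have "(?s \<odot>\<^bsub>\<A>\<^esub> e 0 r) \<otimes>\<^bsub>\<A>\<^esub> c = e 0 0"
          using e c by (subst (asm) h_inj) (auto simp: A_smult(1))
        then have "z = (?s \<odot>\<^bsub>\<A>\<^esub> e 0 r) \<odot>\<^bsub>V\<^esub> (c \<odot>\<^bsub>V\<^esub> z)"
          using smult_assoc[of "?s \<odot>\<^bsub>\<A>\<^esub> e 0 r" c z] e c z ez by (simp add: A_smult(1))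
        also have "\<dots> = \<zero>\<^bsub>V\<^esub>" unfolding cz au using e by (simp add: A_smult(1))
        finally show False using z by simp
      qed
    qed
  qed
  have "x \<noteq> 0\<^sub>v ?n"
  proof
    assume "x = 0\<^sub>v ?n"
    then have "h \<one>\<^bsub>\<A>\<^esub> *\<^sub>v x = 0\<^sub>v ?n" using hc[OF A.one_closed] by auto
    then show False using iff[OF A.one_closed] u by simp
  qed
  then show thesis using that x iff by blast
qed

definition column_module :: "nat \<Rightarrow> ('a \<Rightarrow> 'k::field mat) \<Rightarrow> ('a, 'k vec) module" where
  "column_module d h = \<lparr>carrier = carrier_vec (d + 1), monoid.mult = undefined, one = undefined,
     zero = 0\<^sub>v (d + 1), add = (+), module.smult = (\<lambda>a v. h a *\<^sub>v v)\<rparr>"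

lemma column_module_simps:
  "carrier (column_module d h) = carrier_vec (d + 1)"
  "zero (column_module d h) = 0\<^sub>v (d + 1)"
  "add (column_module d h) = (+)"
  "a \<odot>\<^bsub>column_module d h\<^esub> v = h a *\<^sub>v v"
  by (simp_all add: column_module_def)

text \<open>This concrete module is the witness for the existential over \<open>V\<close> in
  \<open>first_split_sequence\<close>.\<close>

lemma irreducible_column_module:
  fixes \<A> :: "('k::field, 'a, 'm) module_scheme"
  assumes iso: "algebra_isomorphism \<A> (mat_algebra d) h"
  shows "irreducible_left_module \<A> (column_module d h)"
proof -
  let ?n = "d + 1" and ?V = "column_module d h"
  interpret algebra_isomorphism \<A> "mat_algebra d" h by (rule iso)
  have hc: "h a \<in> carrier_mat ?n ?n" if "a \<in> carrier \<A>" for a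
    using h_simps(1)[OF that] by (simp add: module_mat_simps)
  have ab: "abelian_group ?V"
  proof (rule abelian_groupI)
    fix x assume "x \<in> carrier ?V"
    then show "\<exists>y\<in>carrier ?V. y \<oplus>\<^bsub>?V\<^esub> x = \<zero>\<^bsub>?V\<^esub>"
      by (intro bexI[of _ "- x"]) (auto simp: column_module_simps)
  qed (auto simp: column_module_simps intro: assoc_add_vec comm_add_vec)
  have "h a *\<^sub>v v \<in> carrier_vec ?n" if "a \<in> carrier \<A>" "v \<in> carrier_vec ?n" for a v
    using mult_mat_vec_carrier[OF hc[OF that(1)] that(2)] .
  moreover have "h a * h b *\<^sub>v v = h a *\<^sub>v (h b *\<^sub>v v)"
    if "a \<in> carrier \<A>" "b \<in> carrier \<A>" "v \<in> carrier_vec ?n" for a b v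
    using assoc_mult_mat_vec[OF hc[OF that(1)] hc[OF that(2)] that(3)] .
  ultimately have lm: "left_module \<A> ?V"
    unfolding left_module_def using ab hc A.ring_axioms
    by (auto simp: column_module_simps h_simps module_mat_simps add_mult_distrib_mat_vec[of _ ?n ?n]
        mult_add_distrib_mat_vec[of _ ?n ?n])
  have ne: "carrier ?V \<noteq> {\<zero>\<^bsub>?V\<^esub>}"
  proof
    assume "carrier ?V = {\<zero>\<^bsub>?V\<^esub>}"
    moreover have "(unit_vec ?n 0 :: 'k vec) \<in> carrier ?V" by (simp add: column_module_simps)
    ultimately have "unit_vec ?n 0 = (0\<^sub>v ?n :: 'k vec)" by (simp add: column_module_simps)
    then have "unit_vec ?n 0 $ 0 = (0\<^sub>v ?n :: 'k vec) $ 0" by (rule arg_cong)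
    then show False by simp
  qed
  have "W = {\<zero>\<^bsub>?V\<^esub>} \<or> W = carrier ?V" if W: "Module.submodule W \<A> ?V" for W
  proof (rule disjCI)
    assume nc: "W \<noteq> carrier ?V"
    have sub: "subgroup W (add_monoid ?V)" using W by (simp add: Module.submodule_def)
    have sm: "h a *\<^sub>v w \<in> W" if "a \<in> carrier \<A>" "w \<in> W" for a w
      using Module.submodule.smult_closed[OF W that] by (simp add: column_module_simps)
    have Wc: "W \<subseteq> carrier_vec ?n" and W0: "0\<^sub>v ?n \<in> W"
      using subgroup.subset[OF sub] subgroup.one_closed[OF sub] by (auto simp: column_module_simps)
    have "w = 0\<^sub>v ?n" if w: "w \<in> W" for w
    proof (rule ccontr)
      assume "w \<noteq> 0\<^sub>v ?n"
      then obtain r where r: "r < ?n" "w $ r \<noteq> 0"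
        using w Wc by (metis carrier_vecD eq_vecI index_zero_vec subsetD)
      have "x \<in> W" if x: "x \<in> carrier_vec ?n" for x
      proof -
        \<comment> \<open>A matrix with a single nonzero column that sends \<open>w\<close> to the
          prescribed \<open>x\<close>; hence any nonzero \<open>w\<close> generates all column
          vectors.\<close>
        define N where "N = mat ?n ?n (\<lambda>(p, q). if q = r then x $ p * inverse (w $ r) else 0)"
        have N: "N \<in> carrier (mat_algebra d)" by (simp add: N_def module_mat_simps)
        have "(N *\<^sub>v w) $ p = x $ p" if p: "p < ?n" for p
        proof -
          have "(N *\<^sub>v w) $ p = (\<Sum>q = 0..<?n. (if q = r then x $ p * inverse (w $ r) else 0) * w $ q)"
            using p w Wc by (auto simp: N_def scalar_prod_def)
          also have "\<dots> = (\<Sum>q\<in>{r}. (if q = r then x $ p * inverse (w $ r) else 0) * w $ q)"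
            using r by (intro sum.mono_neutral_right) auto
          finally show ?thesis using r by simp
        qed
        then have "N *\<^sub>v w = x" using x by (auto simp: N_def)
        then show "x \<in> W" using sm[of "k N" w] h_k[OF N] w by simp
      qed
      then show False using nc Wc by (auto simp: column_module_simps)
    qed
    with W0 have "W = {0\<^sub>v ?n}" by blast
    then show "W = {\<zero>\<^bsub>?V\<^esub>}" by (simp add: column_module_simps)
  qed
  then show ?thesis using lm ne unfolding irreducible_left_module_def by blast
qed

text \<open>A description free of modules, valid for every isomorphism \<open>h\<close> onto
  matrices. From an arbitrary \<open>V\<close> one passes to column vectors by equality of
  annihilators; in the other direction the column module is taken for \<open>V\<close>. The two
  kernel conditions express membership in the split component.\<close>

lemma first_split_sequence_iff:
  fixes \<A> :: "('k::field, 'a, 'm) module_scheme"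
  assumes m: "matrix_algebra d \<A>" and A: "A \<in> carrier \<A>" and As: "As \<in> carrier \<A>"
    and iso: "algebra_isomorphism \<A> (mat_algebra d) h"
  shows "first_split_sequence d \<A> A As E Es \<phi> \<longleftrightarrow> \<phi> \<in> {1..d} \<rightarrow>\<^sub>E UNIV \<and>
    (\<exists>\<theta> \<theta>s. idempotent_ordering d \<A> A \<theta> E \<and> idempotent_ordering d \<A> As \<theta>s Es \<and>
      (\<forall>i\<in>{1..d}. \<exists>x\<in>carrier_vec (d + 1). x \<noteq> 0\<^sub>v (d + 1) \<and>
         (\<forall>l\<in>{i<..d}. h (Es l) *\<^sub>v x = 0\<^sub>v (d + 1)) \<and> (\<forall>l<i. h (E l) *\<^sub>v x = 0\<^sub>v (d + 1)) \<and>
         h (alg_shift \<A> A (\<theta> (i - 1)) \<otimes>\<^bsub>\<A>\<^esub> alg_shift \<A> As (\<theta>s i)) *\<^sub>v x = \<phi> i \<cdot>\<^sub>v x))"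
    (is "_ \<longleftrightarrow> _ \<and> (\<exists>\<theta> \<theta>s. _ \<and> _ \<and> (\<forall>i\<in>{1..d}. \<exists>x\<in>carrier_vec (d + 1). ?Q \<theta> \<theta>s i x))")
proof -
  let ?n = "d + 1"
  interpret algebra_isomorphism \<A> "mat_algebra d" h by (rule iso)
  have hc: "h a \<in> carrier_mat ?n ?n" if "a \<in> carrier \<A>" for a
    using h_simps(1)[OF that] by (simp add: module_mat_simps)
  define S where "S \<theta> \<theta>s i = alg_shift \<A> A (\<theta> (i - 1)) \<otimes>\<^bsub>\<A>\<^esub> alg_shift \<A> As (\<theta>s i)" for \<theta> \<theta>s :: "nat \<Rightarrow> 'k" and i
  have S: "S \<theta> \<theta>s i \<in> carrier \<A>" for \<theta> \<theta>s i
    using A As by (simp add: S_def alg_shift_closed)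
  have scal: "c \<odot>\<^bsub>\<A>\<^esub> \<one>\<^bsub>\<A>\<^esub> \<in> carrier \<A>" for c by (simp add: A_smult(1))
  have split: "u \<in> split_component d V E Es i \<longleftrightarrow> u \<in> carrier V \<and>
      (\<forall>l\<in>{i<..d}. Es l \<odot>\<^bsub>V\<^esub> u = \<zero>\<^bsub>V\<^esub>) \<and> (\<forall>l<i. E l \<odot>\<^bsub>V\<^esub> u = \<zero>\<^bsub>V\<^esub>)"
    if ord: "idempotent_ordering d \<A> A \<theta> E" "idempotent_ordering d \<A> As \<theta>s Es"
      and V: "left_module \<A> V" and i: "i \<le> d" for \<theta> \<theta>s V u i
  proof -
    interpret V: left_ring_module \<A> V using V by unfold_locales
    have "component_sum V Es {0..i} = {u \<in> carrier V. \<forall>l\<in>{0..d} - {0..i}. Es l \<odot>\<^bsub>V\<^esub> u = \<zero>\<^bsub>V\<^esub>}"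
      using idempotents_orthogonal[OF m As ord(2)] i
      by (intro V.component_sum_eq idempotents_sum[OF m As ord(2)] idempotent_ordering_closed[OF ord(2)]) auto
    moreover have "component_sum V E {i..d} = {u \<in> carrier V. \<forall>l\<in>{0..d} - {i..d}. E l \<odot>\<^bsub>V\<^esub> u = \<zero>\<^bsub>V\<^esub>}"
      using idempotents_orthogonal[OF m A ord(1)] i
      by (intro V.component_sum_eq idempotents_sum[OF m A ord(1)] idempotent_ordering_closed[OF ord(1)]) auto
    moreover have "{0..d} - {0..i} = {i<..d}" "{0..d} - {i..d} = {..<i}" using i by auto
    ultimately show ?thesis unfolding split_component_def by auto
  qed
  have shift_zero: "h (S \<theta> \<theta>s i \<ominus>\<^bsub>\<A>\<^esub> c \<odot>\<^bsub>\<A>\<^esub> \<one>\<^bsub>\<A>\<^esub>) *\<^sub>v x = 0\<^sub>v ?n \<longleftrightarrow> h (S \<theta> \<theta>s i) *\<^sub>v x = c \<cdot>\<^sub>v x"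
    if x: "x \<in> carrier_vec ?n" for \<theta> \<theta>s i c x
  proof -
    have "h (S \<theta> \<theta>s i \<ominus>\<^bsub>\<A>\<^esub> c \<odot>\<^bsub>\<A>\<^esub> \<one>\<^bsub>\<A>\<^esub>) = alg_shift (mat_algebra d) (h (S \<theta> \<theta>s i)) c"
      using h_shift[OF S, of \<theta> \<theta>s i c] by (simp add: alg_shift_def)
    then have "h (S \<theta> \<theta>s i \<ominus>\<^bsub>\<A>\<^esub> c \<odot>\<^bsub>\<A>\<^esub> \<one>\<^bsub>\<A>\<^esub>) *\<^sub>v x = h (S \<theta> \<theta>s i) *\<^sub>v x - c \<cdot>\<^sub>v x"
      using alg_shift_mat_mult_vec[OF hc[OF S] x] by simp
    moreover have "a - b = 0\<^sub>v ?n \<longleftrightarrow> a = b" if "a \<in> carrier_vec ?n" "b \<in> carrier_vec ?n" for a b :: "'k vec"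
      using that by (auto simp: vec_eq_iff)
    moreover have "h (S \<theta> \<theta>s i) *\<^sub>v x \<in> carrier_vec ?n" "c \<cdot>\<^sub>v x \<in> carrier_vec ?n"
      using mult_mat_vec_carrier[OF hc[OF S] x] x by auto
    ultimately show ?thesis by simp
  qed
  show ?thesis
  proof (rule iffI)
    assume "first_split_sequence d \<A> A As E Es \<phi>"
    then obtain \<theta> \<theta>s and V :: "('a, 'k vec) module" where ext: "\<phi> \<in> {1..d} \<rightarrow>\<^sub>E UNIV"
      and ord: "idempotent_ordering d \<A> A \<theta> E" "idempotent_ordering d \<A> As \<theta>s Es"
      and irr: "irreducible_left_module \<A> V"
      and u: "\<forall>i\<in>{1..d}. \<exists>u\<in>split_component d V E Es i. u \<noteq> \<zero>\<^bsub>V\<^esub> \<and>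
           S \<theta> \<theta>s i \<odot>\<^bsub>V\<^esub> u = (\<phi> i \<odot>\<^bsub>\<A>\<^esub> \<one>\<^bsub>\<A>\<^esub>) \<odot>\<^bsub>V\<^esub> u"
      unfolding first_split_sequence_def S_def by auto
    have lm: "left_module \<A> V" using irr unfolding irreducible_left_module_def by blast
    interpret V: left_ring_module \<A> V using lm by unfold_locales
    have "\<exists>x\<in>carrier_vec ?n. ?Q \<theta> \<theta>s i x" if i: "i \<in> {1..d}" for i
    proof -
      obtain u where u': "u \<in> split_component d V E Es i" "u \<noteq> \<zero>\<^bsub>V\<^esub>"
        "S \<theta> \<theta>s i \<odot>\<^bsub>V\<^esub> u = (\<phi> i \<odot>\<^bsub>\<A>\<^esub> \<one>\<^bsub>\<A>\<^esub>) \<odot>\<^bsub>V\<^esub> u" using u i by blast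
      then have uc: "u \<in> carrier V" and s: "\<forall>l\<in>{i<..d}. Es l \<odot>\<^bsub>V\<^esub> u = \<zero>\<^bsub>V\<^esub>" "\<forall>l<i. E l \<odot>\<^bsub>V\<^esub> u = \<zero>\<^bsub>V\<^esub>"
        using split[OF ord lm, of i u] i by auto
      have z: "(S \<theta> \<theta>s i \<ominus>\<^bsub>\<A>\<^esub> \<phi> i \<odot>\<^bsub>\<A>\<^esub> \<one>\<^bsub>\<A>\<^esub>) \<odot>\<^bsub>V\<^esub> u = \<zero>\<^bsub>V\<^esub>"
        using u'(3) V.smult_minus_eq_zero[OF S scal uc] by blast
      obtain x where x: "x \<in> carrier_vec ?n" "x \<noteq> 0\<^sub>v ?n"
        "\<And>a. a \<in> carrier \<A> \<Longrightarrow> a \<odot>\<^bsub>V\<^esub> u = \<zero>\<^bsub>V\<^esub> \<longleftrightarrow> h a *\<^sub>v x = 0\<^sub>v ?n"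
        using irreducible_annihilator[OF iso irr uc u'(2)] by blast
      have "h (S \<theta> \<theta>s i \<ominus>\<^bsub>\<A>\<^esub> \<phi> i \<odot>\<^bsub>\<A>\<^esub> \<one>\<^bsub>\<A>\<^esub>) *\<^sub>v x = 0\<^sub>v ?n"
        using z x(3)[OF A.minus_closed[OF S scal]] by blast
      then have "h (S \<theta> \<theta>s i) *\<^sub>v x = \<phi> i \<cdot>\<^sub>v x" using shift_zero[OF x(1)] by blast
      moreover have "\<forall>l\<in>{i<..d}. h (Es l) *\<^sub>v x = 0\<^sub>v ?n" "\<forall>l<i. h (E l) *\<^sub>v x = 0\<^sub>v ?n"
        using s x(3) idempotent_ordering_closed[OF ord(1)] idempotent_ordering_closed[OF ord(2)] i by auto
      ultimately show ?thesis using x(1,2) unfolding S_def by blast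
    qed
    then show "\<phi> \<in> {1..d} \<rightarrow>\<^sub>E UNIV \<and> (\<exists>\<theta> \<theta>s. idempotent_ordering d \<A> A \<theta> E \<and>
      idempotent_ordering d \<A> As \<theta>s Es \<and> (\<forall>i\<in>{1..d}. \<exists>x\<in>carrier_vec ?n. ?Q \<theta> \<theta>s i x))"
      using ext ord by blast
  next
    assume "\<phi> \<in> {1..d} \<rightarrow>\<^sub>E UNIV \<and> (\<exists>\<theta> \<theta>s. idempotent_ordering d \<A> A \<theta> E \<and>
      idempotent_ordering d \<A> As \<theta>s Es \<and> (\<forall>i\<in>{1..d}. \<exists>x\<in>carrier_vec ?n. ?Q \<theta> \<theta>s i x))"
    then obtain \<theta> \<theta>s where ext: "\<phi> \<in> {1..d} \<rightarrow>\<^sub>E UNIV"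
      and ord: "idempotent_ordering d \<A> A \<theta> E" "idempotent_ordering d \<A> As \<theta>s Es"
      and x: "\<forall>i\<in>{1..d}. \<exists>x\<in>carrier_vec ?n. ?Q \<theta> \<theta>s i x" by blast
    let ?V = "column_module d h"
    have irr: "irreducible_left_module \<A> ?V" by (rule irreducible_column_module[OF iso])
    then have lm: "left_module \<A> ?V" unfolding irreducible_left_module_def by blast
    have one: "h (c \<odot>\<^bsub>\<A>\<^esub> \<one>\<^bsub>\<A>\<^esub>) *\<^sub>v x = c \<cdot>\<^sub>v x" if "x \<in> carrier_vec ?n" for c x
      using that by (simp add: h_simps module_mat_simps smult_mat_mult_vec[of _ ?n ?n])
    have "\<exists>u\<in>split_component d ?V E Es i. u \<noteq> \<zero>\<^bsub>?V\<^esub> \<and>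
           (alg_shift \<A> A (\<theta> (i - 1)) \<otimes>\<^bsub>\<A>\<^esub> alg_shift \<A> As (\<theta>s i)) \<odot>\<^bsub>?V\<^esub> u =
           (\<phi> i \<odot>\<^bsub>\<A>\<^esub> \<one>\<^bsub>\<A>\<^esub>) \<odot>\<^bsub>?V\<^esub> u" if i: "i \<in> {1..d}" for i
    proof -
      obtain x where x: "x \<in> carrier_vec ?n" "?Q \<theta> \<theta>s i x" using x i by blast
      then have "x \<in> split_component d ?V E Es i"
        using split[OF ord lm, of i x] i by (simp add: column_module_simps)
      then show ?thesis using x one by (intro bexI[of _ x]) (simp_all add: column_module_simps)
    qed
    then show "first_split_sequence d \<A> A As E Es \<phi>"
      unfolding first_split_sequence_def using ext ord irr by blast
  qed
qed

section \<open>Tridiagonal matrices and split vectors\<close>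

lemma mult_mat_vec_index:
  assumes "M \<in> carrier_mat (d + 1) (d + 1)" "x \<in> carrier_vec (d + 1)" "i \<le> d"
  shows "(M *\<^sub>v x) $ i = (\<Sum>j\<le>d. M $$ (i, j) * x $ j)"
proof -
  have "{0..<d + 1} = {..d}" by auto
  then show ?thesis using assms by (simp add: scalar_prod_def)
qed

declare index_mult_mat_vec [simp del]

text \<open>Row \<open>i\<close> of the eigenvalue equation determines \<open>y (i + 1)\<close> from
  the earlier entries because the superdiagonal entry is nonzero. So an eigenvector with vanishing
  first entry vanishes altogether.\<close>

lemma hessenberg_eigenvector_zero:
  fixes T :: "nat \<Rightarrow> nat \<Rightarrow> 'k::field"
  assumes eig: "\<And>i. i \<le> d \<Longrightarrow> (\<Sum>j\<le>d. T i j * y j) = t * y i"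
    and zero: "\<And>i j. i \<le> d \<Longrightarrow> j \<le> d \<Longrightarrow> i + 1 < j \<Longrightarrow> T i j = 0"
    and nonzero: "\<And>i. i < d \<Longrightarrow> T i (i + 1) \<noteq> 0"
    and start: "y 0 = 0" and j: "j \<le> d"
  shows "y j = 0"
  using j
proof (induction j rule: less_induct)
  case (less j)
  show ?case
  proof (cases j)
    case 0
    then show ?thesis using start by simp
  next
    case (Suc i)
    have "(\<Sum>l\<le>d. T i l * y l) = (\<Sum>l\<in>{i + 1}. T i l * y l)"
    proof (rule sum.mono_neutral_right)
      show "\<forall>l\<in>{..d} - {i + 1}. T i l * y l = 0"
      proof
        fix l assume l: "l \<in> {..d} - {i + 1}"
        show "T i l * y l = 0"
        proof (cases "l \<le> i")
          case True
          then show ?thesis using less Suc l by simp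
        next
          case False
          then show ?thesis using zero[of i l] l less.prems Suc by simp
        qed
      qed
    qed (use less.prems Suc in auto)
    then have "T i (i + 1) * y (i + 1) = t * y i"
      using eig[of i] less.prems Suc by simp
    moreover have "y i = 0" using less Suc by simp
    ultimately show ?thesis using nonzero[of i] less.prems Suc by (simp add: Suc_eq_plus1)
  qed
qed

text \<open>Reflection of \<open>T\<close> in the antidiagonal turns left eigenvectors into right
  ones read backwards and preserves the shape of \<open>T\<close>; the last entry takes the place of
  the first.\<close>

lemma hessenberg_left_eigenvector_zero:
  fixes T :: "nat \<Rightarrow> nat \<Rightarrow> 'k::field"
  assumes eig: "\<And>j. j \<le> d \<Longrightarrow> (\<Sum>i\<le>d. y i * T i j) = t * y j"
    and zero: "\<And>i j. i \<le> d \<Longrightarrow> j \<le> d \<Longrightarrow> i + 1 < j \<Longrightarrow> T i j = 0"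
    and nonzero: "\<And>i. i < d \<Longrightarrow> T i (i + 1) \<noteq> 0"
    and start: "y d = 0" and j: "j \<le> d"
  shows "y j = 0"
proof -
  have "y (d - (d - j)) = 0"
  proof (rule hessenberg_eigenvector_zero[where T = "\<lambda>i j. T (d - j) (d - i)" and t = t and d = d
        and y = "\<lambda>j. y (d - j)"])
    fix i assume i: "i \<le> d"
    have "(\<Sum>j\<le>d. T (d - j) (d - i) * y (d - j)) = (\<Sum>j\<le>d. y j * T j (d - i))"
      using sum.atLeastAtMost_rev[of "\<lambda>j. y j * T j (d - i)" 0 d]
      by (simp add: atLeast0AtMost mult.commute)
    then show "(\<Sum>j\<le>d. T (d - j) (d - i) * y (d - j)) = t * y (d - i)"
      using eig[of "d - i"] by simp
  next
    fix i assume i: "i < d"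
    have "d - (i + 1) + 1 = d - i" using i by simp
    then show "T (d - (i + 1)) (d - i) \<noteq> 0" using nonzero[of "d - (i + 1)"] i by simp
  qed (use zero start in auto)
  then show ?thesis using j by simp
qed

text \<open>The columns of \<open>Q\<close> form an eigenbasis of \<open>B\<close>, and
  \<open>T\<close> is the matrix of the dual element in that basis. The relations are stated for
  \<open>Qi\<close> because the arguments follow the coordinates \<open>Qi *\<^sub>v x\<close> of a
  vector in this basis.\<close>

locale leonard_matrices =
  fixes d :: nat and B :: "'k::field mat" and \<theta> \<theta>s :: "nat \<Rightarrow> 'k" and Q Qi T :: "'k mat"
  assumes B [simp]: "B \<in> carrier_mat (d + 1) (d + 1)" and Q [simp]: "Q \<in> carrier_mat (d + 1) (d + 1)"
    and Qi [simp]: "Qi \<in> carrier_mat (d + 1) (d + 1)" and T [simp]: "T \<in> carrier_mat (d + 1) (d + 1)"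
    and inv: "Q * Qi = 1\<^sub>m (d + 1)" "Qi * Q = 1\<^sub>m (d + 1)"
    and Qi_B: "Qi * B = mat_diag (d + 1) \<theta> * Qi"
    and Qi_D: "Qi * mat_diag (d + 1) \<theta>s = T * Qi"
    and B_zero: "\<And>i j. i \<le> d \<Longrightarrow> j \<le> d \<Longrightarrow> i + 1 < j \<or> j + 1 < i \<Longrightarrow> B $$ (i, j) = 0"
    and B_nonzero: "\<And>i. i < d \<Longrightarrow> B $$ (i, i + 1) \<noteq> 0 \<and> B $$ (i + 1, i) \<noteq> 0"
    and T_zero: "\<And>i j. i \<le> d \<Longrightarrow> j \<le> d \<Longrightarrow> i + 1 < j \<or> j + 1 < i \<Longrightarrow> T $$ (i, j) = 0"
    and T_nonzero: "\<And>i. i < d \<Longrightarrow> T $$ (i, i + 1) \<noteq> 0 \<and> T $$ (i + 1, i) \<noteq> 0"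
    and inj: "inj_on \<theta> {0..d}" "inj_on \<theta>s {0..d}"
begin

lemma dims [simp]:
  "dim_row B = d + 1" "dim_col B = d + 1" "dim_row Q = d + 1" "dim_col Q = d + 1"
  "dim_row Qi = d + 1" "dim_col Qi = d + 1" "dim_row T = d + 1" "dim_col T = d + 1"
  using carrier_matD[OF B] carrier_matD[OF Q] carrier_matD[OF Qi] carrier_matD[OF T] by auto

definition dshift :: "'k \<Rightarrow> 'k vec \<Rightarrow> 'k vec" where
  "dshift c x = vec (d + 1) (\<lambda>k. (\<theta>s k - c) * x $ k)"

text \<open>Membership of \<open>x\<close> in E_i V + ... + E_d V, expressed by its coordinates in
  the eigenbasis of \<open>B\<close>. The value \<open>i = d + 1\<close> is meaningful and stands
  for the zero space.\<close>

definition flag :: "nat \<Rightarrow> 'k vec \<Rightarrow> bool" where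
  "flag i x \<longleftrightarrow> x \<in> carrier_vec (d + 1) \<and> (\<forall>l<i. (Qi *\<^sub>v x) $ l = 0)"

lemma dshift_closed [simp]: "dshift c x \<in> carrier_vec (d + 1)" "dim_vec (dshift c x) = d + 1"
  by (simp_all add: dshift_def)

lemma Qi_mult_dshift:
  assumes "x \<in> carrier_vec (d + 1)"
  shows "Qi *\<^sub>v dshift c x = T *\<^sub>v (Qi *\<^sub>v x) - c \<cdot>\<^sub>v (Qi *\<^sub>v x)"
proof -
  have "dshift c x = mat_diag (d + 1) \<theta>s *\<^sub>v x - c \<cdot>\<^sub>v x"
    using assms by (auto simp: dshift_def mat_diag_mult_vec left_diff_distrib)
  then have "Qi *\<^sub>v dshift c x = Qi *\<^sub>v (mat_diag (d + 1) \<theta>s *\<^sub>v x) - c \<cdot>\<^sub>v (Qi *\<^sub>v x)"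
    using assms by (simp add: mult_minus_distrib_mat_vec[of _ "d + 1" "d + 1"] mult_mat_vec[of _ "d + 1" "d + 1"]
        mult_mat_vec_carrier[of _ "d + 1" "d + 1"])
  also have "Qi *\<^sub>v (mat_diag (d + 1) \<theta>s *\<^sub>v x) = (Qi * mat_diag (d + 1) \<theta>s) *\<^sub>v x"
    by (rule assoc_mult_mat_vec[OF Qi mat_diag_dim assms, symmetric])
  also have "\<dots> = T *\<^sub>v (Qi *\<^sub>v x)"
    unfolding Qi_D by (rule assoc_mult_mat_vec[OF T Qi assms])
  finally show ?thesis .
qed

lemma Qi_mult_closed [simp]: "x \<in> carrier_vec (d + 1) \<Longrightarrow> Qi *\<^sub>v x \<in> carrier_vec (d + 1)"
  using mult_mat_vec_carrier[OF Qi] .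

lemma Q_Qi_mult: "x \<in> carrier_vec (d + 1) \<Longrightarrow> Q *\<^sub>v (Qi *\<^sub>v x) = x"
  using assoc_mult_mat_vec[OF Q Qi, of x] inv by simp

lemma Qi_mult_eq_zero:
  assumes "x \<in> carrier_vec (d + 1)" "\<And>l. l \<le> d \<Longrightarrow> (Qi *\<^sub>v x) $ l = 0"
  shows "x = 0\<^sub>v (d + 1)"
proof -
  have "Qi *\<^sub>v x = 0\<^sub>v (d + 1)" using assms Qi by (intro eq_vecI) auto
  then have "x = Q *\<^sub>v 0\<^sub>v (d + 1)" using Q_Qi_mult[OF assms(1)] by simp
  also have "\<dots> = 0\<^sub>v (d + 1)" by (intro eq_vecI) (auto simp: index_mult_mat_vec)
  finally show ?thesis .
qed

text \<open>In the eigenbasis of \<open>B\<close> the dual element is the tridiagonal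
  \<open>T\<close>, so it enlarges the flag by at most one step.\<close>

lemma flag_dshift:
  assumes x: "flag (i + 1) x" and i: "i \<le> d" shows "flag i (dshift c x)"
  unfolding flag_def
proof (intro conjI allI impI)
  fix l assume l: "l < i"
  have xc: "x \<in> carrier_vec (d + 1)" and z: "\<And>j. j < i + 1 \<Longrightarrow> (Qi *\<^sub>v x) $ j = 0"
    using x by (auto simp: flag_def)
  have "(T *\<^sub>v (Qi *\<^sub>v x)) $ l = (\<Sum>j\<le>d. T $$ (l, j) * (Qi *\<^sub>v x) $ j)"
    using l i xc by (intro mult_mat_vec_index) auto
  also have "\<dots> = 0"
  proof (intro sum.neutral ballI)
    fix j assume j: "j \<in> {..d}"
    show "T $$ (l, j) * (Qi *\<^sub>v x) $ j = 0"
      using z[of j] T_zero[of l j] j l i by (cases "j < i + 1") auto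
  qed
  finally show "(Qi *\<^sub>v dshift c x) $ l = 0"
    using z[of l] l i T Qi_mult_closed[OF xc] unfolding Qi_mult_dshift[OF xc] by auto
qed simp

lemma Qi_mult_B:
  assumes "x \<in> carrier_vec (d + 1)" "l \<le> d"
  shows "(Qi *\<^sub>v (B *\<^sub>v x)) $ l = \<theta> l * (Qi *\<^sub>v x) $ l"
proof -
  have "Qi *\<^sub>v (B *\<^sub>v x) = (Qi * B) *\<^sub>v x"
    by (rule assoc_mult_mat_vec[OF Qi B assms(1), symmetric])
  also have "\<dots> = mat_diag (d + 1) \<theta> *\<^sub>v (Qi *\<^sub>v x)"
    unfolding Qi_B by (rule assoc_mult_mat_vec[OF mat_diag_dim Qi assms(1)])
  also have "\<dots> = vec (d + 1) (\<lambda>l. \<theta> l * (Qi *\<^sub>v x) $ l)"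
    using assms(1) by (intro mat_diag_mult_vec) simp
  finally show ?thesis using assms(2) by simp
qed

lemma B_mult_closed [simp]: "x \<in> carrier_vec (d + 1) \<Longrightarrow> B *\<^sub>v x \<in> carrier_vec (d + 1)"
  using mult_mat_vec_carrier[OF B] .

text \<open>In the eigenbasis the map multiplies coordinate \<open>l\<close> by
  \<open>\<theta> l - \<theta> i\<close>; the flag therefore shrinks by one step, coordinate
  \<open>i\<close> being killed.\<close>

lemma flag_B:
  assumes x: "flag i x" and i: "i < d" shows "flag (i + 1) (B *\<^sub>v x - \<theta> i \<cdot>\<^sub>v x)"
  unfolding flag_def
proof (intro conjI allI impI)
  have xc: "x \<in> carrier_vec (d + 1)" and z: "\<And>j. j < i \<Longrightarrow> (Qi *\<^sub>v x) $ j = 0"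
    using x by (auto simp: flag_def)
  show "B *\<^sub>v x - \<theta> i \<cdot>\<^sub>v x \<in> carrier_vec (d + 1)" using xc by simp
  fix l assume l: "l < i + 1"
  have "Qi *\<^sub>v (B *\<^sub>v x - \<theta> i \<cdot>\<^sub>v x) = Qi *\<^sub>v (B *\<^sub>v x) - \<theta> i \<cdot>\<^sub>v (Qi *\<^sub>v x)"
    using xc by (simp add: mult_minus_distrib_mat_vec[of _ "d + 1" "d + 1"] mult_mat_vec[of _ "d + 1" "d + 1"])
  then have "(Qi *\<^sub>v (B *\<^sub>v x - \<theta> i \<cdot>\<^sub>v x)) $ l = (\<theta> l - \<theta> i) * (Qi *\<^sub>v x) $ l"
    using l i Qi_mult_B[OF xc, of l] Qi_mult_closed[OF xc] by (auto simp: left_diff_distrib)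
  then show "(Qi *\<^sub>v (B *\<^sub>v x - \<theta> i \<cdot>\<^sub>v x)) $ l = 0"
    using z[of l] l by (cases "l = i") auto
qed

text \<open>The spaces E_i V + ... + E_d V and E*_0 V + ... + E*_{i-1} V meet trivially. This
  replaces every dimension argument about the split decomposition.\<close>

lemma flag_eq_zero:
  assumes "flag i x" "i \<le> d + 1" "\<And>k. i \<le> k \<Longrightarrow> k \<le> d \<Longrightarrow> x $ k = 0"
  shows "x = 0\<^sub>v (d + 1)"
  using assms
proof (induction i arbitrary: x)
  case 0
  then show ?case by (intro eq_vecI) (auto simp: flag_def)
next
  case (Suc i)
  have i: "i \<le> d" using Suc.prems by simp
  have xc: "x \<in> carrier_vec (d + 1)" using Suc.prems by (auto simp: flag_def)
  \<comment> \<open>The shift removes the last entry of the support at the cost of one step in the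
    flag, so the induction hypothesis applies. Consequently \<open>x\<close> is an eigenvector of
    the diagonal matrix whose coordinate 0 in the eigenbasis of \<open>B\<close> is zero, and such a
    vector vanishes since \<open>T\<close> is tridiagonal with nonzero superdiagonal.\<close>
  have "dshift (\<theta>s i) x = 0\<^sub>v (d + 1)"
  proof (rule Suc.IH)
    show "flag i (dshift (\<theta>s i) x)" using flag_dshift[of i x] Suc.prems i by (simp add: Suc_eq_plus1)
    fix k assume k: "i \<le> k" "k \<le> d"
    then show "dshift (\<theta>s i) x $ k = 0"
      using Suc.prems(3)[of k] by (cases "k = i") (auto simp: dshift_def)
  qed (use i in simp)
  then have eig: "T *\<^sub>v (Qi *\<^sub>v x) - \<theta>s i \<cdot>\<^sub>v (Qi *\<^sub>v x) = Qi *\<^sub>v 0\<^sub>v (d + 1)"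
    using Qi_mult_dshift[OF xc, of "\<theta>s i"] by simp
  have "(Qi *\<^sub>v x) $ j = 0" if j: "j \<le> d" for j
  proof (rule hessenberg_eigenvector_zero[where T = "\<lambda>i j. T $$ (i, j)" and t = "\<theta>s i" and d = d and j = j])
    fix l assume l: "l \<le> d"
    have "(T *\<^sub>v (Qi *\<^sub>v x) - \<theta>s i \<cdot>\<^sub>v (Qi *\<^sub>v x)) $ l = 0"
      unfolding eig using l
      by (simp add: index_mult_mat_vec scalar_prod_right_zero[of _ "d + 1"] carrier_vecI)
    then have "(T *\<^sub>v (Qi *\<^sub>v x)) $ l = \<theta>s i * (Qi *\<^sub>v x) $ l"
      using l T Qi_mult_closed[OF xc] by auto
    then show "(\<Sum>j\<le>d. T $$ (l, j) * (Qi *\<^sub>v x) $ j) = \<theta>s i * (Qi *\<^sub>v x) $ l"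
      unfolding mult_mat_vec_index[OF T Qi_mult_closed[OF xc] l] .
  next
    show "(Qi *\<^sub>v x) $ 0 = 0" using Suc.prems by (auto simp: flag_def)
  qed (use T_zero T_nonzero j in auto)
  then show ?case using Qi_mult_eq_zero[OF xc] by blast
qed

end

section \<open>Split vectors generated from an eigenvector of the last eigenvalue\<close>

locale leonard_matrices_vector = leonard_matrices +
  fixes q :: "'a vec"
  assumes q [simp]: "q \<in> carrier_vec (d + 1)" and q_nonzero: "q \<noteq> 0\<^sub>v (d + 1)"
    and B_q: "B *\<^sub>v q = \<theta> d \<cdot>\<^sub>v q"
begin

lemma dim_q [simp]: "dim_vec q = d + 1"
  using q by auto

lemma flag_q: "flag d q"
  unfolding flag_def
proof (intro conjI allI impI)
  fix l assume l: "l < d"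
  have "(Qi *\<^sub>v (B *\<^sub>v q)) $ l = \<theta> l * (Qi *\<^sub>v q) $ l" using l by (intro Qi_mult_B) auto
  moreover have "(Qi *\<^sub>v (B *\<^sub>v q)) $ l = \<theta> d * (Qi *\<^sub>v q) $ l"
    unfolding B_q using l Qi_mult_closed[OF q] Qi by (simp add: mult_mat_vec[of _ "d + 1" "d + 1"])
  moreover have "\<theta> l \<noteq> \<theta> d" using inj_onD[OF inj(1), of l d] l by auto
  ultimately show "(Qi *\<^sub>v q) $ l = 0" by auto
qed simp

lemma q_index_nonzero:
  assumes k: "k \<le> d" shows "q $ k \<noteq> 0"
proof
  assume "q $ k = 0"
  have qd: "(Qi *\<^sub>v q) $ d \<noteq> 0"
  proof
    assume "(Qi *\<^sub>v q) $ d = 0"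
    then have "(Qi *\<^sub>v q) $ l = 0" if "l \<le> d" for l
      using that flag_q by (cases "l = d") (auto simp: flag_def)
    then show False using Qi_mult_eq_zero[OF q] q_nonzero by blast
  qed
  \<comment> \<open>Since \<open>q\<close> lies in the last eigenspace, it is a nonzero multiple of
    column \<open>d\<close> of \<open>Q\<close>; a zero entry of \<open>q\<close> is thus a zero
    entry of that column.\<close>
  have "q $ k = (Q *\<^sub>v (Qi *\<^sub>v q)) $ k" by (simp add: Q_Qi_mult)
  also have "\<dots> = (\<Sum>j\<le>d. Q $$ (k, j) * (Qi *\<^sub>v q) $ j)"
    using k by (intro mult_mat_vec_index) auto
  also have "\<dots> = (\<Sum>j\<in>{d}. Q $$ (k, j) * (Qi *\<^sub>v q) $ j)"
    using flag_q by (intro sum.mono_neutral_right) (auto simp: flag_def)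
  finally have kd: "Q $$ (k, d) = 0" using \<open>q $ k = 0\<close> qd by simp
  have DQ: "Q * T = mat_diag (d + 1) \<theta>s * Q"
  proof -
    have "Q * T = Q * (T * (Qi * Q))" by (simp add: inv right_mult_one_mat[OF T])
    also have "\<dots> = Q * ((T * Qi) * Q)"
      using assoc_mult_mat[OF T Qi Q] by simp
    also have "\<dots> = Q * (Qi * mat_diag (d + 1) \<theta>s) * Q"
      unfolding Qi_D[symmetric]
      by (rule assoc_mult_mat[OF Q mult_carrier_mat[OF Qi mat_diag_dim] Q, symmetric])
    also have "Q * (Qi * mat_diag (d + 1) \<theta>s) = (Q * Qi) * mat_diag (d + 1) \<theta>s"
      by (rule assoc_mult_mat[OF Q Qi mat_diag_dim, symmetric])
    finally show ?thesis by (simp add: inv left_mult_one_mat[OF mat_diag_dim])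
  qed
  \<comment> \<open>Row \<open>k\<close> of \<open>Q\<close> is a left eigenvector of
    \<open>T\<close> for \<open>\<theta>s k\<close> with vanishing last entry. It would be zero,
    contradicting invertibility of \<open>Q\<close>.\<close>
  have row: "Q $$ (k, j) = 0" if j: "j \<le> d" for j
  proof (rule hessenberg_left_eigenvector_zero[where T = "\<lambda>i j. T $$ (i, j)" and t = "\<theta>s k"
        and d = d and j = j and y = "\<lambda>j. Q $$ (k, j)"])
    fix j assume j: "j \<le> d"
    have "{0..<d + 1} = {..d}" by auto
    then have "(Q * T) $$ (k, j) = (\<Sum>i\<le>d. Q $$ (k, i) * T $$ (i, j))"
      using j k Q T by (simp add: scalar_prod_def)
    moreover have "(mat_diag (d + 1) \<theta>s * Q) $$ (k, j) = \<theta>s k * Q $$ (k, j)"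
      using j k by (subst mat_diag_mult_left[OF Q]) auto
    ultimately show "(\<Sum>i\<le>d. Q $$ (k, i) * T $$ (i, j)) = \<theta>s k * Q $$ (k, j)"
      using DQ by simp
  qed (use T_zero T_nonzero kd j in auto)
  have "(Q * Qi) $$ (k, k) = (\<Sum>i = 0..<d + 1. Q $$ (k, i) * Qi $$ (i, k))"
    using k Q Qi by (simp add: scalar_prod_def)
  also have "\<dots> = 0" using row by (intro sum.neutral) auto
  finally show False using k by (simp add: inv)
qed

definition qprod :: "nat set \<Rightarrow> 'a vec" where
  "qprod H = vec (d + 1) (\<lambda>k. q $ k * (\<Prod>h\<in>H. \<theta>s k - \<theta>s h))"

lemma qprod_closed [simp]: "qprod H \<in> carrier_vec (d + 1)" "dim_vec (qprod H) = d + 1"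
  by (simp_all add: qprod_def)

lemma qprod_insert: "finite H \<Longrightarrow> h \<notin> H \<Longrightarrow> qprod (insert h H) = dshift (\<theta>s h) (qprod H)"
  by (auto simp: qprod_def dshift_def)

text \<open>\<open>qprod H\<close> is a polynomial of degree \<open>card H\<close> in the diagonal
  matrix, applied to \<open>q\<close>. Starting from \<open>flag d q\<close>, every linear factor
  costs one step.\<close>

lemma flag_qprod:
  assumes "finite H" "card H \<le> d" shows "flag (d - card H) (qprod H)"
  using assms
proof (induction H rule: finite_induct)
  case empty
  have "qprod {} = q" using q by (auto simp: qprod_def)
  then show ?case using flag_q by simp
next
  case (insert h H)
  then have e: "d - card H = d - card (insert h H) + 1" and "card H \<le> d" by auto
  then have "flag (d - card (insert h H) + 1) (qprod H)" using insert.IH by metis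
  then have "flag (d - card (insert h H)) (dshift (\<theta>s h) (qprod H))" by (rule flag_dshift) simp
  then show ?case unfolding qprod_insert[OF insert.hyps] .
qed

definition split_vec :: "nat \<Rightarrow> 'a vec" where
  "split_vec i = qprod {i + 1..d}"

lemma split_vec_closed [simp]: "split_vec i \<in> carrier_vec (d + 1)" "dim_vec (split_vec i) = d + 1"
  by (simp_all add: split_vec_def)

lemma flag_split_vec: "i \<le> d \<Longrightarrow> flag i (split_vec i)"
  using flag_qprod[of "{i + 1..d}"] by (simp add: split_vec_def)

lemma split_vec_index: "k \<le> d \<Longrightarrow> split_vec i $ k = q $ k * (\<Prod>h\<in>{i + 1..d}. \<theta>s k - \<theta>s h)"
  by (simp add: split_vec_def qprod_def)

lemma split_vec_zero: "i < k \<Longrightarrow> k \<le> d \<Longrightarrow> split_vec i $ k = 0"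
  by (auto simp: split_vec_index intro!: prod_zero bexI[of _ k])

lemma dual_diff_nonzero: "i \<le> d \<Longrightarrow> j \<le> d \<Longrightarrow> i \<noteq> j \<Longrightarrow> \<theta>s i - \<theta>s j \<noteq> 0"
  using inj_onD[OF inj(2), of i j] by auto

lemma split_vec_diag_nonzero: "i \<le> d \<Longrightarrow> split_vec i $ i \<noteq> 0"
  using q_index_nonzero[of i] dual_diff_nonzero by (auto simp: split_vec_index)

lemma dshift_split_vec: "1 \<le> i \<Longrightarrow> i \<le> d \<Longrightarrow> dshift (\<theta>s i) (split_vec i) = split_vec (i - 1)"
proof -
  assume i: "1 \<le> i" "i \<le> d"
  then have "{i - 1 + 1..d} = insert i {i + 1..d}" by auto
  then show ?thesis unfolding split_vec_def by (simp add: qprod_insert)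
qed

text \<open>The split component is a line: after subtraction of the multiple that cancels entry
  \<open>i\<close>, the support is too short for the flag and \<open>flag_eq_zero\<close>
  applies.\<close>

lemma split_vec_unique:
  assumes x: "flag i x" and i: "i \<le> d" and supp: "\<And>k. i < k \<Longrightarrow> k \<le> d \<Longrightarrow> x $ k = 0"
  shows "x = (x $ i / split_vec i $ i) \<cdot>\<^sub>v split_vec i"
proof -
  let ?c = "x $ i / split_vec i $ i" and ?y = "x - (x $ i / split_vec i $ i) \<cdot>\<^sub>v split_vec i"
  have xc: "x \<in> carrier_vec (d + 1)" using x by (auto simp: flag_def)
  have "Qi *\<^sub>v ?y = Qi *\<^sub>v x - ?c \<cdot>\<^sub>v (Qi *\<^sub>v split_vec i)"
    using xc by (simp add: mult_minus_distrib_mat_vec[of _ "d + 1" "d + 1"] mult_mat_vec[of _ "d + 1" "d + 1"])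
  then have y1: "flag i ?y"
    using x flag_split_vec[OF i] i Qi_mult_closed[OF xc]
    by (auto simp: flag_def)
  have y2: "?y $ k = 0" if "i \<le> k" "k \<le> d" for k
    using that supp split_vec_zero[of i k] split_vec_diag_nonzero[OF i] xc
    by (cases "k = i") auto
  have y0: "?y = 0\<^sub>v (d + 1)" by (rule flag_eq_zero[OF y1 _ y2]) (use i in simp_all)
  show ?thesis
  proof (rule eq_vecI)
    fix k assume "k < dim_vec (?c \<cdot>\<^sub>v split_vec i)"
    then have k: "k < d + 1" by simp
    then show "x $ k = (?c \<cdot>\<^sub>v split_vec i) $ k"
      using arg_cong[OF y0, of "\<lambda>v. v $ k"] xc by auto
  qed (use xc in auto)
qed

text \<open>The numerator is entry \<open>i\<close> of \<open>B\<close> applied to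
  \<open>split_vec (i - 1)\<close>: the support of that vector ends at \<open>i - 1\<close> and
  \<open>B\<close> is tridiagonal, so a single term survives. The intended range is
  \<open>1 \<le> i\<close>.\<close>

definition split_coeff :: "nat \<Rightarrow> 'a" where
  "split_coeff i = B $$ (i, i - 1) * split_vec (i - 1) $ (i - 1) / split_vec i $ i"

lemma B_mult_split_vec_index:
  assumes i: "i \<le> d" and k: "k \<le> d"
  shows "(B *\<^sub>v split_vec i) $ k = (\<Sum>j\<le>i. B $$ (k, j) * split_vec i $ j)"
proof -
  have "(B *\<^sub>v split_vec i) $ k = (\<Sum>j\<le>d. B $$ (k, j) * split_vec i $ j)"
    using k by (intro mult_mat_vec_index) auto
  also have "\<dots> = (\<Sum>j\<le>i. B $$ (k, j) * split_vec i $ j)"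
    using i split_vec_zero by (intro sum.mono_neutral_right) auto
  finally show ?thesis .
qed

text \<open>Subtracting \<theta>_i moves the vector one step down the flag, and tridiagonality
  extends its support by one place. The result lies in the next split component, hence is a multiple
  of its generator.\<close>

lemma B_split_vec:
  assumes i: "i < d"
  shows "B *\<^sub>v split_vec i - \<theta> i \<cdot>\<^sub>v split_vec i = split_coeff (i + 1) \<cdot>\<^sub>v split_vec (i + 1)"
proof -
  let ?x = "B *\<^sub>v split_vec i - \<theta> i \<cdot>\<^sub>v split_vec i"
  have idx: "?x $ k = (B *\<^sub>v split_vec i) $ k - \<theta> i * split_vec i $ k" if "k \<le> d" for k
    using that B by auto
  have x1: "flag (i + 1) ?x" using i flag_B[OF flag_split_vec] by simp
  have x2: "?x $ k = 0" if k: "i + 1 < k" "k \<le> d" for k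
  proof -
    have "(\<Sum>j\<le>i. B $$ (k, j) * split_vec i $ j) = 0"
      using k i by (intro sum.neutral) (auto intro!: B_zero)
    then show ?thesis using idx[OF k(2)] B_mult_split_vec_index[of i k] k i split_vec_zero[of i k] by simp
  qed
  have "?x = (?x $ (i + 1) / split_vec (i + 1) $ (i + 1)) \<cdot>\<^sub>v split_vec (i + 1)"
    by (rule split_vec_unique[OF x1 _ x2]) (use i in simp_all)
  moreover have "?x $ (i + 1) = B $$ (i + 1, i) * split_vec i $ i"
  proof -
    have "(\<Sum>j\<le>i. B $$ (i + 1, j) * split_vec i $ j) = (\<Sum>j\<in>{i}. B $$ (i + 1, j) * split_vec i $ j)"
      using i by (intro sum.mono_neutral_right) (auto intro!: B_zero)
    then show ?thesis
      using idx[of "i + 1"] B_mult_split_vec_index[of i "i + 1"] split_vec_zero[of i "i + 1"] i by simp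
  qed
  ultimately show ?thesis by (simp add: split_coeff_def)
qed

text \<open>Entry \<open>i\<close> of \<open>B *\<^sub>v split_vec i\<close> is computed twice, once
  by expanding row \<open>i\<close> and once by \<open>B_split_vec\<close>. The first way produces
  the term with \<open>split_coeff i\<close>, the second the term with
  \<open>split_coeff (i + 1)\<close>.\<close>

lemma B_diag:
  assumes i: "i \<le> d"
  shows "B $$ (i, i) = \<theta> i + (if i = 0 then 0 else split_coeff i / (\<theta>s i - \<theta>s (i - 1)))
    + (if i = d then 0 else split_coeff (i + 1) / (\<theta>s i - \<theta>s (i + 1)))"
proof -
  let ?v = "split_vec i"
  have vi: "?v $ i \<noteq> 0" using split_vec_diag_nonzero[OF i] .
  have "(B *\<^sub>v ?v) $ i = (\<Sum>j\<le>i. B $$ (i, j) * ?v $ j)"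
    using i by (intro B_mult_split_vec_index) auto
  also have "\<dots> = B $$ (i, i) * ?v $ i - (if i = 0 then 0 else split_coeff i / (\<theta>s i - \<theta>s (i - 1))) * ?v $ i"
  proof (cases "i = 0")
    case False
    have "(\<Sum>j\<le>i. B $$ (i, j) * ?v $ j) = (\<Sum>j\<in>{i, i - 1}. B $$ (i, j) * ?v $ j)"
      using i by (intro sum.mono_neutral_right) (auto intro!: B_zero)
    also have "\<dots> = B $$ (i, i) * ?v $ i + B $$ (i, i - 1) * ?v $ (i - 1)" using False by simp
    also have "B $$ (i, i - 1) * ?v $ (i - 1) = - split_coeff i / (\<theta>s i - \<theta>s (i - 1)) * ?v $ i"
    proof -
      \<comment> \<open>The generators of adjacent components differ by one linear factor, which
        here becomes the denominator of the diagonal formula.\<close>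
      have s: "split_vec (i - 1) $ (i - 1) = (\<theta>s (i - 1) - \<theta>s i) * ?v $ (i - 1)"
        using arg_cong[OF dshift_split_vec[of i], of "\<lambda>v. v $ (i - 1)"] i False by (simp add: dshift_def)
      have ne: "\<theta>s (i - 1) - \<theta>s i \<noteq> 0" using i False by (intro dual_diff_nonzero) auto
      have "\<theta>s i - \<theta>s (i - 1) = - (\<theta>s (i - 1) - \<theta>s i)" by simp
      then have "- split_coeff i / (\<theta>s i - \<theta>s (i - 1)) = split_coeff i / (\<theta>s (i - 1) - \<theta>s i)"
        by (simp only: minus_divide_divide)
      also have "\<dots> = B $$ (i, i - 1) * ?v $ (i - 1) / ?v $ i"
        unfolding split_coeff_def s using ne by simp
      finally show ?thesis using vi by simp
    qed
    finally show ?thesis using False by (simp add: algebra_simps)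
  qed simp
  finally have 1: "(B *\<^sub>v ?v) $ i = B $$ (i, i) * ?v $ i -
    (if i = 0 then 0 else split_coeff i / (\<theta>s i - \<theta>s (i - 1))) * ?v $ i" .
  have 2: "(B *\<^sub>v ?v) $ i = \<theta> i * ?v $ i +
    (if i = d then 0 else split_coeff (i + 1) / (\<theta>s i - \<theta>s (i + 1))) * ?v $ i"
  proof (cases "i = d")
    case True
    \<comment> \<open>At the upper end the empty product leaves \<open>q\<close> itself, and its
      eigenvalue equation takes the place of \<open>B_split_vec\<close>.\<close>
    have "qprod {} = q" using q by (auto simp: qprod_def)
    then have "?v = q" using True by (simp add: split_vec_def)
    then show ?thesis using True B_q q by auto
  next
    case False
    then have i': "i < d" using i by simp
    have "(B *\<^sub>v ?v - \<theta> i \<cdot>\<^sub>v ?v) $ i = (split_coeff (i + 1) \<cdot>\<^sub>v split_vec (i + 1)) $ i"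
      using B_split_vec[OF i'] by simp
    then have "(B *\<^sub>v ?v) $ i = \<theta> i * ?v $ i + split_coeff (i + 1) * split_vec (i + 1) $ i"
      using i B by (auto simp: algebra_simps)
    moreover have "?v $ i = (\<theta>s i - \<theta>s (i + 1)) * split_vec (i + 1) $ i"
      using arg_cong[OF dshift_split_vec[of "i + 1"], of "\<lambda>v. v $ i"] i' by (simp add: dshift_def)
    moreover have "\<theta>s i - \<theta>s (i + 1) \<noteq> 0" using i' by (intro dual_diff_nonzero) auto
    ultimately show ?thesis using False by simp
  qed
  let ?a = "if i = 0 then 0 else split_coeff i / (\<theta>s i - \<theta>s (i - 1))"
    and ?b = "if i = d then 0 else split_coeff (i + 1) / (\<theta>s i - \<theta>s (i + 1))"
  have "B $$ (i, i) * ?v $ i = (\<theta> i + ?a + ?b) * ?v $ i"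
    using 1 2 by (simp only: distrib_right) (simp add: algebra_simps)
  then show ?thesis using vi by simp
qed

end

section \<open>Matrix entries from the split sequences\<close>

text \<open>Row 0 of \<open>Qi\<close> is a left eigenvector for \<theta>_0, and \<theta>_0 is also
  the row sum. This is the situation of a stationary measure of a birth-death chain, for which the
  net flow across each edge is zero.\<close>

lemma (in leonard_matrices) left_eigenvector_balance:
  assumes row: "\<And>i. i \<le> d \<Longrightarrow> (\<Sum>j\<le>d. B $$ (i, j)) = \<theta> 0" and j: "j < d"
  shows "Qi $$ (0, j) * B $$ (j, j + 1) = Qi $$ (0, j + 1) * B $$ (j + 1, j)"
proof -
  define w where "w k = Qi $$ (0, k)" for k
  have "{0..<d + 1} = {..d}" by auto
  then have "(Qi * B) $$ (0, j) = (\<Sum>k\<le>d. w k * B $$ (k, j))" if "j \<le> d" for j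
    using that by (simp add: w_def scalar_prod_def)
  moreover have "(mat_diag (d + 1) \<theta> * Qi) $$ (0, j) = \<theta> 0 * w j" if "j \<le> d" for j
    using that by (subst mat_diag_mult_left[OF Qi]) (auto simp: w_def)
  ultimately have eig: "(\<Sum>k\<le>d. w k * B $$ (k, j)) = \<theta> 0 * w j" if "j \<le> d" for j
    using that Qi_B by simp
  have step: "w j * B $$ (j, j + 1) = w (j + 1) * B $$ (j + 1, j)"
    if j: "j < d" and IH: "j > 0 \<Longrightarrow> w (j - 1) * B $$ (j - 1, j) = w j * B $$ (j, j - 1)" for j
  proof -
    \<comment> \<open>The total net flow into \<open>j\<close> is zero. The diagonal term cancels
      and the flow from \<open>j - 1\<close> is zero by the previous step, so the flow from
      \<open>j + 1\<close> is zero too.\<close>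
    have "(\<Sum>k\<le>d. w k * B $$ (k, j) - w j * B $$ (j, k)) = 0"
      using eig[of j] row[of j] j by (simp add: sum_subtractf flip: sum_distrib_left)
    also have "(\<Sum>k\<le>d. w k * B $$ (k, j) - w j * B $$ (j, k)) =
        (\<Sum>k\<in>{j + 1}. w k * B $$ (k, j) - w j * B $$ (j, k))"
    proof (intro sum.mono_neutral_right ballI)
      fix k assume k: "k \<in> {..d} - {j + 1}"
      consider "k = j" | "k + 1 = j" | "j + 1 < k" | "k + 1 < j" using k by force
      then show "w k * B $$ (k, j) - w j * B $$ (j, k) = 0"
        using IH B_zero[of k j] B_zero[of j k] k j by cases auto
    qed (use j in auto)
    finally show ?thesis by simp
  qed
  show ?thesis
    using j
  proof (induction j)
    case 0
    then show ?case using step[of 0] by (simp add: w_def)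
  next
    case (Suc j)
    then show ?case using step[of "j + 1"] by (simp add: w_def Suc_eq_plus1)
  qed
qed

text \<open>The balance relation has nonzero coefficients, so one zero entry would spread over the
  entire row of the invertible matrix \<open>Qi\<close>.\<close>

lemma (in leonard_matrices) left_eigenvector_nonzero:
  assumes row: "\<And>i. i \<le> d \<Longrightarrow> (\<Sum>j\<le>d. B $$ (i, j)) = \<theta> 0" and k: "k \<le> d"
  shows "Qi $$ (0, k) \<noteq> 0"
proof -
  have iff: "Qi $$ (0, k) = 0 \<longleftrightarrow> Qi $$ (0, 0) = 0" if "k \<le> d" for k
    using that
  proof (induction k)
    case (Suc k)
    then have "Qi $$ (0, k + 1) = 0 \<longleftrightarrow> Qi $$ (0, k) = 0"
      using left_eigenvector_balance[OF row, of k] B_nonzero[of k] by auto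
    then show ?case using Suc by (simp add: Suc_eq_plus1)
  qed simp
  show ?thesis
  proof
    assume "Qi $$ (0, k) = 0"
    then have "Qi $$ (0, j) = 0" if "j \<le> d" for j using iff[OF k] iff[OF that] by simp
    then have "(\<Sum>j = 0..<d + 1. Qi $$ (0, j) * Q $$ (j, 0)) = 0" by (intro sum.neutral) auto
    moreover have "(Qi * Q) $$ (0, 0) = (\<Sum>j = 0..<d + 1. Qi $$ (0, j) * Q $$ (j, 0))"
      by (simp add: scalar_prod_def)
    ultimately show False by (simp add: inv)
  qed
qed

lemma (in leonard_matrices_vector) B_superdiag:
  assumes row: "\<And>i. i \<le> d \<Longrightarrow> (\<Sum>j\<le>d. B $$ (i, j)) = \<theta> 0" and i: "1 \<le> i" "i \<le> d"
  shows "B $$ (i - 1, i) = split_coeff i * (\<Prod>h<i - 1. \<theta>s (i - 1) - \<theta>s h) / (\<Prod>h<i. \<theta>s i - \<theta>s h)"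
proof -
  define w' w where "w' = Qi $$ (0, i - 1)" and "w = Qi $$ (0, i)"
  define a a' where "a = (\<Prod>h<i - 1. \<theta>s (i - 1) - \<theta>s h)" and "a' = (\<Prod>h\<in>{i + 1..d}. \<theta>s (i - 1) - \<theta>s h)"
  define b b' where "b = (\<Prod>h<i - 1. \<theta>s i - \<theta>s h)" and "b' = (\<Prod>h\<in>{i + 1..d}. \<theta>s i - \<theta>s h)"
  define \<delta> where "\<delta> = \<theta>s i - \<theta>s (i - 1)"
  let ?q' = "q $ (i - 1)" and ?q = "q $ i"
  have nz: "w' \<noteq> 0" "w \<noteq> 0" "?q' \<noteq> 0" "?q \<noteq> 0"
    using left_eigenvector_nonzero[OF row] q_index_nonzero i by (auto simp: w_def w'_def)
  have ne: "\<theta>s i \<noteq> \<theta>s h" if "h \<le> d" "h \<noteq> i" for h using dual_diff_nonzero[OF i(2) that(1)] that by auto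
  then have nz': "b \<noteq> 0" "b' \<noteq> 0" "\<delta> \<noteq> 0"
    using i by (auto simp: b_def b'_def \<delta>_def)
  have bal: "w' * B $$ (i - 1, i) = w * B $$ (i, i - 1)"
    using left_eigenvector_balance[OF row, of "i - 1"] i by (simp add: w_def w'_def)
  define H where "H = {..<i - 1} \<union> {i + 1..d}"
  \<comment> \<open>With \<open>d - 1\<close> factors the flag only comes down to 1, so coordinate 0
    of \<open>qprod H\<close>, its pairing with the left eigenvector, is still zero; and
    \<open>qprod H\<close> is supported on the two omitted indices.\<close>
  have "card H = d - 1" using i unfolding H_def by (subst card_Un_disjoint) auto
  then have "flag 1 (qprod H)" using flag_qprod[of H] i by (simp add: H_def)
  then have "0 = (Qi *\<^sub>v qprod H) $ 0" by (simp add: flag_def)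
  also have "\<dots> = (\<Sum>k\<le>d. Qi $$ (0, k) * qprod H $ k)"
    by (intro mult_mat_vec_index) auto
  also have "\<dots> = (\<Sum>k\<in>{i - 1, i}. Qi $$ (0, k) * qprod H $ k)"
  proof (intro sum.mono_neutral_right ballI)
    fix k assume "k \<in> {..d} - {i - 1, i}"
    then have "k \<in> H" "k \<le> d" by (auto simp: H_def)
    then show "Qi $$ (0, k) * qprod H $ k = 0"
      by (auto simp: qprod_def H_def intro!: prod_zero)
  qed (use i in auto)
  also have "\<dots> = w' * qprod H $ (i - 1) + w * qprod H $ i" using i by (simp add: w_def w'_def)
  finally have "w' * qprod H $ (i - 1) + w * qprod H $ i = 0" by simp
  moreover have "(\<Prod>h\<in>H. t - \<theta>s h) = (\<Prod>h<i - 1. t - \<theta>s h) * (\<Prod>h\<in>{i + 1..d}. t - \<theta>s h)" for t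
    unfolding H_def by (rule prod.union_disjoint) auto
  then have "qprod H $ (i - 1) = ?q' * (a * a')" "qprod H $ i = ?q * (b * b')"
    using i unfolding qprod_def a_def a'_def b_def b'_def by simp_all
  ultimately have orth: "w' * ?q' * a * a' = - (w * ?q * b * b')"
    by (simp add: add_eq_0_iff2 ac_simps)
  \<comment> \<open>Compared with \<open>split_vec i\<close>, the generator
    \<open>split_vec (i - 1)\<close> has the extra factor for \<open>h = i\<close>, which evaluates
    to \<open>- \<delta>\<close> at entry \<open>i - 1\<close>.\<close>
  have c: "split_coeff i = B $$ (i, i - 1) * (?q' * (- \<delta> * a')) / (?q * b')"
  proof -
    have "{i - 1 + 1..d} = insert i {i + 1..d}" using i by auto
    then show ?thesis using i
      unfolding split_coeff_def a'_def b'_def \<delta>_def by (simp add: split_vec_index)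
  qed
  have prod: "(\<Prod>h<i. \<theta>s i - \<theta>s h) = \<delta> * b"
  proof -
    have "{..<i} = insert (i - 1) {..<i - 1}" using i by auto
    then show ?thesis by (simp add: b_def \<delta>_def)
  qed
  \<comment> \<open>The sign from this extra factor cancels the sign in \<open>orth\<close>.
    Multiplying by \<open>w'\<close> prepares for the balance relation; \<open>w'\<close> is
    cancelled at the end.\<close>
  have "w' * (split_coeff i * a / (\<delta> * b)) = - (B $$ (i, i - 1) * (w' * ?q' * a * a') / (?q * b' * b))"
    unfolding c using nz nz' by (simp add: field_simps)
  also have "\<dots> = w * B $$ (i, i - 1)"
    unfolding orth using nz nz' by (simp add: field_simps)
  also have "\<dots> = w' * B $$ (i - 1, i)" by (rule bal[symmetric])
  finally have "split_coeff i * a / (\<delta> * b) = B $$ (i - 1, i)"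
    using nz(1) mult_left_cancel by blast
  then show ?thesis unfolding prod a_def by simp
qed

text \<open>The product retains just the entry at \<open>(i, j)\<close>. This translates the
  conditions on an idempotent sequence into zero and nonzero matrix entries.\<close>

lemma diag_unit_sandwich:
  assumes M: "M \<in> carrier_mat (d + 1) (d + 1)" and ij: "i \<le> d" "j \<le> d"
  shows "diag_unit d i * M * diag_unit d j = 0\<^sub>m (d + 1) (d + 1) \<longleftrightarrow> M $$ (i, j) = 0"
proof -
  have eq: "diag_unit d i * M * diag_unit d j =
      mat (d + 1) (d + 1) (\<lambda>(p, q). (if p = i then 1 else 0) * M $$ (p, q) * (if q = j then 1 else 0))"
    unfolding mat_diag_mult_left[OF M]
    by (subst mat_diag_mult_right[of _ "d + 1"]) (auto intro!: eq_matI)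
  show ?thesis
  proof
    assume "diag_unit d i * M * diag_unit d j = 0\<^sub>m (d + 1) (d + 1)"
    from arg_cong[OF this, of "\<lambda>X. X $$ (i, j)"] show "M $$ (i, j) = 0"
      unfolding eq using ij by simp
  qed (auto simp: eq intro!: eq_matI)
qed

text \<open>The dual idempotent sequence governs the shape of \<open>B\<close>, and the idempotent
  sequence governs the shape of \<open>T\<close>. The two kernel equivalences are what
  \<open>first_split_sequence_iff\<close> requires of the idempotents.\<close>

lemma leonard_system_matrices:
  fixes B :: "'k::field mat"
  assumes L: "leonard_system d (mat_algebra d) B (mat_diag (d + 1) \<theta>s) E Es"
    and ord: "idempotent_ordering d (mat_algebra d) B \<theta> E"
    and ords: "idempotent_ordering d (mat_algebra d) (mat_diag (d + 1) \<theta>s) \<theta>s Es"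
  obtains Q Qi T where "leonard_matrices d B \<theta> \<theta>s Q Qi T"
    "\<forall>l\<le>d. \<forall>x\<in>carrier_vec (d + 1). E l *\<^sub>v x = 0\<^sub>v (d + 1) \<longleftrightarrow> (Qi *\<^sub>v x) $ l = 0"
    "\<forall>l\<le>d. \<forall>x\<in>carrier_vec (d + 1). Es l *\<^sub>v x = 0\<^sub>v (d + 1) \<longleftrightarrow> x $ l = 0"
proof -
  let ?n = "d + 1" and ?D = "mat_diag (d + 1) \<theta>s"
  have B: "B \<in> carrier_mat ?n ?n"
    using L unfolding leonard_system_def multiplicity_free_def by (simp add: module_mat_simps)
  have inj: "inj_on \<theta> {0..d}" "inj_on \<theta>s {0..d}"
    using idempotent_ordering_inj[OF ord] idempotent_ordering_inj[OF ords] .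
  obtain Q Qi where Q: "Q \<in> carrier_mat ?n ?n" and Qi: "Qi \<in> carrier_mat ?n ?n"
    and inv: "Q * Qi = 1\<^sub>m ?n" "Qi * Q = 1\<^sub>m ?n"
    and BQ: "B * Q = Q * mat_diag ?n \<theta>" and EQ: "\<And>i. i \<le> d \<Longrightarrow> E i * Q = Q * diag_unit d i"
    using diagonalization[OF B ord] by blast
  have conj: "X = Q * Y * Qi" "Qi * X = Y * Qi"
    if X: "X \<in> carrier_mat ?n ?n" and Y: "Y \<in> carrier_mat ?n ?n" and eq: "X * Q = Q * Y" for X Y
  proof -
    have "X = X * (Q * Qi)" using X by (simp add: inv)
    also have "\<dots> = Q * Y * Qi" using assoc_mult_mat[OF X Q Qi] eq by simp
    finally show 1: "X = Q * Y * Qi" .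
    have "Qi * X = Qi * (Q * (Y * Qi))" unfolding 1 using assoc_mult_mat[OF Q Y Qi] by simp
    also have "\<dots> = Qi * Q * (Y * Qi)" using assoc_mult_mat[OF Qi Q mult_carrier_mat[OF Y Qi]] by simp
    finally show "Qi * X = Y * Qi" using Y Qi by (simp add: inv)
  qed
  have Ec: "E l \<in> carrier_mat ?n ?n" if "l \<le> d" for l
    using idempotent_ordering_closed[OF ord that] by (simp add: module_mat_simps)
  note Esl = idempotent_ordering_mat_diag[OF ords]
  define T where "T = Qi * ?D * Q"
  have T: "T \<in> carrier_mat ?n ?n" unfolding T_def by (rule mult_carrier_mat[OF mult_carrier_mat[OF Qi mat_diag_dim] Q])
  have QiD: "Qi * ?D = T * Qi"
  proof -
    have "T * Qi = Qi * ?D * (Q * Qi)"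
      unfolding T_def by (rule assoc_mult_mat[OF mult_carrier_mat[OF Qi mat_diag_dim] Q Qi])
    then show ?thesis by (simp add: inv right_mult_one_mat[OF mult_carrier_mat[OF Qi mat_diag_dim]])
  qed
  have EDE: "E i * ?D * E j = Q * (diag_unit d i * T * diag_unit d j) * Qi" if ij: "i \<le> d" "j \<le> d" for i j
  proof -
    have "E i * ?D * E j = (Q * diag_unit d i * Qi) * ?D * (Q * diag_unit d j * Qi)"
      using conj(1)[OF Ec[OF ij(1)] mat_diag_dim EQ[OF ij(1)]] conj(1)[OF Ec[OF ij(2)] mat_diag_dim EQ[OF ij(2)]]
      by metis
    also have "\<dots> = Q * (diag_unit d i * T * diag_unit d j) * Qi"
      unfolding T_def using Q Qi
      by (simp add: assoc_mult_mat[of _ ?n ?n _ ?n _ ?n] mult_carrier_mat[of _ ?n ?n])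
    finally show ?thesis .
  qed
  have EDE0: "E i * ?D * E j = 0\<^sub>m ?n ?n \<longleftrightarrow> T $$ (i, j) = 0" if ij: "i \<le> d" "j \<le> d" for i j
  proof -
    let ?X = "diag_unit d i * T * diag_unit d j"
    have X: "?X \<in> carrier_mat ?n ?n" using T by (meson mat_diag_dim mult_carrier_mat)
    have "Qi * (Q * ?X * Qi) * Q = ?X"
    proof -
      have "Qi * (Q * ?X * Qi) * Q = (Qi * Q) * ?X * (Qi * Q)"
        using Q Qi X by (simp add: assoc_mult_mat[of _ ?n ?n _ ?n _ ?n] mult_carrier_mat[of _ ?n ?n])
      then show ?thesis by (simp add: inv left_mult_one_mat[OF X] right_mult_one_mat[OF X])
    qed
    moreover have "Qi * 0\<^sub>m ?n ?n * Q = 0\<^sub>m ?n ?n" "Q * 0\<^sub>m ?n ?n * Qi = 0\<^sub>m ?n ?n" using Q Qi by auto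
    ultimately have "Q * ?X * Qi = 0\<^sub>m ?n ?n \<longleftrightarrow> ?X = 0\<^sub>m ?n ?n" by metis
    then show ?thesis using diag_unit_sandwich[OF T ij] EDE[OF ij] by simp
  qed
  have EsBEs0: "Es i * B * Es j = 0\<^sub>m ?n ?n \<longleftrightarrow> B $$ (i, j) = 0" if "i \<le> d" "j \<le> d" for i j
    using diag_unit_sandwich[OF B that] that by (simp add: Esl)
  have seq: "idempotent_sequence d (mat_algebra d) B ?D E" "idempotent_sequence d (mat_algebra d) ?D B Es"
    using L unfolding leonard_system_def by auto
  have far: "T $$ (i, j) = 0" "B $$ (i, j) = 0" if "i \<le> d" "j \<le> d" "i + 1 < j \<or> j + 1 < i" for i j
  proof -
    have "\<bar>int i - int j\<bar> > 1" using that by auto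
    then show "T $$ (i, j) = 0" "B $$ (i, j) = 0"
      using seq that EDE0 EsBEs0 unfolding idempotent_sequence_def by (auto simp: module_mat_simps)
  qed
  have near: "T $$ (i, j) \<noteq> 0" "B $$ (i, j) \<noteq> 0" if "i \<le> d" "j \<le> d" "j = i + 1 \<or> i = j + 1" for i j
  proof -
    have "\<bar>int i - int j\<bar> = 1" using that by auto
    then show "T $$ (i, j) \<noteq> 0" "B $$ (i, j) \<noteq> 0"
      using seq that EDE0 EsBEs0 unfolding idempotent_sequence_def by (auto simp: module_mat_simps)
  qed
  have mats: "leonard_matrices d B \<theta> \<theta>s Q Qi T"
  proof
    show "Qi * B = mat_diag (d + 1) \<theta> * Qi" using conj(2)[OF B mat_diag_dim BQ] .
  qed (use B Q Qi T inv QiD far near inj in auto)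
  have Ex: "E l *\<^sub>v x = 0\<^sub>v ?n \<longleftrightarrow> (Qi *\<^sub>v x) $ l = 0" if l: "l \<le> d" and x: "x \<in> carrier_vec ?n" for l x
  proof -
    have c: "(Qi *\<^sub>v x) $ l = 0 \<longleftrightarrow> diag_unit d l *\<^sub>v (Qi *\<^sub>v x) = 0\<^sub>v ?n"
      using l mult_mat_vec_carrier[OF Qi x] by (auto simp: diag_unit_mult_vec vec_eq_iff)
    have "E l *\<^sub>v x = (Q * diag_unit d l * Qi) *\<^sub>v x"
      using conj(1)[OF Ec[OF l] mat_diag_dim EQ[OF l]] by simp
    also have "\<dots> = Q *\<^sub>v (diag_unit d l *\<^sub>v (Qi *\<^sub>v x))"
      using Q Qi x by (simp add: assoc_mult_mat_vec[of _ ?n ?n _ ?n] mult_carrier_mat[of _ ?n ?n] mult_mat_vec_carrier[of _ ?n ?n])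
    finally have E: "E l *\<^sub>v x = Q *\<^sub>v (diag_unit d l *\<^sub>v (Qi *\<^sub>v x))" .
    have Q0: "Q *\<^sub>v y = 0\<^sub>v ?n \<longleftrightarrow> y = 0\<^sub>v ?n" if y: "y \<in> carrier_vec ?n" for y
    proof
      assume "Q *\<^sub>v y = 0\<^sub>v ?n"
      then have "Qi *\<^sub>v (Q *\<^sub>v y) = 0\<^sub>v ?n" using Qi by (auto intro!: eq_vecI simp: index_mult_mat_vec)
      then show "y = 0\<^sub>v ?n" using assoc_mult_mat_vec[OF Qi Q y] y by (simp add: inv)
    next
      assume "y = 0\<^sub>v ?n"
      then show "Q *\<^sub>v y = 0\<^sub>v ?n" using Q by (auto intro!: eq_vecI simp: index_mult_mat_vec)
    qed
    show ?thesis
      unfolding E c using mult_mat_vec_carrier[OF mat_diag_dim mult_mat_vec_carrier[OF Qi x]] by (rule Q0)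
  qed
  have Esx: "Es l *\<^sub>v x = 0\<^sub>v ?n \<longleftrightarrow> x $ l = 0" if l: "l \<le> d" and x: "x \<in> carrier_vec ?n" for l x
    using l x by (auto simp: Esl diag_unit_mult_vec vec_eq_iff)
  show thesis using that[OF mats] Ex Esx by blast
qed

text \<open>Distinct positions carry distinct idempotents, and each idempotent determines its
  eigenvalue. Thus the eigenvalue sequences quantified existentially in the definitions are the
  expected ones.\<close>

lemma idempotent_ordering_unique:
  fixes \<A> :: "('k::field, 'a, 'm) module_scheme"
  assumes m: "matrix_algebra d \<A>" and a: "a \<in> carrier \<A>"
    and ord: "idempotent_ordering d \<A> a \<theta> E" and ord': "idempotent_ordering d \<A> a \<theta>' E"
  shows "\<theta>' = \<theta>"
proof -
  have bij: "bij_betw \<theta>' {0..d} {t. alg_eigenvalue d \<A> a t}"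
    and img: "\<theta>' ` {0..d} = \<theta> ` {0..d}"
    and ext: "\<theta> \<in> {0..d} \<rightarrow>\<^sub>E UNIV" "\<theta>' \<in> {0..d} \<rightarrow>\<^sub>E UNIV"
    using ord ord' unfolding idempotent_ordering_def bij_betw_def by auto
  obtain h where iso: "algebra_isomorphism \<A> (mat_algebra d) h"
    and hE: "\<And>i. i \<le> d \<Longrightarrow> h (E i) = diag_unit d i"
    using diagonalizing_iso[OF m a ord] by blast
  show ?thesis
  proof (rule PiE_ext[OF ext(2,1)])
    fix i assume i: "i \<in> {0..d}"
    then obtain j where j: "j \<in> {0..d}" "\<theta>' i = \<theta> j" using img by blast
    have "E i = primitive_idempotent d \<A> a \<theta>' i"
      using ord' i unfolding idempotent_ordering_def by blast
    also have "\<dots> = E j"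
      using i j by (intro primitive_idempotent_reorder[OF m a ord bij]) auto
    finally have "diag_unit d i = (diag_unit d j :: 'k mat)" using hE i j by (metis atLeastAtMost_iff)
    from arg_cong[OF this, of "\<lambda>X. X $$ (i, i)"] have "i = j"
      using i by (auto simp: mat_diag_def split: if_splits)
    then show "\<theta>' i = \<theta> i" using j by simp
  qed
qed

text \<open>The kernel conditions place \<open>x\<close> on the line through
  \<open>split_vec i\<close>, where the prescribed product acts by the scalar
  \<open>split_coeff i\<close>.\<close>

lemma (in leonard_matrices_vector) first_split_sequence_eq:
  assumes ord: "idempotent_ordering d (mat_algebra d) B \<theta> E"
    and ords: "idempotent_ordering d (mat_algebra d) (mat_diag (d + 1) \<theta>s) \<theta>s Es"
    and E: "\<forall>l\<le>d. \<forall>x\<in>carrier_vec (d + 1). E l *\<^sub>v x = 0\<^sub>v (d + 1) \<longleftrightarrow> (Qi *\<^sub>v x) $ l = 0"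
    and Es: "\<forall>l\<le>d. \<forall>x\<in>carrier_vec (d + 1). Es l *\<^sub>v x = 0\<^sub>v (d + 1) \<longleftrightarrow> x $ l = 0"
  shows "first_split_sequence d (mat_algebra d) B (mat_diag (d + 1) \<theta>s) E Es \<phi> \<longleftrightarrow>
    \<phi> \<in> {1..d} \<rightarrow>\<^sub>E UNIV \<and> (\<forall>i\<in>{1..d}. \<phi> i = split_coeff i)"
proof -
  let ?n = "d + 1" and ?M = "mat_algebra d :: ('a, 'a mat) module" and ?D = "mat_diag (d + 1) \<theta>s"
  have iso: "algebra_isomorphism ?M ?M id"
    by unfold_locales (rule assoc_mat_algebra id_algebra_iso)+
  have c: "B \<in> carrier ?M" "?D \<in> carrier ?M" by (simp_all add: module_mat_simps)
  have act: "(alg_shift ?M B s \<otimes>\<^bsub>?M\<^esub> alg_shift ?M ?D t) *\<^sub>v x = B *\<^sub>v dshift t x - s \<cdot>\<^sub>v dshift t x"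
    if x: "x \<in> carrier_vec ?n" for s t x
  proof -
    have "?D *\<^sub>v x - t \<cdot>\<^sub>v x = dshift t x"
      using x by (auto simp: dshift_def mat_diag_mult_vec left_diff_distrib)
    then have 1: "alg_shift ?M ?D t *\<^sub>v x = dshift t x"
      using x by (simp add: alg_shift_mat_mult_vec)
    have "alg_shift ?M B s \<in> carrier_mat ?n ?n" "alg_shift ?M ?D t \<in> carrier_mat ?n ?n"
      unfolding alg_shift_mat[OF B] alg_shift_mat[OF mat_diag_dim] by (auto intro!: minus_carrier_mat)
    then have "(alg_shift ?M B s \<otimes>\<^bsub>?M\<^esub> alg_shift ?M ?D t) *\<^sub>v x = alg_shift ?M B s *\<^sub>v dshift t x"
      using assoc_mult_mat_vec[of "alg_shift ?M B s" ?n ?n "alg_shift ?M ?D t" ?n x] x 1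
      by (simp add: module_mat_simps)
    then show ?thesis by (simp add: alg_shift_mat_mult_vec[OF B])
  qed
  have uniq: "idempotent_ordering d ?M B \<theta>' E \<Longrightarrow> \<theta>' = \<theta>" "idempotent_ordering d ?M ?D \<theta>s' Es \<Longrightarrow> \<theta>s' = \<theta>s"
    for \<theta>' \<theta>s'
    using idempotent_ordering_unique[OF matrix_mat_algebra c(1) ord]
      idempotent_ordering_unique[OF matrix_mat_algebra c(2) ords] by auto
  have space: "(\<forall>l\<in>{i<..d}. Es l *\<^sub>v x = 0\<^sub>v ?n) \<and> (\<forall>l<i. E l *\<^sub>v x = 0\<^sub>v ?n) \<longleftrightarrow>
      flag i x \<and> (\<forall>k. i < k \<longrightarrow> k \<le> d \<longrightarrow> x $ k = 0)" if x: "x \<in> carrier_vec ?n" and i: "i \<le> d" for x i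
    using E Es x i unfolding flag_def by auto
  \<comment> \<open>The dual factor carries the generator at \<open>i\<close> to the one at
    \<open>i - 1\<close>, and \<open>B - \<theta>_{i-1}\<close> carries that one back with the
    coefficient.\<close>
  have image: "B *\<^sub>v dshift (\<theta>s i) (split_vec i) - \<theta> (i - 1) \<cdot>\<^sub>v dshift (\<theta>s i) (split_vec i) =
      split_coeff i \<cdot>\<^sub>v split_vec i" if i: "i \<in> {1..d}" for i
  proof -
    have "i - 1 < d" "i - 1 + 1 = i" using i by auto
    then show ?thesis using i B_split_vec[of "i - 1"] by (simp add: dshift_split_vec)
  qed
  have eigen: "(\<exists>x\<in>carrier_vec ?n. x \<noteq> 0\<^sub>v ?n \<and>
         (\<forall>l\<in>{i<..d}. id (Es l) *\<^sub>v x = 0\<^sub>v ?n) \<and> (\<forall>l<i. id (E l) *\<^sub>v x = 0\<^sub>v ?n) \<and>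
         id (alg_shift ?M B (\<theta> (i - 1)) \<otimes>\<^bsub>?M\<^esub> alg_shift ?M ?D (\<theta>s i)) *\<^sub>v x = \<phi> i \<cdot>\<^sub>v x)
      \<longleftrightarrow> \<phi> i = split_coeff i" (is "?L \<longleftrightarrow> _") if i: "i \<in> {1..d}" for i
  proof
    assume ?L
    then obtain x where x: "x \<in> carrier_vec ?n" "x \<noteq> 0\<^sub>v ?n" "flag i x"
      "\<And>k. i < k \<Longrightarrow> k \<le> d \<Longrightarrow> x $ k = 0"
      and eq: "B *\<^sub>v dshift (\<theta>s i) x - \<theta> (i - 1) \<cdot>\<^sub>v dshift (\<theta>s i) x = \<phi> i \<cdot>\<^sub>v x"
      using space act i unfolding id_apply by auto
    define c where "c = x $ i / split_vec i $ i"
    have xc: "x = c \<cdot>\<^sub>v split_vec i"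
      unfolding c_def using split_vec_unique[OF x(3) _ x(4)] i by simp
    then have c0: "c \<noteq> 0" using x(2) by auto
    have "dshift (\<theta>s i) x = c \<cdot>\<^sub>v dshift (\<theta>s i) (split_vec i)"
      unfolding xc by (auto simp: dshift_def)
    then have "\<phi> i \<cdot>\<^sub>v x = c \<cdot>\<^sub>v (B *\<^sub>v dshift (\<theta>s i) (split_vec i) - \<theta> (i - 1) \<cdot>\<^sub>v dshift (\<theta>s i) (split_vec i))"
      unfolding eq[symmetric] mult_mat_vec[OF B dshift_closed(1)]
      by (simp add: mult_mat_vec[OF B dshift_closed(1)]) (auto simp: right_diff_distrib intro!: eq_vecI)
    then have "\<phi> i \<cdot>\<^sub>v x = c \<cdot>\<^sub>v (split_coeff i \<cdot>\<^sub>v split_vec i)" unfolding image[OF i] .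
    from arg_cong[OF this, of "\<lambda>v. v $ i"] have "\<phi> i * (c * split_vec i $ i) = c * (split_coeff i * split_vec i $ i)"
      using i unfolding xc by simp
    then show "\<phi> i = split_coeff i" using c0 split_vec_diag_nonzero[of i] i by simp
  next
    assume \<phi>: "\<phi> i = split_coeff i"
    have "split_vec i \<noteq> 0\<^sub>v ?n" using split_vec_diag_nonzero[of i] i by auto
    moreover have "flag i (split_vec i)" "\<forall>k. i < k \<longrightarrow> k \<le> d \<longrightarrow> split_vec i $ k = 0"
      using flag_split_vec[of i] split_vec_zero[of i] i by auto
    ultimately show ?L
      using space[OF split_vec_closed(1), of i i] act[OF split_vec_closed(1), of "\<theta> (i - 1)" "\<theta>s i" i] image[OF i] \<phi> i
      unfolding id_apply by (intro bexI[of _ "split_vec i"]) auto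
  qed
  show ?thesis
    unfolding first_split_sequence_iff[OF matrix_mat_algebra c iso]
  proof (intro conj_cong refl iffI)
    assume "\<forall>i\<in>{1..d}. \<phi> i = split_coeff i"
    then show "\<exists>\<theta> \<theta>s'. idempotent_ordering d ?M B \<theta> E \<and> idempotent_ordering d ?M ?D \<theta>s' Es \<and>
      (\<forall>i\<in>{1..d}. \<exists>x\<in>carrier_vec ?n. x \<noteq> 0\<^sub>v ?n \<and>
         (\<forall>l\<in>{i<..d}. id (Es l) *\<^sub>v x = 0\<^sub>v ?n) \<and> (\<forall>l<i. id (E l) *\<^sub>v x = 0\<^sub>v ?n) \<and>
         id (alg_shift ?M B (\<theta> (i - 1)) \<otimes>\<^bsub>?M\<^esub> alg_shift ?M ?D (\<theta>s' i)) *\<^sub>v x = \<phi> i \<cdot>\<^sub>v x)"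
      by (intro exI[of _ \<theta>] exI[of _ \<theta>s] conjI ord ords ballI iffD2[OF eigen]) simp_all
  next
    assume "\<exists>\<theta> \<theta>s'. idempotent_ordering d ?M B \<theta> E \<and> idempotent_ordering d ?M ?D \<theta>s' Es \<and>
      (\<forall>i\<in>{1..d}. \<exists>x\<in>carrier_vec ?n. x \<noteq> 0\<^sub>v ?n \<and>
         (\<forall>l\<in>{i<..d}. id (Es l) *\<^sub>v x = 0\<^sub>v ?n) \<and> (\<forall>l<i. id (E l) *\<^sub>v x = 0\<^sub>v ?n) \<and>
         id (alg_shift ?M B (\<theta> (i - 1)) \<otimes>\<^bsub>?M\<^esub> alg_shift ?M ?D (\<theta>s' i)) *\<^sub>v x = \<phi> i \<cdot>\<^sub>v x)"
    then obtain \<theta>' \<theta>s' where o: "idempotent_ordering d ?M B \<theta>' E" "idempotent_ordering d ?M ?D \<theta>s' Es"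
      and *: "\<forall>i\<in>{1..d}. \<exists>x\<in>carrier_vec ?n. x \<noteq> 0\<^sub>v ?n \<and>
         (\<forall>l\<in>{i<..d}. id (Es l) *\<^sub>v x = 0\<^sub>v ?n) \<and> (\<forall>l<i. id (E l) *\<^sub>v x = 0\<^sub>v ?n) \<and>
         id (alg_shift ?M B (\<theta>' (i - 1)) \<otimes>\<^bsub>?M\<^esub> alg_shift ?M ?D (\<theta>s' i)) *\<^sub>v x = \<phi> i \<cdot>\<^sub>v x"
      by (elim exE conjE)
    show "\<forall>i\<in>{1..d}. \<phi> i = split_coeff i"
    proof
      fix i assume i: "i \<in> {1..d}"
      show "\<phi> i = split_coeff i"
        by (rule iffD1[OF eigen[OF i] bspec[OF *[unfolded uniq(1)[OF o(1)] uniq(2)[OF o(2)]] i]])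
    qed
  qed
qed

lemma eigenvalue_vector:
  fixes B :: "'k::field mat"
  assumes B: "B \<in> carrier_mat (d + 1) (d + 1)" and ord: "idempotent_ordering d (mat_algebra d) B \<theta> E"
    and i: "i \<le> d"
  obtains v where "v \<in> carrier_vec (d + 1)" "v \<noteq> 0\<^sub>v (d + 1)" "B *\<^sub>v v = \<theta> i \<cdot>\<^sub>v v"
proof -
  have "alg_eigenvalue d (mat_algebra d) B (\<theta> i)"
    using ord i unfolding idempotent_ordering_def bij_betw_def by auto
  then show thesis
    using that B alg_eigenvalue_mat[OF B] unfolding eigenvalue_def eigenvector_def by auto
qed

text \<open>The vector construction is instantiated twice. With the given order it yields the
  diagonal and the superdiagonal, in terms of the first split sequence; with the reversed order it
  yields the subdiagonal. The first conclusion records both existence and uniqueness of the split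
  sequences.\<close>

lemma split_sequences_row_sum:
  fixes B :: "'k::field mat"
  assumes L: "leonard_system d (mat_algebra d) B (mat_diag (d + 1) \<theta>s) E Es"
    and ord: "idempotent_ordering d (mat_algebra d) B \<theta> E"
    and ords: "idempotent_ordering d (mat_algebra d) (mat_diag (d + 1) \<theta>s) \<theta>s Es"
    and row: "constant_row_sum B (\<theta> 0)"
  obtains \<phi> \<psi> where
    "\<And>\<phi>' \<psi>'. system_parameter_array d (mat_algebra d) B (mat_diag (d + 1) \<theta>s) E Es (\<theta>, \<theta>s, \<phi>', \<psi>') \<longleftrightarrow>
      \<phi>' = \<phi> \<and> \<psi>' = \<psi>"
    "B = p_T d (\<theta>, \<theta>s, \<phi>, \<psi>)"
proof -
  let ?n = "d + 1" and ?D = "mat_diag (d + 1) \<theta>s" and ?M = "mat_algebra d :: ('k, 'k mat) module"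
  have Bc: "B \<in> carrier_mat ?n ?n"
    using L unfolding leonard_system_def multiplicity_free_def by (simp add: module_mat_simps)
  have row': "(\<Sum>j\<le>d. B $$ (i, j)) = \<theta> 0" if "i \<le> d" for i
  proof -
    have "{..<?n} = {..d}" by auto
    then show ?thesis using row Bc that unfolding constant_row_sum_def by auto
  qed
  obtain Q Qi T where mats: "leonard_matrices d B \<theta> \<theta>s Q Qi T"
    and E: "\<forall>l\<le>d. \<forall>x\<in>carrier_vec ?n. E l *\<^sub>v x = 0\<^sub>v ?n \<longleftrightarrow> (Qi *\<^sub>v x) $ l = 0"
    and Es: "\<forall>l\<le>d. \<forall>x\<in>carrier_vec ?n. Es l *\<^sub>v x = 0\<^sub>v ?n \<longleftrightarrow> x $ l = 0"
    using leonard_system_matrices[OF L ord ords] by metis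
  obtain q where q: "q \<in> carrier_vec ?n" "q \<noteq> 0\<^sub>v ?n" "B *\<^sub>v q = \<theta> d \<cdot>\<^sub>v q"
    using eigenvalue_vector[OF Bc ord order_refl] by blast
  interpret F: leonard_matrices_vector d B \<theta> \<theta>s Q Qi T q
    using mats q by (intro leonard_matrices_vector.intro leonard_matrices_vector_axioms.intro)
  \<comment> \<open>After reversal the last eigenvalue is \<theta>_0, and constant row sum says
    precisely that the all-ones vector is an eigenvector for it.\<close>
  define \<theta>' where "\<theta>' = (\<lambda>i\<in>{0..d}. \<theta> (d - i))"
  define E' where "E' = (\<lambda>i\<in>{0..d}. E (d - i))"
  have ord': "idempotent_ordering d ?M B \<theta>' E'"
    unfolding \<theta>'_def E'_def using Bc
    by (intro idempotent_ordering_reverse[OF matrix_mat_algebra _ ord]) (simp add: module_mat_simps)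
  have L': "leonard_system d ?M B ?D E' Es"
    unfolding E'_def by (rule leonard_system_reverse[OF L])
  obtain Q' Qi' T' where mats': "leonard_matrices d B \<theta>' \<theta>s Q' Qi' T'"
    and E': "\<forall>l\<le>d. \<forall>x\<in>carrier_vec ?n. E' l *\<^sub>v x = 0\<^sub>v ?n \<longleftrightarrow> (Qi' *\<^sub>v x) $ l = 0"
    using leonard_system_matrices[OF L' ord' ords] by metis
  let ?u = "vec ?n (\<lambda>_. 1) :: 'k vec"
  have u: "B *\<^sub>v ?u = \<theta>' d \<cdot>\<^sub>v ?u"
  proof (rule eq_vecI)
    fix i assume "i < dim_vec (\<theta>' d \<cdot>\<^sub>v ?u)"
    then have i: "i \<le> d" by simp
    have "(B *\<^sub>v ?u) $ i = (\<Sum>j\<le>d. B $$ (i, j) * ?u $ j)"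
      using i Bc by (intro mult_mat_vec_index) auto
    also have "\<dots> = (\<Sum>j\<le>d. B $$ (i, j))" by (intro sum.cong) auto
    finally show "(B *\<^sub>v ?u) $ i = (\<theta>' d \<cdot>\<^sub>v ?u) $ i" using i row' by (simp add: \<theta>'_def)
  qed (use Bc in auto)
  have "?u $ 0 \<noteq> 0\<^sub>v ?n $ 0" by simp
  then have u0: "?u \<noteq> 0\<^sub>v ?n" by metis
  interpret S: leonard_matrices_vector d B \<theta>' \<theta>s Q' Qi' T' ?u
    using mats' u u0 by (intro leonard_matrices_vector.intro leonard_matrices_vector_axioms.intro) auto
  define \<phi> where "\<phi> = (\<lambda>i\<in>{1..d}. F.split_coeff i)"
  define \<psi> where "\<psi> = (\<lambda>i\<in>{1..d}. S.split_coeff i)"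
  have first: "first_split_sequence d ?M B ?D E Es \<phi>' \<longleftrightarrow> \<phi>' = \<phi>" for \<phi>'
    unfolding F.first_split_sequence_eq[OF ord ords E Es] \<phi>_def
    by (auto simp: PiE_def extensional_def fun_eq_iff)
  have second: "second_split_sequence d ?M B ?D E Es \<psi>' \<longleftrightarrow> \<psi>' = \<psi>" for \<psi>'
    unfolding second_split_sequence_def E'_def[symmetric] S.first_split_sequence_eq[OF ord' ords E' Es] \<psi>_def
    by (auto simp: PiE_def extensional_def fun_eq_iff)
  have "B = p_T d (\<theta>, \<theta>s, \<phi>, \<psi>)"
  proof (rule eq_matI)
    fix i j assume "i < dim_row (p_T d (\<theta>, \<theta>s, \<phi>, \<psi>))" "j < dim_col (p_T d (\<theta>, \<theta>s, \<phi>, \<psi>))"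
    then have ij: "i \<le> d" "j \<le> d" by auto
    consider "i = j" | "j = i + 1" | "i = j + 1" | "i + 1 < j \<or> j + 1 < i" by force
    then show "B $$ (i, j) = p_T d (\<theta>, \<theta>s, \<phi>, \<psi>) $$ (i, j)"
    proof cases
      case 1
      then show ?thesis using ij F.B_diag[of i] by (auto simp: \<phi>_def)
    next
      case 2
      then show ?thesis using ij F.B_superdiag[OF row', of j] by (simp add: \<phi>_def)
    next
      case 3
      \<comment> \<open>For the all-ones vector the generators have plain products as entries, so
        the definition of \<open>S.split_coeff\<close> solved for the subdiagonal entry is the
        required formula.\<close>
      have s: "S.split_vec k $ k = (\<Prod>h\<in>{k + 1..d}. \<theta>s k - \<theta>s h)" if "k \<le> d" for k
        using that by (simp add: S.split_vec_index)
      have "S.split_vec i $ i \<noteq> 0" "S.split_vec j $ j \<noteq> 0"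
        using S.split_vec_diag_nonzero ij by auto
      then have "B $$ (i, j) = S.split_coeff i * S.split_vec i $ i / S.split_vec j $ j"
        using 3 by (simp add: S.split_coeff_def)
      then show ?thesis using 3 ij by (simp add: s \<psi>_def)
    next
      case 4
      then show ?thesis using ij F.B_zero[of i j] by auto
    qed
  qed (use Bc in auto)
  moreover have "system_parameter_array d ?M B ?D E Es (\<theta>, \<theta>s, \<phi>', \<psi>') \<longleftrightarrow> \<phi>' = \<phi> \<and> \<psi>' = \<psi>" for \<phi>' \<psi>'
    using ord ords first second by simp
  ultimately show thesis using that by blast
qed

section \<open>Canonical forms\<close>

context algebra_isomorphism
begin

text \<open>No module is transported. In the module-free criterion, \<open>g\<close> on the target
  and \<open>g \<circ> h\<close> on the source produce the very same matrices.\<close>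

lemma first_split_sequence_image:
  assumes m: "matrix_algebra d \<A>" and a: "a \<in> carrier \<A>" and b: "b \<in> carrier \<A>"
    and split: "first_split_sequence d \<A> a b E Es \<phi>"
  shows "first_split_sequence d \<B> (h a) (h b) (\<lambda>i\<in>{0..d}. h (E i)) (\<lambda>i\<in>{0..d}. h (Es i)) \<phi>"
proof -
  have mB: "matrix_algebra d \<B>" by (rule matrix_algebra_image[OF m])
  then obtain g where g: "g \<in> algebra_iso \<B> (mat_algebra d)"
    unfolding matrix_algebra_def by auto
  have isoB: "algebra_isomorphism \<B> (mat_algebra d) g"
    using assoc_B assoc_mat_algebra g by unfold_locales
  have isoA: "algebra_isomorphism \<A> (mat_algebra d) (g \<circ> h)"
    using assoc_A assoc_mat_algebra algebra_iso_comp[OF h g] by unfold_locales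
  from split[unfolded first_split_sequence_iff[OF m a b isoA]]
  obtain \<theta> \<theta>s where ext: "\<phi> \<in> {1..d} \<rightarrow>\<^sub>E UNIV"
    and ord: "idempotent_ordering d \<A> a \<theta> E" "idempotent_ordering d \<A> b \<theta>s Es"
    and x: "\<forall>i\<in>{1..d}. \<exists>x\<in>carrier_vec (d + 1). x \<noteq> 0\<^sub>v (d + 1) \<and>
         (\<forall>l\<in>{i<..d}. (g \<circ> h) (Es l) *\<^sub>v x = 0\<^sub>v (d + 1)) \<and> (\<forall>l<i. (g \<circ> h) (E l) *\<^sub>v x = 0\<^sub>v (d + 1)) \<and>
         (g \<circ> h) (alg_shift \<A> a (\<theta> (i - 1)) \<otimes>\<^bsub>\<A>\<^esub> alg_shift \<A> b (\<theta>s i)) *\<^sub>v x = \<phi> i \<cdot>\<^sub>v x"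
    by blast
  have shift: "h (alg_shift \<A> a s \<otimes>\<^bsub>\<A>\<^esub> alg_shift \<A> b t) = alg_shift \<B> (h a) s \<otimes>\<^bsub>\<B>\<^esub> alg_shift \<B> (h b) t"
    for s t
    using a b by (simp add: h_simps(2) alg_shift_closed h_shift)
  show ?thesis
    unfolding first_split_sequence_iff[OF mB h_simps(1)[OF a] h_simps(1)[OF b] isoB]
  proof (rule conjI[OF ext], rule exI[of _ \<theta>], rule exI[of _ \<theta>s], intro conjI
      idempotent_ordering_image[OF m a ord(1)] idempotent_ordering_image[OF m b ord(2)] ballI)
    fix i assume i: "i \<in> {1..d}"
    then obtain x where "x \<in> carrier_vec (d + 1)" "x \<noteq> 0\<^sub>v (d + 1)"
      "\<forall>l\<in>{i<..d}. g (h (Es l)) *\<^sub>v x = 0\<^sub>v (d + 1)" "\<forall>l<i. g (h (E l)) *\<^sub>v x = 0\<^sub>v (d + 1)"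
      "g (h (alg_shift \<A> a (\<theta> (i - 1)) \<otimes>\<^bsub>\<A>\<^esub> alg_shift \<A> b (\<theta>s i))) *\<^sub>v x = \<phi> i \<cdot>\<^sub>v x"
      using x unfolding comp_apply by blast
    then show "\<exists>x\<in>carrier_vec (d + 1). x \<noteq> 0\<^sub>v (d + 1) \<and>
        (\<forall>l\<in>{i<..d}. g ((\<lambda>i\<in>{0..d}. h (Es i)) l) *\<^sub>v x = 0\<^sub>v (d + 1)) \<and>
        (\<forall>l<i. g ((\<lambda>i\<in>{0..d}. h (E i)) l) *\<^sub>v x = 0\<^sub>v (d + 1)) \<and>
        g (alg_shift \<B> (h a) (\<theta> (i - 1)) \<otimes>\<^bsub>\<B>\<^esub> alg_shift \<B> (h b) (\<theta>s i)) *\<^sub>v x = \<phi> i \<cdot>\<^sub>v x"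
      using i unfolding shift by (intro bexI[of _ x]) auto
  qed
qed

lemma system_parameter_array_image:
  assumes m: "matrix_algebra d \<A>" and a: "a \<in> carrier \<A>" and b: "b \<in> carrier \<A>"
    and "system_parameter_array d \<A> a b E Es p"
  shows "system_parameter_array d \<B> (h a) (h b) (\<lambda>i\<in>{0..d}. h (E i)) (\<lambda>i\<in>{0..d}. h (Es i)) p"
proof -
  obtain \<theta> \<theta>s \<phi> \<psi> where p: "p = (\<theta>, \<theta>s, \<phi>, \<psi>)" by (cases p) auto
  have rev: "(\<lambda>i\<in>{0..d}. h ((\<lambda>i\<in>{0..d}. E (d - i)) i)) = (\<lambda>i\<in>{0..d}. (\<lambda>i\<in>{0..d}. h (E i)) (d - i))"
    by auto
  show ?thesis
    using assms(4) idempotent_ordering_image[OF m a] idempotent_ordering_image[OF m b]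
      first_split_sequence_image[OF m a b]
      first_split_sequence_image[OF m a b, of "\<lambda>i\<in>{0..d}. E (d - i)", unfolded rev]
    unfolding p system_parameter_array.simps second_split_sequence_def by blast
qed

lemma parameter_arrays_image_subset: "parameter_arrays d \<A> a b \<subseteq> parameter_arrays d \<B> (h a) (h b)"
proof
  fix p assume "p \<in> parameter_arrays d \<A> a b"
  then obtain E Es where "leonard_system d \<A> a b E Es" "system_parameter_array d \<A> a b E Es p"
    unfolding parameter_arrays_def by auto
  then show "p \<in> parameter_arrays d \<B> (h a) (h b)"
    using leonard_system_image system_parameter_array_image
    unfolding parameter_arrays_def leonard_system_def multiplicity_free_def by blast
qed

end

lemma (in algebra_isomorphism) parameter_arrays_image:
  assumes "a \<in> carrier \<A>" "b \<in> carrier \<A>"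
  shows "parameter_arrays d \<B> (h a) (h b) = parameter_arrays d \<A> a b"
  using parameter_arrays_image_subset[of d a b] assms k_h
    algebra_isomorphism.parameter_arrays_image_subset[OF inverse_isomorphism, of d "h a" "h b"]
  by auto

lemma leonard_system_pair: "leonard_system d \<A> A As E Es \<Longrightarrow> leonard_pair d \<A> A As"
  unfolding leonard_system_def leonard_pair_def by blast

lemma leonard_system_dual: "leonard_system d \<A> A As E Es \<longleftrightarrow> leonard_system d \<A> As A Es E"
  unfolding leonard_system_def by blast

lemma leonard_systemD:
  assumes "leonard_system d \<A> A As E Es"
  shows "matrix_algebra d \<A>" "A \<in> carrier \<A>" "As \<in> carrier \<A>"
  using assms unfolding leonard_system_def multiplicity_free_def by auto

lemma p_T_eq:
  fixes B :: "'k::field mat"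
  assumes L: "leonard_system d (mat_algebra d) B (mat_diag (d + 1) \<theta>s) E Es"
    and ord: "idempotent_ordering d (mat_algebra d) B \<theta> E"
    and ords: "idempotent_ordering d (mat_algebra d) (mat_diag (d + 1) \<theta>s) \<theta>s Es"
    and row: "constant_row_sum B (\<theta> 0)"
    and par: "system_parameter_array d (mat_algebra d) B (mat_diag (d + 1) \<theta>s) E Es (\<theta>, \<theta>s, \<phi>, \<psi>)"
  shows "p_T d (\<theta>, \<theta>s, \<phi>, \<psi>) = B"
proof (rule split_sequences_row_sum[OF L ord ords row])
  fix \<phi>' \<psi>'
  assume iff: "\<And>\<phi>'' \<psi>''. system_parameter_array d (mat_algebra d) B (mat_diag (d + 1) \<theta>s) E Es (\<theta>, \<theta>s, \<phi>'', \<psi>'')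
      \<longleftrightarrow> \<phi>'' = \<phi>' \<and> \<psi>'' = \<psi>'" and B: "B = p_T d (\<theta>, \<theta>s, \<phi>', \<psi>')"
  have "\<phi> = \<phi>' \<and> \<psi> = \<psi>'" using iffD1[OF iff par] .
  then show ?thesis using B by simp
qed

text \<open>Diagonalizing the dual element fixes the isomorphism up to rescaling of the basis; the
  scaling is then chosen so that the eigenvector for \<theta>_0 becomes the all-ones vector.\<close>

lemma parameter_array_canonical_iso:
  fixes \<A> :: "('k::field, 'a, 'm) module_scheme"
  assumes L: "leonard_system d \<A> A As E Es"
    and par: "system_parameter_array d \<A> A As E Es (\<theta>, \<theta>s, \<phi>, \<psi>)"
  obtains h where "algebra_isomorphism \<A> (mat_algebra d) h" "h A = p_T d (\<theta>, \<theta>s, \<phi>, \<psi>)"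
    "h As = mat_diag (d + 1) \<theta>s" "constant_row_sum (h A) (\<theta> 0)"
proof -
  let ?n = "d + 1" and ?M = "mat_algebra d :: ('k, 'k mat) module" and ?D = "mat_diag (d + 1) \<theta>s"
  note m = leonard_systemD(1)[OF L] and A = leonard_systemD(2)[OF L] and As = leonard_systemD(3)[OF L]
  have ord: "idempotent_ordering d \<A> A \<theta> E" and ords: "idempotent_ordering d \<A> As \<theta>s Es"
    using par by auto
  obtain h where iso: "algebra_isomorphism \<A> ?M h" and hAs: "h As = ?D"
    using diagonalizing_iso[OF m As ords] by blast
  interpret algebra_isomorphism \<A> ?M h by (rule iso)
  let ?B = "h A" and ?E = "\<lambda>i\<in>{0..d}. h (E i)" and ?Es = "\<lambda>i\<in>{0..d}. h (Es i)"
  have B: "?B \<in> carrier_mat ?n ?n" using h_simps(1)[OF A] by (simp add: module_mat_simps)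
  have L1: "leonard_system d ?M ?B ?D ?E ?Es" using leonard_system_image[OF L] unfolding hAs .
  have ord1: "idempotent_ordering d ?M ?B \<theta> ?E" by (rule idempotent_ordering_image[OF m A ord])
  have ords1: "idempotent_ordering d ?M ?D \<theta>s ?Es" using idempotent_ordering_image[OF m As ords] unfolding hAs .
  obtain v where v: "v \<in> carrier_vec ?n" "v \<noteq> 0\<^sub>v ?n" "?B *\<^sub>v v = \<theta> 0 \<cdot>\<^sub>v v"
    using eigenvalue_vector[OF B ord1 le0] by blast
  \<comment> \<open>In the reversed system \<open>v\<close> belongs to the last eigenvalue, so
    \<open>q_index_nonzero\<close> applies to it.\<close>
  have v0: "v $ k \<noteq> 0" if "k \<le> d" for k
  proof -
    let ?\<theta> = "\<lambda>i\<in>{0..d}. \<theta> (d - i)"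
    obtain Q Qi T where "leonard_matrices d ?B ?\<theta> \<theta>s Q Qi T"
      using leonard_system_matrices[OF leonard_system_reverse[OF L1]
          idempotent_ordering_reverse[OF matrix_mat_algebra h_simps(1)[OF A] ord1] ords1] by metis
    then interpret leonard_matrices_vector d ?B ?\<theta> \<theta>s Q Qi T v
      using v by (intro leonard_matrices_vector.intro leonard_matrices_vector_axioms.intro) auto
    show ?thesis by (rule q_index_nonzero[OF that])
  qed
  \<comment> \<open>Conjugation by a diagonal matrix leaves the diagonal dual element unchanged and
    turns the eigenvalue equation for \<open>v\<close> into the row sum condition.\<close>
  let ?Q = "mat_diag ?n (\<lambda>k. v $ k)" and ?Qi = "mat_diag ?n (\<lambda>k. inverse (v $ k))"
  have "?Q * ?Qi = mat_diag ?n (\<lambda>_. 1)" "?Qi * ?Q = mat_diag ?n (\<lambda>_. 1)"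
    unfolding mat_diag_diag using v0 by (intro mat_diag_eqI; simp)+
  then have inv: "?Q * ?Qi = 1\<^sub>m ?n" "?Qi * ?Q = 1\<^sub>m ?n" by simp_all
  define g where "g X = ?Qi * X * ?Q" for X
  have "g \<circ> h \<in> algebra_iso \<A> ?M"
    using algebra_iso_comp[OF h conjugation_algebra_iso[OF mat_diag_dim mat_diag_dim inv]] unfolding g_def .
  then have iso2: "algebra_isomorphism \<A> ?M (g \<circ> h)"
    using assoc_A assoc_B by unfold_locales
  interpret g: algebra_isomorphism \<A> ?M "g \<circ> h" by (rule iso2)
  have gD: "(g \<circ> h) As = ?D"
    unfolding comp_apply hAs g_def mat_diag_diag using v0 by (intro mat_diag_eqI) auto
  have gB: "g ?B = mat ?n ?n (\<lambda>(i, j). inverse (v $ i) * ?B $$ (i, j) * v $ j)"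
    unfolding g_def mat_diag_mult_left[OF B]
    by (subst mat_diag_mult_right[of _ ?n]) (auto intro!: eq_matI)
  have row: "constant_row_sum ((g \<circ> h) A) (\<theta> 0)"
    unfolding constant_row_sum_def
  proof (intro allI impI)
    fix i assume "i < dim_row ((g \<circ> h) A)"
    then have i: "i \<le> d" by (simp add: gB)
    have "{..<?n} = {..d}" by auto
    then have "(\<Sum>j<dim_col ((g \<circ> h) A). (g \<circ> h) A $$ (i, j)) = inverse (v $ i) * (\<Sum>j\<le>d. ?B $$ (i, j) * v $ j)"
      using i by (simp add: gB sum_distrib_left mult.assoc)
    also have "(\<Sum>j\<le>d. ?B $$ (i, j) * v $ j) = (?B *\<^sub>v v) $ i"
      by (rule mult_mat_vec_index[OF B v(1) i, symmetric])
    also have "inverse (v $ i) * \<dots> = \<theta> 0" using v0[OF i] v(1,3) i by simp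
    finally show "(\<Sum>j<dim_col ((g \<circ> h) A). (g \<circ> h) A $$ (i, j)) = \<theta> 0" .
  qed
  let ?E2 = "\<lambda>i\<in>{0..d}. (g \<circ> h) (E i)" and ?Es2 = "\<lambda>i\<in>{0..d}. (g \<circ> h) (Es i)"
  have L2: "leonard_system d ?M ((g \<circ> h) A) ?D ?E2 ?Es2"
    using g.leonard_system_image[OF L] unfolding gD .
  have ord2: "idempotent_ordering d ?M ((g \<circ> h) A) \<theta> ?E2" by (rule g.idempotent_ordering_image[OF m A ord])
  have ords2: "idempotent_ordering d ?M ?D \<theta>s ?Es2" using g.idempotent_ordering_image[OF m As ords] unfolding gD .
  have par2: "system_parameter_array d ?M ((g \<circ> h) A) ?D ?E2 ?Es2 (\<theta>, \<theta>s, \<phi>, \<psi>)"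
    using g.system_parameter_array_image[OF m A As par] unfolding gD .
  have "(g \<circ> h) A = p_T d (\<theta>, \<theta>s, \<phi>, \<psi>)"
    by (rule p_T_eq[OF L2 ord2 ords2 row par2, symmetric])
  then show thesis using that[OF iso2 _ gD row] by blast
qed

text \<open>Off the diagonal each entry is a split parameter times a nonzero factor in the dual
  eigenvalues, which are shared by both arrays. Once the split sequences agree, the diagonal returns
  \<theta>.\<close>

lemma p_T_inject:
  fixes \<theta>s :: "nat \<Rightarrow> 'k::field"
  assumes inj: "inj_on \<theta>s {0..d}"
    and ext: "\<theta> \<in> {0..d} \<rightarrow>\<^sub>E UNIV" "\<phi> \<in> {1..d} \<rightarrow>\<^sub>E UNIV" "\<psi> \<in> {1..d} \<rightarrow>\<^sub>E UNIV"
      "\<theta>' \<in> {0..d} \<rightarrow>\<^sub>E UNIV" "\<phi>' \<in> {1..d} \<rightarrow>\<^sub>E UNIV" "\<psi>' \<in> {1..d} \<rightarrow>\<^sub>E UNIV"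
    and eq: "p_T d (\<theta>, \<theta>s, \<phi>, \<psi>) = p_T d (\<theta>', \<theta>s, \<phi>', \<psi>')"
  shows "\<theta> = \<theta>' \<and> \<phi> = \<phi>' \<and> \<psi> = \<psi>'"
proof -
  have ne: "\<theta>s i \<noteq> \<theta>s j" if "i \<le> d" "j \<le> d" "i \<noteq> j" for i j
    using inj_onD[OF inj, of i j] that by auto
  have entry: "p_T d (\<theta>, \<theta>s, \<phi>, \<psi>) $$ (i, j) = p_T d (\<theta>', \<theta>s, \<phi>', \<psi>') $$ (i, j)" for i j
    unfolding eq ..
  have \<phi>: "\<phi> = \<phi>'"
  proof (rule PiE_ext[OF ext(2,5)])
    fix j assume j: "j \<in> {1..d}"
    have "(\<Prod>h<j - 1. \<theta>s (j - 1) - \<theta>s h) \<noteq> 0" "(\<Prod>h<j. \<theta>s j - \<theta>s h) \<noteq> 0"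
      using ne j by auto
    moreover have "j - 1 \<noteq> j" "j - 1 + 1 = j" "j - 1 \<noteq> j + 1" using j by auto
    ultimately show "\<phi> j = \<phi>' j" using entry[of "j - 1" j] j by simp
  qed
  have \<psi>: "\<psi> = \<psi>'"
  proof (rule PiE_ext[OF ext(3,6)])
    fix i assume i: "i \<in> {1..d}"
    have "(\<Prod>h\<in>{i + 1..d}. \<theta>s i - \<theta>s h) \<noteq> 0" "(\<Prod>h\<in>{i..d}. \<theta>s (i - 1) - \<theta>s h) \<noteq> 0"
      using ne i by auto
    moreover have "i - 1 \<noteq> i" "i - 1 + 1 = i" "i - 1 \<noteq> i + 1" using i by auto
    ultimately show "\<psi> i = \<psi>' i" using entry[of i "i - 1"] i by simp
  qed
  have "\<theta> = \<theta>'"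
  proof (rule PiE_ext[OF ext(1,4)])
    fix i assume "i \<in> {0..d}"
    then show "\<theta> i = \<theta>' i" using entry[of i i] by (simp add: \<phi>)
  qed
  then show ?thesis using \<phi> \<psi> by blast
qed

section \<open>Designated parameter arrays\<close>

lemma eigenvalue_mat_diag: "eigenvalue (mat_diag n f) t \<longleftrightarrow> t \<in> f ` {..<n}" for f :: "nat \<Rightarrow> 'k::field"
proof
  have dim: "dim_row (mat_diag n f) = n" by (simp add: mat_diag_def)
  show "t \<in> f ` {..<n}" if ev: "eigenvalue (mat_diag n f) t"
  proof -
    obtain v where v: "v \<in> carrier_vec n" "v \<noteq> 0\<^sub>v n" "mat_diag n f *\<^sub>v v = t \<cdot>\<^sub>v v"
      using ev unfolding eigenvalue_def eigenvector_def dim by blast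
    obtain k where k: "k < n" "v $ k \<noteq> 0"
      using v(1,2) by (metis carrier_vecD eq_vecI index_zero_vec)
    have "(mat_diag n f *\<^sub>v v) $ k = (t \<cdot>\<^sub>v v) $ k" using v(3) by simp
    then have "f k * v $ k = t * v $ k" using k v(1) by (simp add: mat_diag_mult_vec[OF v(1)])
    then show ?thesis using k by auto
  qed
  show "eigenvalue (mat_diag n f) t" if img: "t \<in> f ` {..<n}"
  proof -
    obtain k where k: "k < n" "t = f k" using img by auto
    have "mat_diag n f *\<^sub>v unit_vec n k = t \<cdot>\<^sub>v unit_vec n k"
      using k by (subst mat_diag_mult_vec) auto
    then show ?thesis
      using k unfolding eigenvalue_def eigenvector_def dim by (intro exI[of _ "unit_vec n k"]) simp
  qed
qed

lemma diagonal_mat_eq_mat_diag: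
  assumes "X \<in> carrier_mat n n" "diagonal_mat X" "\<And>i. i < n \<Longrightarrow> f i = X $$ (i, i)"
  shows "X = mat_diag n f"
  using assms by (auto simp: mat_diag_def diagonal_mat_def intro!: eq_matI)

text \<open>It replaces the given dual sequence by the one in diagonal order. The two differ by a
  permutation, which tridiagonality of \<open>B\<close> forces to be the identity or the reversal,
  and both keep the Leonard conditions.\<close>

lemma leonard_system_standard_dual:
  fixes B :: "'k::field mat"
  assumes L: "leonard_system d (mat_algebra d) B (mat_diag (d + 1) \<theta>s) E Es'"
    and tri: "tridiagonal_mat B" and ext: "\<theta>s \<in> {0..d} \<rightarrow>\<^sub>E UNIV"
  obtains Es where "leonard_system d (mat_algebra d) B (mat_diag (d + 1) \<theta>s) E Es"
    "idempotent_ordering d (mat_algebra d) (mat_diag (d + 1) \<theta>s) \<theta>s Es"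
proof -
  let ?n = "d + 1" and ?M = "mat_algebra d :: ('k, 'k mat) module" and ?D = "mat_diag (d + 1) \<theta>s"
  have B: "B \<in> carrier_mat ?n ?n" and Dc: "?D \<in> carrier ?M"
    using leonard_systemD(2,3)[OF L] by (simp_all add: module_mat_simps)
  have seq: "idempotent_sequence d ?M ?D B Es'" using L unfolding leonard_system_def by blast
  then obtain \<theta>s' where ord': "idempotent_ordering d ?M ?D \<theta>s' Es'"
    unfolding idempotent_sequence_def by blast
  have "{0..d} = {..<?n}" by auto
  then have eig: "{t. alg_eigenvalue d ?M ?D t} = \<theta>s ` {0..d}"
    by (auto simp: alg_eigenvalue_mat eigenvalue_mat_diag)
  have "card {t. alg_eigenvalue d ?M ?D t} = d + 1"
    using L unfolding leonard_system_def multiplicity_free_def by blast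
  \<comment> \<open>The diagonal entries are distinct by counting: \<open>d + 1\<close> positions
    have to cover \<open>d + 1\<close> eigenvalues.\<close>
  then have inj: "inj_on \<theta>s {0..d}" unfolding eig by (intro eq_card_imp_inj_on) auto
  define Es where "Es = (\<lambda>i\<in>{0..d}. primitive_idempotent d ?M ?D \<theta>s i)"
  have ord: "idempotent_ordering d ?M ?D \<theta>s Es"
    using ext inj eig primitive_idempotent_closed[OF assoc_mat_algebra Dc]
    unfolding idempotent_ordering_def Es_def bij_betw_def by auto
  have bij': "bij_betw \<theta>s' {0..d} {t. alg_eigenvalue d ?M ?D t}"
    using ord' unfolding idempotent_ordering_def by blast
  \<comment> \<open>The position on the diagonal of the \<open>i\<close>-th eigenvalue in the given
    dual order.\<close>
  define \<sigma> where "\<sigma> i = inv_into {0..d} \<theta>s (\<theta>s' i)" for i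
  have \<theta>\<sigma>: "\<theta>s (\<sigma> i) = \<theta>s' i" "\<sigma> i \<le> d" if "i \<le> d" for i
  proof -
    have img: "\<theta>s' i \<in> \<theta>s ` {0..d}" using bij' that unfolding eig bij_betw_def by auto
    then show "\<theta>s (\<sigma> i) = \<theta>s' i" "\<sigma> i \<le> d"
      unfolding \<sigma>_def using f_inv_into_f[OF img] inv_into_into[OF img] by simp_all
  qed
  have "inj_on \<sigma> {0..d}"
    using \<theta>\<sigma>(1) bij' unfolding bij_betw_def inj_on_def by (metis atLeastAtMost_iff)
  moreover have "\<sigma> ` {0..d} \<subseteq> {0..d}" by (rule image_subsetI) (simp add: \<theta>\<sigma>(2))
  ultimately have bij: "bij_betw \<sigma> {0..d} {0..d}"
    using endo_inj_surj[of "{0..d}" \<sigma>] unfolding bij_betw_def by simp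
  have Es': "Es' i = Es (\<sigma> i)" if i: "i \<le> d" for i
  proof -
    have "Es' i = primitive_idempotent d ?M ?D \<theta>s' i" using ord' i unfolding idempotent_ordering_def by auto
    also have "\<dots> = Es (\<sigma> i)"
      using \<theta>\<sigma>[OF i] i by (intro primitive_idempotent_reorder[OF matrix_mat_algebra Dc ord bij']) auto
    finally show ?thesis .
  qed
  \<comment> \<open>Consecutive members of the given dual sequence are linked by a nonzero entry of
    \<open>B\<close> at the permuted positions, which therefore are adjacent.\<close>
  have step: "\<bar>int (\<sigma> i) - int (\<sigma> (i + 1))\<bar> = 1" if i: "i < d" for i
  proof -
    have "i \<in> {0..d}" "i + 1 \<in> {0..d}" "\<bar>int i - int (i + 1)\<bar> = 1" using i by auto
    then have "Es' i \<otimes>\<^bsub>?M\<^esub> B \<otimes>\<^bsub>?M\<^esub> Es' (i + 1) \<noteq> \<zero>\<^bsub>?M\<^esub>"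
      using seq unfolding idempotent_sequence_def by blast
    then have "B $$ (\<sigma> i, \<sigma> (i + 1)) \<noteq> 0"
      using diag_unit_sandwich[OF B, of "\<sigma> i" "\<sigma> (i + 1)"] \<theta>\<sigma> Es' i
        idempotent_ordering_mat_diag[OF ord] by (simp add: module_mat_simps)
    then have "\<sigma> i = \<sigma> (i + 1) \<or> \<sigma> i = \<sigma> (i + 1) + 1 \<or> \<sigma> (i + 1) = \<sigma> i + 1"
      using tri \<theta>\<sigma>(2)[of i] \<theta>\<sigma>(2)[of "i + 1"] B i unfolding tridiagonal_mat_def by auto
    moreover have "\<sigma> i \<noteq> \<sigma> (i + 1)"
      using bij_betw_imp_inj_on[OF bij] i by (auto dest: inj_onD[of _ _ i "i + 1"])
    ultimately show ?thesis by auto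
  qed
  have Es_ext: "Es \<in> {0..d} \<rightarrow>\<^sub>E carrier ?M" "Es' \<in> {0..d} \<rightarrow>\<^sub>E carrier ?M"
    using ord ord' unfolding idempotent_ordering_def by blast+
  from unit_step_bijection[OF bij step] have "leonard_system d ?M B ?D E Es"
  proof
    assume "\<forall>i\<le>d. \<sigma> i = i"
    then have "Es' = Es" using Es' by (intro PiE_ext[OF Es_ext(2,1)]) auto
    then show ?thesis using L by simp
  next
    assume rev: "\<forall>i\<le>d. \<sigma> i = d - i"
    have "Es = (\<lambda>i\<in>{0..d}. Es' (d - i))"
    proof (rule PiE_ext[OF Es_ext(1)])
      show "(\<lambda>i\<in>{0..d}. Es' (d - i)) \<in> {0..d} \<rightarrow>\<^sub>E carrier ?M"
        using idempotent_ordering_closed[OF ord'] by auto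
      show "Es i = (\<lambda>i\<in>{0..d}. Es' (d - i)) i" if "i \<in> {0..d}" for i
        using that Es'[of "d - i"] rev by simp
    qed
    then show ?thesis
      using leonard_system_reverse[of d ?M ?D B Es' E] L leonard_system_dual by metis
  qed
  then show thesis using that ord by blast
qed

lemma td_d_canonical_carrier:
  assumes "td_d_canonical d B Bs"
  shows "B \<in> carrier_mat (d + 1) (d + 1)" "Bs \<in> carrier_mat (d + 1) (d + 1)"
  using assms unfolding td_d_canonical_def leonard_pair_def multiplicity_free_def
  by (simp_all add: module_mat_simps)

lemma designated_parameter_array_matrices:
  fixes B :: "'k::field mat"
  assumes can: "td_d_canonical d B Bs" and des: "designated_parameter_array d B Bs p"
  shows "p \<in> parameter_arrays d (mat_algebra d) B Bs" "p_T d p = B" "p_D d p = Bs"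
proof -
  let ?M = "mat_algebra d :: ('k, 'k mat) module"
  note c = td_d_canonical_carrier[OF can]
  then have cM: "B \<in> carrier ?M" "Bs \<in> carrier ?M" by (simp_all add: module_mat_simps)
  obtain E Es where sys: "designated_system d B Bs E Es" and par: "system_parameter_array d ?M B Bs E Es p"
    using des unfolding designated_parameter_array_def by blast
  have L: "leonard_system d ?M B Bs E Es" using sys unfolding designated_system_def by blast
  then show "p \<in> parameter_arrays d ?M B Bs" using par unfolding parameter_arrays_def by blast
  obtain \<theta> \<theta>s \<phi> \<psi> where p: "p = (\<theta>, \<theta>s, \<phi>, \<psi>)" by (cases p) auto
  have ord: "idempotent_ordering d ?M B \<theta> E" "idempotent_ordering d ?M Bs \<theta>s Es"
    using par unfolding p by auto
  \<comment> \<open>The designated system has its own existentially quantified eigenvalue sequences;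
    uniqueness identifies them with the components of \<open>p\<close>.\<close>
  have row: "constant_row_sum B (\<theta> 0)"
    using sys idempotent_ordering_unique[OF matrix_mat_algebra cM(1) ord(1)]
    unfolding designated_system_def by blast
  have diag: "\<forall>i\<in>{0..d}. \<theta>s i = Bs $$ (i, i)"
    using sys idempotent_ordering_unique[OF matrix_mat_algebra cM(2) ord(2)]
    unfolding designated_system_def by blast
  have Bs: "Bs = mat_diag (d + 1) \<theta>s"
    using can diag c(2) unfolding td_d_canonical_def by (intro diagonal_mat_eq_mat_diag) auto
  show "p_D d p = Bs" unfolding p Bs by simp
  show "p_T d p = B"
    unfolding p by (rule p_T_eq[OF L[unfolded Bs] ord(1) ord(2)[unfolded Bs] row par[unfolded p Bs]])
qed

lemma designated_parameter_array_exists: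
  fixes B :: "'k::field mat"
  assumes can: "td_d_canonical d B Bs"
  obtains p where "designated_parameter_array d B Bs p"
proof -
  let ?n = "d + 1" and ?M = "mat_algebra d :: ('k, 'k mat) module"
  note c = td_d_canonical_carrier[OF can]
  define \<theta>s where "\<theta>s = (\<lambda>i\<in>{0..d}. Bs $$ (i, i))"
  have Bs: "Bs = mat_diag ?n \<theta>s"
    using can c(2) unfolding td_d_canonical_def \<theta>s_def by (intro diagonal_mat_eq_mat_diag) auto
  obtain E0 Es0 \<theta>0 where L0: "leonard_system d ?M B Bs E0 Es0" and ord0: "idempotent_ordering d ?M B \<theta>0 E0"
    and row0: "constant_row_sum B (\<theta>0 0) \<or> constant_row_sum B (\<theta>0 d)"
    using can unfolding td_d_canonical_def by blast
  \<comment> \<open>If the row sum is the last eigenvalue, reversing the idempotents makes it the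
    first one.\<close>
  have "\<exists>E \<theta>. leonard_system d ?M B Bs E Es0 \<and> idempotent_ordering d ?M B \<theta> E \<and> constant_row_sum B (\<theta> 0)"
  proof (cases "constant_row_sum B (\<theta>0 0)")
    case True
    then show ?thesis using L0 ord0 by blast
  next
    case False
    then have "constant_row_sum B ((\<lambda>i\<in>{0..d}. \<theta>0 (d - i)) 0)" using row0 by simp
    then show ?thesis
      using leonard_system_reverse[OF L0]
        idempotent_ordering_reverse[OF leonard_systemD(1,2)[OF L0] ord0] by blast
  qed
  then obtain E \<theta> where L1: "leonard_system d ?M B Bs E Es0" and ord: "idempotent_ordering d ?M B \<theta> E"
    and row: "constant_row_sum B (\<theta> 0)" by blast
  have tri: "tridiagonal_mat B" using can unfolding td_d_canonical_def by blast
  have ext: "\<theta>s \<in> {0..d} \<rightarrow>\<^sub>E UNIV" unfolding \<theta>s_def by auto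
  obtain Es where L: "leonard_system d ?M B (mat_diag ?n \<theta>s) E Es"
    and ords: "idempotent_ordering d ?M (mat_diag ?n \<theta>s) \<theta>s Es"
    using leonard_system_standard_dual[OF L1[unfolded Bs] tri ext] by blast
  have "\<exists>\<phi> \<psi>. system_parameter_array d ?M B Bs E Es (\<theta>, \<theta>s, \<phi>, \<psi>)"
  proof (rule split_sequences_row_sum[OF L ord ords row])
    fix \<phi> \<psi>
    assume iff: "\<And>\<phi>' \<psi>'. system_parameter_array d ?M B (mat_diag ?n \<theta>s) E Es (\<theta>, \<theta>s, \<phi>', \<psi>')
      \<longleftrightarrow> \<phi>' = \<phi> \<and> \<psi>' = \<psi>"
    have "system_parameter_array d ?M B Bs E Es (\<theta>, \<theta>s, \<phi>, \<psi>)"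
      unfolding Bs by (rule iffD2[OF iff]) (rule conjI[OF refl refl])
    then show ?thesis by blast
  qed
  then obtain \<phi> \<psi> where par: "system_parameter_array d ?M B Bs E Es (\<theta>, \<theta>s, \<phi>, \<psi>)" by blast
  have diag: "\<forall>i\<in>{0..d}. \<theta>s i = Bs $$ (i, i)" unfolding \<theta>s_def by simp
  have "designated_system d B Bs E Es"
    unfolding designated_system_def
    using L[folded Bs] ord ords[folded Bs] row diag by blast
  then have "designated_parameter_array d B Bs (\<theta>, \<theta>s, \<phi>, \<psi>)"
    unfolding designated_parameter_array_def using par by blast
  then show thesis by (rule that)
qed

text \<open>Canonical forms are defined with an unspecified size. The intrinsic description of
  eigenvalues does not refer to the size, so counting eigenvalues recovers the diameter.\<close>

lemma leonard_pair_iso_diameter: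
  fixes \<A> :: "('k::field, 'a, 'm) module_scheme"
  assumes pair: "leonard_pair d \<A> A As" and can: "td_d_canonical e B Bs"
    and iso: "leonard_pair_iso \<A> A As (mat_algebra e) B Bs"
  shows "e = d"
proof -
  obtain h where h_iso: "h \<in> algebra_iso \<A> (mat_algebra e)" and hA: "h A = B"
    using iso unfolding leonard_pair_iso_def by blast
  have m: "matrix_algebra d \<A>" and A: "A \<in> carrier \<A>" and card: "card {t. alg_eigenvalue d \<A> A t} = d + 1"
    using pair unfolding leonard_pair_def multiplicity_free_def by auto
  have me: "matrix_algebra e \<A>" using m h_iso unfolding matrix_algebra_def by auto
  interpret algebra_isomorphism \<A> "mat_algebra e" h
    using matrix_algebraD(2)[OF m] assoc_mat_algebra h_iso by unfold_locales
  have "alg_eigenvalue e (mat_algebra e) B t \<longleftrightarrow> alg_eigenvalue d \<A> A t" for t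
    using alg_eigenvalue_image[OF me A] alg_eigenvalue_iff[OF me A] alg_eigenvalue_iff[OF m A] hA by simp
  moreover have "card {t. alg_eigenvalue e (mat_algebra e) B t} = e + 1"
    using can unfolding td_d_canonical_def leonard_pair_def multiplicity_free_def by blast
  ultimately show ?thesis using card by simp
qed

theorem theorem22p8:
  fixes \<A> :: "('k::field, 'a, 'm) module_scheme" and d :: nat and A As :: 'a
  assumes "leonard_pair d \<A> A As"
  shows "bij_betw (\<lambda>p. (p_T d p, p_D d p))
           (parameter_arrays d \<A> A As) (td_d_canonical_forms \<A> A As) \<and>
         (\<forall>(B, Bs) \<in> td_d_canonical_forms \<A> A As. \<forall>p.
           designated_parameter_array d B Bs p \<longleftrightarrow>
           p = the_inv_into (parameter_arrays d \<A> A As) (\<lambda>p. (p_T d p, p_D d p)) (B, Bs))"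
proof -
  let ?f = "\<lambda>p. (p_T d p, p_D d p)" and ?P = "parameter_arrays d \<A> A As"
    and ?C = "td_d_canonical_forms \<A> A As" and ?M = "mat_algebra d :: ('k, 'k mat) module"
  have m: "matrix_algebra d \<A>" and A: "A \<in> carrier \<A>" and As: "As \<in> carrier \<A>"
    using assms unfolding leonard_pair_def multiplicity_free_def by auto
  have inj: "inj_on ?f ?P"
  proof (rule inj_onI)
    fix p p' assume p: "p \<in> ?P" and p': "p' \<in> ?P" and eq: "?f p = ?f p'"
    obtain \<theta> \<theta>s \<phi> \<psi> where pq: "p = (\<theta>, \<theta>s, \<phi>, \<psi>)" by (cases p) auto
    obtain \<theta>' \<theta>s' \<phi>' \<psi>' where pq': "p' = (\<theta>', \<theta>s', \<phi>', \<psi>')" by (cases p') auto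
    have e: "\<theta> \<in> {0..d} \<rightarrow>\<^sub>E UNIV" "\<theta>s \<in> {0..d} \<rightarrow>\<^sub>E UNIV" "\<phi> \<in> {1..d} \<rightarrow>\<^sub>E UNIV" "\<psi> \<in> {1..d} \<rightarrow>\<^sub>E UNIV"
      and inj: "inj_on \<theta>s {0..d}"
      using p unfolding parameter_arrays_def pq
      by (auto simp: idempotent_ordering_def first_split_sequence_def second_split_sequence_def bij_betw_def)
    have e': "\<theta>' \<in> {0..d} \<rightarrow>\<^sub>E UNIV" "\<theta>s' \<in> {0..d} \<rightarrow>\<^sub>E UNIV" "\<phi>' \<in> {1..d} \<rightarrow>\<^sub>E UNIV" "\<psi>' \<in> {1..d} \<rightarrow>\<^sub>E UNIV"
      using p' unfolding parameter_arrays_def pq'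
      by (auto simp: idempotent_ordering_def first_split_sequence_def second_split_sequence_def)
    have "\<theta>s = \<theta>s'"
    proof (rule PiE_ext[OF e(2) e'(2)])
      fix i assume i: "i \<in> {0..d}"
      have "p_D d p $$ (i, i) = p_D d p' $$ (i, i)" using eq by simp
      then show "\<theta>s i = \<theta>s' i" using i unfolding pq pq' by (simp add: mat_diag_def)
    qed
    then show "p = p'"
      using p_T_inject[OF inj e(1,3,4) e'(1,3,4)] eq unfolding pq pq' by simp
  qed
  have into: "?f p \<in> ?C" if p: "p \<in> ?P" for p
  proof -
    obtain \<theta> \<theta>s \<phi> \<psi> where pq: "p = (\<theta>, \<theta>s, \<phi>, \<psi>)" by (cases p) auto
    obtain E Es where L: "leonard_system d \<A> A As E Es" and par: "system_parameter_array d \<A> A As E Es p"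
      using p unfolding parameter_arrays_def by blast
    obtain h where iso: "algebra_isomorphism \<A> ?M h" and h: "h A = p_T d p" "h As = p_D d p"
      and row: "constant_row_sum (h A) (\<theta> 0)"
      using parameter_array_canonical_iso[OF L par[unfolded pq]] unfolding pq p_D.simps by blast
    note hA = h
    interpret algebra_isomorphism \<A> ?M h by (rule iso)
    have ord: "idempotent_ordering d \<A> A \<theta> E" using par unfolding pq by simp
    have L': "leonard_system d ?M (h A) (h As) (\<lambda>i\<in>{0..d}. h (E i)) (\<lambda>i\<in>{0..d}. h (Es i))"
      by (rule leonard_system_image[OF L])
    have "tridiagonal_mat (p_T d p)" unfolding pq tridiagonal_mat_def by simp
    moreover have "diagonal_mat (p_D d p)" unfolding pq diagonal_mat_def by (simp add: mat_diag_def)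
    ultimately have "td_d_canonical d (p_T d p) (p_D d p)"
      unfolding td_d_canonical_def hA[symmetric]
      using leonard_system_pair[OF L'] L' idempotent_ordering_image[OF m A ord] row by blast
    moreover have "leonard_pair_iso \<A> A As ?M (p_T d p) (p_D d p)"
      unfolding leonard_pair_iso_def using algebra_isomorphism.h[OF iso] hA by blast
    ultimately show ?thesis unfolding td_d_canonical_forms_def by auto
  qed
  \<comment> \<open>A designated array is a parameter array of the original pair and a preimage of
    the canonical form. Together with \<open>exists\<close> this gives surjectivity and the
    description of the inverse at once.\<close>
  have designated: "p \<in> ?P \<and> ?f p = (B, Bs)"
    if BBs: "(B, Bs) \<in> ?C" and des: "designated_parameter_array d B Bs p" for B Bs p
  proof -
    obtain e where can: "td_d_canonical e B Bs" and iso: "leonard_pair_iso \<A> A As (mat_algebra e) B Bs"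
      using BBs unfolding td_d_canonical_forms_def by blast
    have e: "e = d" by (rule leonard_pair_iso_diameter[OF assms can iso])
    obtain h where h_iso: "h \<in> algebra_iso \<A> ?M" and hA: "h A = B" "h As = Bs"
      using iso unfolding e leonard_pair_iso_def by blast
    interpret algebra_isomorphism \<A> ?M h
      using matrix_algebraD(2)[OF m] assoc_mat_algebra h_iso by unfold_locales
    show ?thesis
      using designated_parameter_array_matrices[OF can[unfolded e] des]
        parameter_arrays_image[OF A As, of d] unfolding hA by simp
  qed
  have exists: "\<exists>p. designated_parameter_array d B Bs p" if BBs: "(B, Bs) \<in> ?C" for B Bs
  proof -
    obtain e where can: "td_d_canonical e B Bs" and iso: "leonard_pair_iso \<A> A As (mat_algebra e) B Bs"
      using BBs unfolding td_d_canonical_forms_def by blast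
    have "e = d" by (rule leonard_pair_iso_diameter[OF assms can iso])
    then show ?thesis using designated_parameter_array_exists can by blast
  qed
  have "?f ` ?P = ?C"
  proof
    show "?C \<subseteq> ?f ` ?P"
    proof
      fix c assume c: "c \<in> ?C"
      obtain B Bs where BBs: "c = (B, Bs)" by (cases c)
      obtain p where "designated_parameter_array d B Bs p" using exists c unfolding BBs by blast
      then have "p \<in> ?P" "?f p = c" using designated[of B Bs p] c unfolding BBs by blast+
      then show "c \<in> ?f ` ?P" by (intro image_eqI[of c ?f p]) simp_all
    qed
  qed (use into in blast)
  moreover have "designated_parameter_array d B Bs p \<longleftrightarrow> p = the_inv_into ?P ?f (B, Bs)"
    if BBs: "(B, Bs) \<in> ?C" for B Bs p
  proof -
    \<comment> \<open>By injectivity every designated array is the inverse image. The converse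
      direction follows because at least one designated array exists and it must be this
      one.\<close>
    have inv: "q = the_inv_into ?P ?f (B, Bs)" if "designated_parameter_array d B Bs q" for q
      using designated[OF BBs that] the_inv_into_f_f[OF inj, of q] by simp
    then show ?thesis using exists[OF BBs] by blast
  qed
  ultimately show ?thesis using inj unfolding bij_betw_def by blast
qed

end
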